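(* Let $n\ge1$. The space of diagonal coinvariants $\mathbf{DH}_n$ satisfies $\dim\mathbf{DH}_n\ge(n+1)^{n-1}$ (the number of parking functions), and the representation of $\Sigma_n$ on $\mathbf{DH}_n$ contains $\mathbb{C}\mathrm{PF}_n\otimes\mathrm{Sign}$ as a subrepresentation, where $\mathrm{Sign}$ is the sign representation of $\Sigma_n$.
   Context: The symmetric group $\Sigma_n$ acts on $\mathbb{C}[x_1,\dots,x_n;y_1,\dots,y_n]$ by permuting the variables $x_i$ and the variables $y_i$ simultaneously. $\mathbf{DH}_n$ is the quotient of $\mathbb{C}[x_1,\dots,x_n;y_1,\dots,y_n]$ by the ideal generated by the $\Sigma_n$-invariant polynomials with zero constant term; it is a representation of $\Sigma_n$. A parking function is a function $f:\{1,\dots,n\}\to\{1,\dots,n\}$ such that $|f^{-1}(\{1,\dots,s\})|\ge s$ for $s=1,\dots,n$. $\Sigma_n$ acts on the set $\mathrm{PF}_n$ of parking functions by permuting the domain, and $\mathbb{C}\mathrm{PF}_n$ is the corresponding complex permutation representation. *)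

theory Defs
  imports
    Complex_Main
    "HOL-Library.Cardinality"
    "HOL-Library.Poly_Mapping"
    "HOL-Combinatorics.Perm"
    "HOL-Combinatorics.Permutations"
begin

text \<open>
  The index set \<open>{1..n}\<close> is an arbitrary finite type \<open>'n\<close>, with \<open>n = CARD('n)\<close>;
  the symmetric group is the type \<open>'n perm\<close> of all its permutations, with product
  \<open>(\<sigma> * \<tau>) i = \<sigma> (\<tau> i)\<close>. In \<open>'n dpoly\<close> the variable \<open>x\<^sub>i\<close> is indexed by \<open>Inl i\<close>
  and \<open>y\<^sub>i\<close> by \<open>Inr i\<close>.
\<close>

type_synonym 'n dmonom = "('n + 'n) \<Rightarrow>\<^sub>0 nat"
type_synonym 'n dpoly = "'n dmonom \<Rightarrow>\<^sub>0 complex"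

definition dvar :: "'n + 'n \<Rightarrow> 'n dpoly" where
  "dvar v = Poly_Mapping.single (Poly_Mapping.single v 1) 1"

definition dconst :: "complex \<Rightarrow> 'n dpoly" where
  "dconst c = Poly_Mapping.single 0 c"


subsection \<open>Representations of the symmetric group\<close>

locale sym_rep = vector_space scale
  for scale :: "complex \<Rightarrow> 'v::ab_group_add \<Rightarrow> 'v" +
  fixes act :: "'n perm \<Rightarrow> 'v \<Rightarrow> 'v"
  assumes act_add: "act \<sigma> (v + w) = act \<sigma> v + act \<sigma> w"
    and act_scale: "act \<sigma> (scale c v) = scale c (act \<sigma> v)"
    and act_one: "act 1 v = v"
    and act_mult: "act (\<sigma> * \<tau>) v = act \<sigma> (act \<tau> v)"

definition contains_subrep ::
  "(complex \<Rightarrow> 'v::ab_group_add \<Rightarrow> 'v) \<Rightarrow> ('n perm \<Rightarrow> 'v \<Rightarrow> 'v) \<Rightarrow>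
   (complex \<Rightarrow> 'w::ab_group_add \<Rightarrow> 'w) \<Rightarrow> ('n perm \<Rightarrow> 'w \<Rightarrow> 'w) \<Rightarrow> bool" where
  "contains_subrep scaleV actV scaleW actW \<longleftrightarrow>
     sym_rep scaleV actV \<and> sym_rep scaleW actW \<and>
     (\<exists>T. Vector_Spaces.linear scaleW scaleV T \<and> inj T \<and>
          (\<forall>\<sigma> w. T (actW \<sigma> w) = actV \<sigma> (T w)))"

text \<open>
  As Sign is one-dimensional, \<open>V \<otimes> Sign\<close> has underlying space \<open>V\<close> (identify \<open>v \<otimes> 1\<close>
  with \<open>v\<close>), on which \<open>\<sigma>\<close> acts by \<open>sign \<sigma>\<close> times its action on \<open>V\<close>.
\<close>

definition tensor_sign ::
  "(complex \<Rightarrow> 'v \<Rightarrow> 'v) \<Rightarrow> ('n perm \<Rightarrow> 'v \<Rightarrow> 'v) \<Rightarrow> 'n perm \<Rightarrow> 'v \<Rightarrow> 'v" where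
  "tensor_sign scale act \<sigma> v = scale (of_int (sign (Perm.apply \<sigma>))) (act \<sigma> v)"

lemma apply_permutation: "permutation (Perm.apply \<sigma>)"
  using Perm.apply[of \<sigma>] by (simp add: permutation)

lemma sym_rep_tensor_sign:
  assumes "sym_rep scale act"
  shows "sym_rep scale (tensor_sign scale act)"
proof -
  interpret sym_rep scale act by fact
  show ?thesis
    by unfold_locales
      (simp_all add: tensor_sign_def act_add act_scale act_one act_mult scale_right_distrib
        sign_compose apply_permutation apply_times ac_simps)
qed


subsection \<open>The action on polynomials\<close>

text \<open>
  \<^const>\<open>Poly_Mapping.map_key\<close> precomposes the coefficient function, so that \<open>\<sigma>\<close> sends the
  variables \<open>x\<^sub>i\<close>, \<open>y\<^sub>i\<close> to \<open>x\<^bsub>\<sigma> i\<^esub>\<close>, \<open>y\<^bsub>\<sigma> i\<^esub>\<close>; see lemma \<open>perm_poly_dvar\<close>.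
\<close>

definition perm_monom :: "'n perm \<Rightarrow> 'n dmonom \<Rightarrow> 'n dmonom" where
  "perm_monom \<sigma> = Poly_Mapping.map_key (map_sum (Perm.apply (inverse \<sigma>)) (Perm.apply (inverse \<sigma>)))"

definition perm_poly :: "'n perm \<Rightarrow> 'n dpoly \<Rightarrow> 'n dpoly" where
  "perm_poly \<sigma> = Poly_Mapping.map_key (perm_monom (inverse \<sigma>))"

lemma perm_apply_inverse [simp]:
  "Perm.apply (inverse \<sigma>) (Perm.apply \<sigma> i) = i"
  "Perm.apply \<sigma> (Perm.apply (inverse \<sigma>) i) = i"
  by (metis Perm.apply_sequence comp_apply apply_one id_apply perm.left_inverse)
    (metis Perm.apply_sequence comp_apply apply_one id_apply perm.right_inverse)

lemma inj_map_sum_perm: "inj (map_sum (Perm.apply \<sigma>) (Perm.apply \<sigma>))"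
  by (simp add: sum.inj_map bij_is_inj)

lemma perm_monom_mult: "perm_monom (\<sigma> * \<tau>) m = perm_monom \<sigma> (perm_monom \<tau> m)"
  unfolding perm_monom_def
  by (simp add: Poly_Mapping.map_key_compose inj_map_sum_perm perm.inverse_distrib_swap
      apply_times map_sum.comp)

lemma perm_monom_one: "perm_monom 1 m = m"
proof -
  have "perm_monom 1 m = Poly_Mapping.map_key (\<lambda>x. x) m"
    unfolding perm_monom_def by (simp add: map_sum.id flip: id_def)
  then show ?thesis by (simp add: Poly_Mapping.map_key_id)
qed

lemma perm_monom_inverse [simp]:
  "perm_monom (inverse \<sigma>) (perm_monom \<sigma> m) = m"
  "perm_monom \<sigma> (perm_monom (inverse \<sigma>) m) = m"
  by (simp_all flip: perm_monom_mult add: perm_monom_one)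

lemma inj_perm_monom: "inj (perm_monom \<sigma>)"
  by (metis injI perm_monom_inverse(1))

lemma perm_monom_add: "perm_monom \<sigma> (a + b) = perm_monom \<sigma> a + perm_monom \<sigma> b"
  unfolding perm_monom_def by (simp add: Poly_Mapping.map_key_plus inj_map_sum_perm)

lemma perm_monom_zero [simp]: "perm_monom \<sigma> 0 = 0"
  unfolding perm_monom_def by (simp add: Poly_Mapping.map_key_zero inj_map_sum_perm)

lemma perm_poly_single: "perm_poly \<sigma> (Poly_Mapping.single m c) = Poly_Mapping.single (perm_monom \<sigma> m) c"
  using Poly_Mapping.map_key_single[OF inj_perm_monom[of "inverse \<sigma>"], of "perm_monom \<sigma> m" c]
  by (simp add: perm_poly_def)

lemma perm_poly_add: "perm_poly \<sigma> (p + q) = perm_poly \<sigma> p + perm_poly \<sigma> q"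
  unfolding perm_poly_def by (simp add: Poly_Mapping.map_key_plus inj_perm_monom)

lemma perm_poly_zero [simp]: "perm_poly \<sigma> 0 = 0"
  unfolding perm_poly_def by (simp add: Poly_Mapping.map_key_zero inj_perm_monom)

lemma perm_poly_diff: "perm_poly \<sigma> (p - q) = perm_poly \<sigma> p - perm_poly \<sigma> q"
  by (metis add_diff_cancel_right' diff_add_cancel perm_poly_add)

lemma dpoly_induct [case_names zero single add]:
  assumes "P 0" "\<And>m c. P (Poly_Mapping.single m c)" "\<And>p q. P p \<Longrightarrow> P q \<Longrightarrow> P (p + q)"
  shows "P (p :: 'a \<Rightarrow>\<^sub>0 'b::comm_monoid_add)"
proof (induction p rule: Poly_Mapping.update_induct)
  case const
  show ?case by fact
next
  case (update f a b)
  have "Poly_Mapping.update a b f = Poly_Mapping.single a b + f"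
    using update(1)
    by (intro poly_mapping_eqI)
      (auto simp: lookup_update lookup_add lookup_single when_def in_keys_iff)
  then show ?case using assms update by simp
qed

lemma perm_poly_times: "perm_poly \<sigma> (p * q) = perm_poly \<sigma> p * perm_poly \<sigma> q"
proof (induction p rule: dpoly_induct)
  case (single m c)
  show ?case
    by (induction q rule: dpoly_induct)
      (simp_all add: mult_single perm_poly_single perm_monom_add perm_poly_add ring_distribs)
qed (simp_all add: perm_poly_add ring_distribs)

lemma perm_poly_dconst: "perm_poly \<sigma> (dconst c) = dconst c"
  by (simp add: dconst_def perm_poly_single)

lemma perm_poly_dvar:
  "perm_poly \<sigma> (dvar (Inl i)) = dvar (Inl (Perm.apply \<sigma> i))"
  "perm_poly \<sigma> (dvar (Inr i)) = dvar (Inr (Perm.apply \<sigma> i))"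
  using Poly_Mapping.map_key_single[OF inj_map_sum_perm[of "inverse \<sigma>"], of "Inl (Perm.apply \<sigma> i)" "1::nat"]
    Poly_Mapping.map_key_single[OF inj_map_sum_perm[of "inverse \<sigma>"], of "Inr (Perm.apply \<sigma> i)" "1::nat"]
  by (simp_all add: dvar_def perm_poly_single perm_monom_def del: One_nat_def)

lemma perm_poly_mult: "perm_poly (\<sigma> * \<tau>) p = perm_poly \<sigma> (perm_poly \<tau> p)"
  by (induction p rule: dpoly_induct) (simp_all add: perm_poly_single perm_monom_mult perm_poly_add)

lemma perm_poly_one: "perm_poly 1 p = p"
  by (induction p rule: dpoly_induct) (simp_all add: perm_poly_single perm_monom_one perm_poly_add)


subsection \<open>Diagonal coinvariants\<close>

interpretation dpoly_module: module "(*) :: 'n dpoly \<Rightarrow> 'n dpoly \<Rightarrow> 'n dpoly"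
  by unfold_locales (simp_all add: algebra_simps)

definition invariants_pos :: "'n dpoly set" where
  "invariants_pos = {p. (\<forall>\<sigma>. perm_poly \<sigma> p = p) \<and> Poly_Mapping.lookup p 0 = 0}"

text \<open>The span in the polynomial ring, as a module over itself, is the generated ideal.\<close>

definition coinv_ideal :: "'n dpoly set" where
  "coinv_ideal = dpoly_module.span invariants_pos"

lemma coinv_ideal_zero: "0 \<in> coinv_ideal"
  and coinv_ideal_add: "p \<in> coinv_ideal \<Longrightarrow> q \<in> coinv_ideal \<Longrightarrow> p + q \<in> coinv_ideal"
  and coinv_ideal_diff: "p \<in> coinv_ideal \<Longrightarrow> q \<in> coinv_ideal \<Longrightarrow> p - q \<in> coinv_ideal"
  and coinv_ideal_minus: "p \<in> coinv_ideal \<Longrightarrow> - p \<in> coinv_ideal"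
  and coinv_ideal_mult: "p \<in> coinv_ideal \<Longrightarrow> r * p \<in> coinv_ideal"
  unfolding coinv_ideal_def
  by (auto intro: dpoly_module.span_zero dpoly_module.span_add dpoly_module.span_diff
      dpoly_module.span_neg dpoly_module.span_scale)

lemma coinv_ideal_perm:
  assumes "p \<in> coinv_ideal"
  shows "perm_poly \<sigma> p \<in> coinv_ideal"
  using assms unfolding coinv_ideal_def
proof (induction rule: dpoly_module.span_induct_alt)
  case base
  then show ?case by (simp add: dpoly_module.span_zero)
next
  case (step c x y)
  then have "perm_poly \<sigma> x \<in> dpoly_module.span invariants_pos"
    by (auto simp: invariants_pos_def intro!: dpoly_module.span_base)
  then show ?case
    using step
    by (simp add: perm_poly_add perm_poly_times dpoly_module.span_add dpoly_module.span_scale)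
qed

definition coinv_rel :: "'n dpoly \<Rightarrow> 'n dpoly \<Rightarrow> bool" where
  "coinv_rel p q \<longleftrightarrow> p - q \<in> coinv_ideal"

lemma equivp_coinv_rel: "equivp (coinv_rel :: 'n dpoly \<Rightarrow> 'n dpoly \<Rightarrow> bool)"
proof (rule equivpI)
  show "reflp (coinv_rel :: 'n dpoly \<Rightarrow> _)"
    by (simp add: reflp_def coinv_rel_def coinv_ideal_zero)
  show "symp (coinv_rel :: 'n dpoly \<Rightarrow> _)"
    by (metis coinv_rel_def coinv_ideal_minus minus_diff_eq sympI)
  show "transp (coinv_rel :: 'n dpoly \<Rightarrow> _)"
  proof (rule transpI)
    fix p q r :: "'n dpoly"
    assume "coinv_rel p q" "coinv_rel q r"
    then have "(p - q) + (q - r) \<in> coinv_ideal"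
      unfolding coinv_rel_def by (rule coinv_ideal_add)
    then show "coinv_rel p r" by (simp add: coinv_rel_def)
  qed
qed

quotient_type 'n DH = "('n::finite) dpoly" / coinv_rel
  by (rule equivp_coinv_rel)

instantiation DH :: (finite) ab_group_add
begin

lift_definition zero_DH :: "'a DH" is 0 .

lift_definition plus_DH :: "'a DH \<Rightarrow> 'a DH \<Rightarrow> 'a DH" is "(+)"
  unfolding coinv_rel_def by (metis add_diff_add coinv_ideal_add)

lift_definition minus_DH :: "'a DH \<Rightarrow> 'a DH \<Rightarrow> 'a DH" is "(-)"
proof -
  fix p q r s :: "'a dpoly"
  assume "coinv_rel p q" "coinv_rel r s"
  then have "(p - q) - (r - s) \<in> coinv_ideal"
    unfolding coinv_rel_def by (rule coinv_ideal_diff)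
  then show "coinv_rel (p - r) (q - s)"
    by (simp add: coinv_rel_def algebra_simps)
qed

lift_definition uminus_DH :: "'a DH \<Rightarrow> 'a DH" is uminus
  unfolding coinv_rel_def by (metis coinv_ideal_minus minus_diff_minus)

instance
  by standard (transfer; simp add: coinv_rel_def coinv_ideal_zero algebra_simps)+

end

lift_definition scale_DH :: "complex \<Rightarrow> 'n::finite DH \<Rightarrow> 'n DH" is "\<lambda>c p. dconst c * p"
  unfolding coinv_rel_def by (metis coinv_ideal_mult right_diff_distrib)

lift_definition perm_DH :: "'n::finite perm \<Rightarrow> 'n DH \<Rightarrow> 'n DH" is perm_poly
  unfolding coinv_rel_def by (metis coinv_ideal_perm perm_poly_diff)

interpretation DH: sym_rep scale_DH perm_DH
proof
  fix a b :: complex and x y :: "'n::finite DH" and \<sigma> \<tau> :: "'n perm"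
  show "scale_DH a (x + y) = scale_DH a x + scale_DH a y"
    by transfer (simp add: coinv_rel_def coinv_ideal_zero algebra_simps)
  show "scale_DH (a + b) x = scale_DH a x + scale_DH b x"
    by transfer (simp add: coinv_rel_def coinv_ideal_zero dconst_def single_add algebra_simps)
  show "scale_DH a (scale_DH b x) = scale_DH (a * b) x"
    by transfer (simp add: coinv_rel_def coinv_ideal_zero dconst_def mult_single flip: mult.assoc)
  show "scale_DH 1 x = x"
    by transfer (simp add: coinv_rel_def coinv_ideal_zero dconst_def)
  show "perm_DH \<sigma> (x + y) = perm_DH \<sigma> x + perm_DH \<sigma> y"
    by transfer (simp add: coinv_rel_def coinv_ideal_zero perm_poly_add)
  show "perm_DH \<sigma> (scale_DH a x) = scale_DH a (perm_DH \<sigma> x)"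
    by transfer (simp add: coinv_rel_def coinv_ideal_zero perm_poly_times perm_poly_dconst)
  show "perm_DH 1 x = x"
    by transfer (simp add: coinv_rel_def coinv_ideal_zero perm_poly_one)
  show "perm_DH (\<sigma> * \<tau>) x = perm_DH \<sigma> (perm_DH \<tau> x)"
    by transfer (simp add: coinv_rel_def coinv_ideal_zero perm_poly_mult)
qed


subsection \<open>Parking functions\<close>

definition parking_functions :: "('n::finite \<Rightarrow> nat) set" where
  "parking_functions =
     {f. range f \<subseteq> {1..CARD('n)} \<and> (\<forall>s\<in>{1..CARD('n)}. card (f -` {1..s}) \<ge> s)}"

typedef (overloaded) 'n pf = "parking_functions :: ('n::finite \<Rightarrow> nat) set"
proof
  have "(\<lambda>_::'n. 1::nat) -` {1..s} = UNIV" if "s \<in> {1..CARD('n)}" for s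
    using that by auto
  then show "(\<lambda>_. 1) \<in> (parking_functions :: ('n \<Rightarrow> nat) set)"
    by (auto simp: parking_functions_def Suc_le_eq)
qed

setup_lifting type_definition_pf

lift_definition perm_pf :: "'n::finite perm \<Rightarrow> 'n pf \<Rightarrow> 'n pf"
  is "\<lambda>\<sigma> f. f \<circ> Perm.apply (inverse \<sigma>)"
proof -
  fix \<sigma> :: "'n perm" and f :: "'n \<Rightarrow> nat"
  have "card ((f \<circ> Perm.apply (inverse \<sigma>)) -` A) = card (f -` A)" for A
    unfolding vimage_comp[symmetric] by (rule card_vimage_inj) (simp_all add: bij_is_inj bij_is_surj)
  moreover assume "f \<in> parking_functions"
  ultimately show "f \<circ> Perm.apply (inverse \<sigma>) \<in> parking_functions"
    by (auto simp: parking_functions_def)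
qed

lemma perm_pf_mult: "perm_pf (\<sigma> * \<tau>) f = perm_pf \<sigma> (perm_pf \<tau> f)"
  by transfer (simp add: perm.inverse_distrib_swap apply_times comp_assoc)

lemma perm_pf_one: "perm_pf 1 f = f"
  by transfer simp

lemma perm_pf_inverse [simp]:
  "perm_pf (inverse \<sigma>) (perm_pf \<sigma> f) = f"
  "perm_pf \<sigma> (perm_pf (inverse \<sigma>) f) = f"
  by (simp_all flip: perm_pf_mult add: perm_pf_one)

lemma inj_perm_pf: "inj (perm_pf \<sigma>)"
  by (metis injI perm_pf_inverse(1))

text \<open>
  The complex vector space with basis the parking functions; \<open>\<sigma>\<close> permutes the basis
  vectors, see lemma \<open>perm_CPF_single\<close>.
\<close>

type_synonym 'n CPF = "'n pf \<Rightarrow>\<^sub>0 complex"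

definition scale_CPF :: "complex \<Rightarrow> 'n::finite CPF \<Rightarrow> 'n CPF" where
  "scale_CPF c = Poly_Mapping.map ((*) c)"

definition perm_CPF :: "'n::finite perm \<Rightarrow> 'n CPF \<Rightarrow> 'n CPF" where
  "perm_CPF \<sigma> = Poly_Mapping.map_key (perm_pf (inverse \<sigma>))"

lemma perm_CPF_single:
  "perm_CPF \<sigma> (Poly_Mapping.single f c) = Poly_Mapping.single (perm_pf \<sigma> f) c"
  using Poly_Mapping.map_key_single[OF inj_perm_pf[of "inverse \<sigma>"], of "perm_pf \<sigma> f" c]
  by (simp add: perm_CPF_def)

lemma lookup_scale_CPF: "Poly_Mapping.lookup (scale_CPF c v) f = c * Poly_Mapping.lookup v f"
  unfolding scale_CPF_def by (simp add: Poly_Mapping.map.rep_eq when_def)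

lemma lookup_perm_CPF:
  "Poly_Mapping.lookup (perm_CPF \<sigma> v) f = Poly_Mapping.lookup v (perm_pf (inverse \<sigma>) f)"
  unfolding perm_CPF_def by (simp add: Poly_Mapping.map_key.rep_eq inj_perm_pf)

interpretation CPF: sym_rep scale_CPF perm_CPF
  by unfold_locales
    (auto intro!: poly_mapping_eqI
      simp: lookup_scale_CPF lookup_perm_CPF lookup_add perm_pf_one perm_pf_mult
        perm.inverse_distrib_swap algebra_simps)

end

theory Submission
  imports
    Defs
    "HOL-Library.Function_Algebras"
    "HOL-Computational_Algebra.Fundamental_Theorem_Algebra"
begin

text \<open>
  The coinvariants are bounded from below by exhibiting a quotient of them, obtained by degenerating
  a noncommutative deformation. Suppose that \<open>M\<close> is a finite-dimensional representation of the
  symmetric group, with further operators \<open>X\<^sub>i\<close> and \<open>Y\<^sub>i\<close> permuted by the group. Let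
  them commute up to terms of lower degree in the \<open>Y\<close>'s, and let \<open>M\<close> be generated by an
  invariant vector \<open>w\<close>. The associated graded module for the filtration by degree in the
  \<open>Y\<close>'s is a cyclic module over the polynomial ring in commuting variables. If the invariants
  of \<open>M\<close> are spanned by \<open>w\<close> alone, then invariant polynomials act on the generator of the
  graded module by scalars; those without constant term kill it once the \<open>X\<^sub>i\<close>, recentred by
  a common constant, are nilpotent. Hence the graded module is a quotient of the diagonal
  coinvariants, and it is isomorphic to \<open>M\<close> as a representation because the group is finite
  (\<open>deformation_contained_in_DH\<close>).

  A module with one-dimensional invariants over the trigonometric Cherednik algebra does all this.
  The only point that is not formal is nilpotency. It follows from the fact that commutators of
  invariant elements of the algebra act by zero on the line of invariants, which determines all power
  sums of the \<open>X\<^sub>i\<close> (\<open>power_sum_w\<close>, \<open>spherical_module_contained_in_DH\<close>).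

  The module needed here is the one of dimension \<open>(n + 1)\<^sup>n\<^sup>-\<^sup>1\<close> at parameter \<open>(n + 1) / n\<close>. It
  is realised in seminormal form: functions on affine permutations \<open>u\<close> of period \<open>n\<close>, on which
  the simple reflections act by explicit \<open>2 \<times> 2\<close> blocks that depend on the differences
  \<open>u (i + 1) - u i\<close>. The affine permutations in which \<open>k\<close> always occurs before \<open>k + n + 1\<close> form a
  bounded region, modulo shifting the values, and functions on it are a quotient module. Writing the
  normalised values of such an element as \<open>(n + 1) r - n f\<close> with \<open>0 \<le> r < n\<close> identifies
  the region with the parking functions \<open>f\<close>. There is an explicit product giving the invariant
  vector, invariants are unique because a reflection fixing a parking function acts by \<open>-1\<close>, and
  irreducibility follows since the joint spectrum of the commuting operators is simple
  (\<open>pf_module_contained_in_DH\<close>).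

  Finally, the restriction of this module to the symmetric group decomposes along the orbits of
  parking functions; each summand is generated by the point mass at a sorted parking function, on which
  the stabilizer acts by the sign. This identifies the module with the permutation representation on
  parking functions twisted by the sign (\<open>pf_module_contains_CPF\<close>).
\<close>

section \<open>Equivariant linear algebra over the symmetric group\<close>

lemma finite_perm_UNIV: "finite (UNIV :: 'n::finite perm set)"
proof (rule finite_imageD)
  show "finite (range (Perm.apply :: 'n perm \<Rightarrow> _))"
    by (rule finite_subset[OF subset_UNIV]) simp
  show "inj (Perm.apply :: 'n perm \<Rightarrow> _)"
    by (simp add: Perm.apply_inject inj_def)
qed

text \<open>
  Averaging over the group turns any linear map into an equivariant one; applied to a linear
  projection it gives invariant complements (Maschke), applied to a linear section it gives
  equivariant sections.
\<close>
definition avg_map :: "(complex \<Rightarrow> 'w::ab_group_add \<Rightarrow> 'w) \<Rightarrow> ('n perm \<Rightarrow> 'w \<Rightarrow> 'w) \<Rightarrow>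
    ('n perm \<Rightarrow> 'v \<Rightarrow> 'v) \<Rightarrow> ('v \<Rightarrow> 'w) \<Rightarrow> 'v \<Rightarrow> 'w" where
  "avg_map scaleW actW actV f v =
     scaleW (1 / of_nat CARD('n perm)) (\<Sum>\<sigma>\<in>UNIV. actW \<sigma> (f (actV (inverse \<sigma>) v)))"

lemma linear_scaleI:
  assumes "vector_space s1" "vector_space s2"
    and "\<And>x y. f (x + y) = f x + f y" "\<And>c x. f (s1 c x) = s2 c (f x)"
  shows "Vector_Spaces.linear s1 s2 f"
  using assms by (simp add: Vector_Spaces.linear_def module_hom_def module_hom_axioms_def vector_space_def module_def)

lemma (in sym_rep) act_linear: "Vector_Spaces.linear scale scale (act \<sigma>)"
  by (rule linear_scaleI) (simp_all add: vector_space_axioms act_add act_scale)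

lemma (in sym_rep) act_inverse [simp]: "act (inverse \<sigma>) (act \<sigma> v) = v" "act \<sigma> (act (inverse \<sigma>) v) = v"
  by (simp_all flip: act_mult add: perm.left_inverse perm.right_inverse act_one)

context
  fixes scaleV :: "complex \<Rightarrow> 'v::ab_group_add \<Rightarrow> 'v" and actV :: "'n::finite perm \<Rightarrow> 'v \<Rightarrow> 'v"
    and scaleW :: "complex \<Rightarrow> 'w::ab_group_add \<Rightarrow> 'w" and actW :: "'n perm \<Rightarrow> 'w \<Rightarrow> 'w"
    and f :: "'v \<Rightarrow> 'w"
  assumes V: "sym_rep scaleV actV" and W: "sym_rep scaleW actW"
    and f: "Vector_Spaces.linear scaleV scaleW f"
begin

interpretation V: sym_rep scaleV actV by (rule V)
interpretation W: sym_rep scaleW actW by (rule W)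
interpretation f: Vector_Spaces.linear scaleV scaleW f by (rule f)

lemma linear_avg_map: "Vector_Spaces.linear scaleV scaleW (avg_map scaleW actW actV f)"
proof (rule linear_scaleI)
  fix x y c
  show "avg_map scaleW actW actV f (x + y) = avg_map scaleW actW actV f x + avg_map scaleW actW actV f y"
    by (simp add: avg_map_def V.act_add W.act_add f.add sum.distrib W.scale_right_distrib)
  show "avg_map scaleW actW actV f (scaleV c x) = scaleW c (avg_map scaleW actW actV f x)"
    unfolding avg_map_def V.act_scale f.scale W.act_scale W.scale_sum_right[symmetric]
    by (rule W.scale_left_commute)
qed (rule V.vector_space_axioms W.vector_space_axioms)+

lemma equivariant_avg_map:
  "avg_map scaleW actW actV f (actV \<tau> v) = actW \<tau> (avg_map scaleW actW actV f v)"
proof -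
  interpret A: Vector_Spaces.linear scaleW scaleW "actW \<tau>" by (rule W.act_linear)
  have "(\<Sum>\<sigma>\<in>UNIV. actW \<sigma> (f (actV (inverse \<sigma>) (actV \<tau> v))))
      = (\<Sum>\<sigma>\<in>UNIV. actW (\<tau> * \<sigma>) (f (actV (inverse (\<tau> * \<sigma>)) (actV \<tau> v))))"
    by (rule sum.reindex_bij_witness[of _ "\<lambda>\<sigma>. \<tau> * \<sigma>" "\<lambda>\<sigma>. inverse \<tau> * \<sigma>"])
      (simp_all flip: mult.assoc add: perm.left_inverse perm.right_inverse)
  also have "\<dots> = actW \<tau> (\<Sum>\<sigma>\<in>UNIV. actW \<sigma> (f (actV (inverse \<sigma>) v)))"
    by (simp add: A.sum W.act_mult perm.inverse_distrib_swap V.act_mult)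
  finally show ?thesis by (simp add: avg_map_def W.act_scale)
qed

lemma avg_map_fixed:
  assumes "\<And>\<sigma>. actW \<sigma> (f (actV (inverse \<sigma>) v)) = u"
  shows "avg_map scaleW actW actV f v = u"
proof -
  have "avg_map scaleW actW actV f v = scaleW (1 / of_nat CARD('n perm)) (\<Sum>\<sigma>\<in>(UNIV::'n perm set). u)"
    using assms by (simp add: avg_map_def)
  also have "\<dots> = u"
    using finite_perm_UNIV[where 'n='n] unfolding W.sum_constant_scale by simp
  finally show ?thesis .
qed

end

lemma equivariant_projection_exists:
  fixes act :: "'n::finite perm \<Rightarrow> 'v \<Rightarrow> 'v::ab_group_add"
  assumes V: "sym_rep scale act" and U: "module.subspace scale U"
    and inv: "\<And>\<sigma> u. u \<in> U \<Longrightarrow> act \<sigma> u \<in> U"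
  obtains P where "Vector_Spaces.linear scale scale P" "\<And>v. P v \<in> U" "\<And>u. u \<in> U \<Longrightarrow> P u = u"
    "\<And>\<sigma> v. P (act \<sigma> v) = act \<sigma> (P v)"
proof -
  interpret V: sym_rep scale act by fact
  interpret VV: vector_space_pair scale scale by unfold_locales
  have "\<exists>g. range g \<subseteq> U \<and> Vector_Spaces.linear scale scale g \<and> (\<forall>v\<in>U. g (id v) = v)"
    by (rule VV.linear_exists_left_inverse_on) (use U V.linear_id in \<open>auto simp: id_def\<close>)
  then obtain g where g: "range g \<subseteq> U" "Vector_Spaces.linear scale scale g" "\<And>v. v \<in> U \<Longrightarrow> g v = v"
    by auto
  let ?P = "avg_map scale act act g"
  show ?thesis
  proof (rule that)
    show "Vector_Spaces.linear scale scale ?P" by (rule linear_avg_map[OF V V g(2)])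
    show "?P (act \<sigma> v) = act \<sigma> (?P v)" for \<sigma> v by (rule equivariant_avg_map[OF V V g(2)])
    show "?P v \<in> U" for v
      unfolding avg_map_def using g(1)
      by (intro V.subspace_scale[OF U] V.subspace_sum[OF U] inv) auto
    show "?P u = u" if "u \<in> U" for u
      by (rule avg_map_fixed[OF V V g(2)]) (use inv[OF that] g(3) in simp)
  qed
qed

lemma equivariant_section_exists:
  fixes actV :: "'n::finite perm \<Rightarrow> 'v \<Rightarrow> 'v::ab_group_add"
    and actW :: "'n perm \<Rightarrow> 'w \<Rightarrow> 'w::ab_group_add"
  assumes V: "sym_rep scaleV actV" and W: "sym_rep scaleW actW"
    and f: "Vector_Spaces.linear scaleV scaleW f" and surj: "surj f"
    and equi: "\<And>\<sigma> v. f (actV \<sigma> v) = actW \<sigma> (f v)"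
  obtains g where "Vector_Spaces.linear scaleW scaleV g" "\<And>w. f (g w) = w"
    "\<And>\<sigma> w. g (actW \<sigma> w) = actV \<sigma> (g w)"
proof -
  interpret V: sym_rep scaleV actV by fact
  interpret W: sym_rep scaleW actW by fact
  interpret VW: vector_space_pair scaleV scaleW by unfold_locales
  interpret f: Vector_Spaces.linear scaleV scaleW f by fact
  have "\<exists>g. range g \<subseteq> V.span UNIV \<and> Vector_Spaces.linear scaleW scaleV g \<and>
      (\<forall>x\<in>W.span UNIV. f (g x) = x)"
    by (rule VW.linear_surj_right_inverse) (use f surj in auto)
  then obtain g where g: "Vector_Spaces.linear scaleW scaleV g" "\<And>w. f (g w) = w"
    by auto
  let ?g = "avg_map scaleV actV actW g"
  have "f (?g w) = w" for w
  proof -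
    have "f (?g w) = avg_map scaleW actW actW id w"
      by (simp add: avg_map_def f.scale f.sum equi g)
    also have "\<dots> = w" by (rule avg_map_fixed[OF W W]) (use W.linear_id in \<open>auto simp: id_def\<close>)
    finally show ?thesis .
  qed
  from linear_avg_map[OF W V g(1)] this equivariant_avg_map[OF W V g(1)] show ?thesis by (rule that)
qed

text \<open>Complete reducibility: a quotient representation is also a subrepresentation.\<close>
lemma contains_subrep_of_surjection:
  fixes actV :: "'n::finite perm \<Rightarrow> 'v \<Rightarrow> 'v::ab_group_add"
    and actW :: "'n perm \<Rightarrow> 'w \<Rightarrow> 'w::ab_group_add"
  assumes "sym_rep scaleV actV" "sym_rep scaleW actW" "Vector_Spaces.linear scaleV scaleW f" "surj f"
    and "\<And>\<sigma> v. f (actV \<sigma> v) = actW \<sigma> (f v)"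
  shows "contains_subrep scaleV actV scaleW actW"
proof -
  obtain g where g: "Vector_Spaces.linear scaleW scaleV g" "\<And>w. f (g w) = w"
      "\<And>\<sigma> w. g (actW \<sigma> w) = actV \<sigma> (g w)"
    by (rule equivariant_section_exists[of scaleV actV scaleW actW f, OF assms(1-5)]) (rule that)
  have "inj g" by (rule inj_on_inverseI) (rule g(2))
  then have "\<exists>T. Vector_Spaces.linear scaleW scaleV T \<and> inj T \<and> (\<forall>\<sigma> w. T (actW \<sigma> w) = actV \<sigma> (T w))"
    by (intro exI[of _ g] conjI allI g)
  with assms(1,2) show ?thesis by (simp add: contains_subrep_def)
qed

section \<open>Noncommutative deformations of the diagonal coinvariants\<close>

abbreviation ydeg :: "('a + 'b) list \<Rightarrow> nat" where
  "ydeg c \<equiv> length (filter (\<lambda>a. \<not> isl a) c)"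

lemma ydeg_mset_cong: "mset c = mset d \<Longrightarrow> ydeg c = ydeg d"
  by (metis mset_filter size_mset)

lemma isl_map_sum_iff [simp]: "isl (map_sum f h a) = isl a"
  by (cases a) simp_all

text \<open>Some ordering of the letters of a monomial; up to lower order the choice will not matter.\<close>
definition word_of :: "'n dmonom \<Rightarrow> ('n::finite + 'n) list" where
  "word_of m = (SOME c. count (mset c) = Poly_Mapping.lookup m)"

lemma count_word_of: "count (mset (word_of m)) = Poly_Mapping.lookup m"
proof -
  have "count (Abs_multiset (Poly_Mapping.lookup m)) = Poly_Mapping.lookup m"
    by (rule count_Abs_multiset) simp
  then have "\<exists>c. count (mset c) = Poly_Mapping.lookup m"
    by (metis ex_mset)
  then show ?thesis unfolding word_of_def by (rule someI_ex)
qed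

lemma mset_word_of_add: "mset (word_of (a + b)) = mset (word_of a @ word_of b)"
  by (rule multiset_eqI) (simp add: count_word_of lookup_add)

lemma count_image_mset_inj: "inj f \<Longrightarrow> count (image_mset f M) (f x) = count M x"
  by (induction M) (auto simp: inj_eq)

lemma mset_word_of_perm:
  "mset (word_of (perm_monom \<sigma> m)) = mset (map (map_sum (Perm.apply \<sigma>) (Perm.apply \<sigma>)) (word_of m))"
proof (rule multiset_eqI)
  fix a
  let ?f = "map_sum (Perm.apply \<sigma>) (Perm.apply \<sigma>)"
  let ?g = "map_sum (Perm.apply (inverse \<sigma>)) (Perm.apply (inverse \<sigma>))"
  have a: "a = ?f (?g a)" by (cases a) simp_all
  have "count (mset (map ?f (word_of m))) (?f (?g a)) = count (mset (word_of m)) (?g a)"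
    using inj_map_sum_perm[of \<sigma>] by (simp only: mset_map count_image_mset_inj)
  then show "count (mset (word_of (perm_monom \<sigma> m))) a = count (mset (map ?f (word_of m))) a"
    using a by (simp add: count_word_of perm_monom_def Poly_Mapping.map_key.rep_eq inj_map_sum_perm)
qed

text \<open>
  A letter \<open>Inl i\<close> or \<open>Inr i\<close> acts by an operator deforming multiplication by \<open>x\<^sub>i\<close> or
  \<open>y\<^sub>i\<close>. Only the \<open>y\<close>'s carry degree, and commutators may be corrected by group elements and
  words of lower degree; for two \<open>x\<close>'s no such word exists, so they commute exactly. The last
  assumption says that the \<open>x\<close>'s have a common null vector among the vectors that they
  generate from \<open>w\<close>; it makes every symmetric polynomial in the \<open>x\<close>'s without constant
  term kill \<open>w\<close>.
\<close>
locale deformed_coinvariants = sym_rep scale act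
  for scale :: "complex \<Rightarrow> 'v::ab_group_add \<Rightarrow> 'v" and act :: "'n::finite perm \<Rightarrow> 'v \<Rightarrow> 'v" +
  fixes g :: "'n + 'n \<Rightarrow> 'v \<Rightarrow> 'v" and w :: 'v
  assumes g_linear: "Vector_Spaces.linear scale scale (g a)"
    and g_equivariant: "act \<sigma> (g a v) = g (map_sum (Perm.apply \<sigma>) (Perm.apply \<sigma>) a) (act \<sigma> v)"
    and g_commutator: "g a (g b v) - g b (g a v) \<in> span {foldr g c (act \<sigma> v) | c \<sigma>. ydeg c < ydeg [a, b]}"
    and w_invariant: "act \<sigma> w = w"
    and invariants: "(\<And>\<sigma>. act \<sigma> v = v) \<Longrightarrow> v \<in> span {w}"
    and generates: "span (range (\<lambda>c. foldr g c w)) = UNIV"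
    and x_socle: "\<exists>v \<in> span ((\<lambda>c. foldr g c w) ` lists (range Inl)). v \<noteq> 0 \<and> (\<forall>i. g (Inl i) v = 0)"
begin

abbreviation ev :: "('n + 'n) list \<Rightarrow> 'v \<Rightarrow> 'v" where "ev c \<equiv> foldr g c"

lemma ev_linear: "Vector_Spaces.linear scale scale (ev c)"
proof (induction c)
  case Nil
  show ?case using linear_id by (simp add: id_def[abs_def])
next
  case (Cons a c)
  from Vector_Spaces.linear_compose[OF Cons g_linear[of a]] show ?case by (simp add: comp_def)
qed

lemma ev_equivariant: "act \<sigma> (ev c v) = ev (map (map_sum (Perm.apply \<sigma>) (Perm.apply \<sigma>)) c) (act \<sigma> v)"
  by (induction c) (simp_all add: g_equivariant)

text \<open>
  The bound on the degree is strict, so that \<open>filt 0 = {0}\<close>: this makes the exact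
  statements about words in the \<open>x\<close>'s instances of the statements modulo lower order.
\<close>
definition filt :: "nat \<Rightarrow> 'v set" where
  "filt k = span {ev c w | c. ydeg c < k}"

lemma subspace_filt: "subspace (filt k)"
  by (simp add: filt_def)

lemma ev_in_filt: "ydeg c < k \<Longrightarrow> ev c w \<in> filt k"
  unfolding filt_def by (rule span_base) auto

lemma filt_0: "filt 0 = {0}"
  by (simp add: filt_def)

lemma ev_filt: "v \<in> filt k \<Longrightarrow> ev c v \<in> filt (ydeg c + k)"
proof -
  interpret L: Vector_Spaces.linear scale scale "ev c" by (rule ev_linear)
  assume "v \<in> filt k"
  then show ?thesis
    unfolding filt_def[of k]
  proof (induction rule: span_induct_alt)
    case base
    show ?case using subspace_filt by (simp add: L.zero subspace_0)
  next
    case (step a x y)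
    then obtain d where "x = ev d w" "ydeg d < k" by auto
    then have "ev c x \<in> filt (ydeg c + k)" using ev_in_filt[of "c @ d"] by simp
    with step show ?case
      using subspace_filt by (simp add: L.add L.scale subspace_add subspace_scale)
  qed
qed

lemma act_filt: "v \<in> filt k \<Longrightarrow> act \<sigma> v \<in> filt k"
proof -
  interpret L: Vector_Spaces.linear scale scale "act \<sigma>" by (rule act_linear)
  assume "v \<in> filt k"
  then show ?thesis
    unfolding filt_def[of k]
  proof (induction rule: span_induct_alt)
    case base
    show ?case using subspace_filt by (simp add: L.zero subspace_0 flip: filt_def)
  next
    case (step a x y)
    then obtain d where "x = ev d w" "ydeg d < k" by auto
    then have "act \<sigma> x \<in> filt k"
      using ev_in_filt[of "map (map_sum (Perm.apply \<sigma>) (Perm.apply \<sigma>)) d"]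
      by (simp add: ev_equivariant w_invariant filter_map comp_def)
    with step show ?case
      using subspace_filt by (simp add: L.add L.scale subspace_add subspace_scale flip: filt_def)
  qed
qed

text \<open>
  The group element in the correction term moves past the remaining letters, permuting their
  indices, until it is absorbed by the invariant vector.
\<close>
lemma ev_swap: "ev (us @ a # b # vs) w - ev (us @ b # a # vs) w \<in> filt (ydeg (us @ a # b # vs))"
proof -
  interpret L: Vector_Spaces.linear scale scale "ev us" by (rule ev_linear)
  let ?v = "ev vs w"
  let ?S = "{ev c (act \<sigma> ?v) | c \<sigma>. ydeg c < ydeg [a, b]}"
  have "ev us x \<in> filt (ydeg (us @ a # b # vs))" if "x \<in> span ?S" for x
    using that
  proof (induction rule: span_induct_alt)
    case base
    show ?case using subspace_filt by (simp add: L.zero subspace_0)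
  next
    case (step e x y)
    then obtain c \<sigma> where x: "x = ev c (act \<sigma> ?v)" "ydeg c < ydeg [a, b]" by blast
    have "ev (us @ c @ map (map_sum (Perm.apply \<sigma>) (Perm.apply \<sigma>)) vs) w \<in> filt (ydeg (us @ a # b # vs))"
      by (rule ev_in_filt) (use x(2) in \<open>auto simp: filter_map comp_def split: if_splits\<close>)
    then have "ev us x \<in> filt (ydeg (us @ a # b # vs))"
      by (simp add: x ev_equivariant w_invariant)
    with step show ?case
      using subspace_filt by (simp add: L.add L.scale subspace_add subspace_scale)
  qed
  from this[OF g_commutator] show ?thesis by (simp add: L.diff)
qed

lemma filt_diff_trans: "a - b \<in> filt k \<Longrightarrow> b - c \<in> filt k \<Longrightarrow> a - c \<in> filt k"
  using subspace_add[OF subspace_filt, of "a - b" k "b - c"] by simp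

lemma ev_move: "ev (us @ vs @ a # ts) w - ev (us @ a # vs @ ts) w \<in> filt (ydeg (us @ a # vs @ ts))"
proof (induction vs arbitrary: us)
  case Nil
  show ?case using subspace_filt by (simp add: subspace_0)
next
  case (Cons b vs)
  have "ev (us @ b # vs @ a # ts) w - ev (us @ b # a # vs @ ts) w \<in> filt (ydeg (us @ a # b # vs @ ts))"
    using Cons.IH[of "us @ [b]"] by (auto split: if_splits)
  moreover have "ev (us @ b # a # vs @ ts) w - ev (us @ a # b # vs @ ts) w \<in> filt (ydeg (us @ a # b # vs @ ts))"
    using ev_swap[of us b a "vs @ ts"] by (auto split: if_splits)
  ultimately show ?case by (auto dest: filt_diff_trans)
qed

lemma ev_reorder:
  "mset xs = mset ys \<Longrightarrow> ev (us @ xs) w - ev (us @ ys) w \<in> filt (ydeg (us @ xs))"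
proof (induction xs arbitrary: us ys)
  case Nil
  then show ?case using subspace_filt by (simp add: subspace_0)
next
  case (Cons a xs)
  then have "a \<in> set ys" by (metis list.set_intros(1) set_mset_mset)
  then obtain y1 y2 where ys: "ys = y1 @ a # y2" by (meson split_list)
  with Cons.prems have m: "mset xs = mset (y1 @ y2)" by simp
  have "ev ((us @ [a]) @ xs) w - ev ((us @ [a]) @ y1 @ y2) w \<in> filt (ydeg ((us @ [a]) @ xs))"
    by (rule Cons.IH[OF m])
  moreover have "ev (us @ ys) w - ev (us @ a # y1 @ y2) w \<in> filt (ydeg (us @ a # y1 @ y2))"
    unfolding ys by (rule ev_move)
  then have "ev (us @ a # y1 @ y2) w - ev (us @ ys) w \<in> filt (ydeg (us @ a # y1 @ y2))"
    using subspace_neg[OF subspace_filt] by fastforce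
  moreover have "ydeg (us @ a # y1 @ y2) = ydeg (us @ a # xs)"
    by (rule ydeg_mset_cong) (simp add: m)
  ultimately show ?case by (auto intro: filt_diff_trans split: if_splits)
qed

lemma ev_reorder': "mset xs = mset ys \<Longrightarrow> ev xs w - ev ys w \<in> filt (ydeg xs)"
  using ev_reorder[of xs ys "[]"] by simp

text \<open>
  The associated graded module is not formed as a quotient: an equivariant projection onto each
  filtration step lets the module itself play that role.
\<close>
definition proj :: "nat \<Rightarrow> 'v \<Rightarrow> 'v" where
  "proj k = (SOME P. Vector_Spaces.linear scale scale P \<and> (\<forall>v. P v \<in> filt k) \<and> (\<forall>u\<in>filt k. P u = u) \<and>
     (\<forall>\<sigma> v. P (act \<sigma> v) = act \<sigma> (P v)))"

lemma proj: "Vector_Spaces.linear scale scale (proj k)" "proj k v \<in> filt k"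
    "u \<in> filt k \<Longrightarrow> proj k u = u" "proj k (act \<sigma> v) = act \<sigma> (proj k v)"
proof -
  have "\<exists>P. Vector_Spaces.linear scale scale P \<and> (\<forall>v. P v \<in> filt k) \<and> (\<forall>u\<in>filt k. P u = u) \<and>
     (\<forall>\<sigma> v. P (act \<sigma> v) = act \<sigma> (P v))"
    by (rule equivariant_projection_exists[OF sym_rep_axioms subspace_filt act_filt]) blast+
  from someI_ex[OF this, folded proj_def]
  show "Vector_Spaces.linear scale scale (proj k)" "proj k v \<in> filt k"
    "u \<in> filt k \<Longrightarrow> proj k u = u" "proj k (act \<sigma> v) = act \<sigma> (proj k v)"
    by auto
qed

definition top_part :: "nat \<Rightarrow> 'v \<Rightarrow> 'v" where
  "top_part k v = v - proj k v"

lemma top_part_linear: "Vector_Spaces.linear scale scale (top_part k)"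
proof -
  interpret P: Vector_Spaces.linear scale scale "proj k" by (rule proj)
  show ?thesis
    by (rule linear_scaleI) (simp_all add: top_part_def P.add P.scale scale_right_diff_distrib vector_space_axioms)
qed

lemma top_part_filt: "v \<in> filt k \<Longrightarrow> top_part k v = 0"
  by (simp add: top_part_def proj)

lemma top_part_cong: "u - v \<in> filt k \<Longrightarrow> top_part k u = top_part k v"
proof -
  interpret P: Vector_Spaces.linear scale scale "top_part k" by (rule top_part_linear)
  show "u - v \<in> filt k \<Longrightarrow> top_part k u = top_part k v"
    using top_part_filt[of "u - v" k] by (simp add: P.diff)
qed

lemma top_part_act: "top_part k (act \<sigma> v) = act \<sigma> (top_part k v)"
proof -
  interpret P: Vector_Spaces.linear scale scale "act \<sigma>" by (rule act_linear)
  show ?thesis by (simp add: top_part_def proj P.diff)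
qed

definition symb :: "'n dmonom \<Rightarrow> 'v" where
  "symb m = top_part (ydeg (word_of m)) (ev (word_of m) w)"

lemma symb_eqI:
  assumes "mset c = mset (word_of m)"
  shows "symb m = top_part (ydeg c) (ev c w)"
  unfolding symb_def ydeg_mset_cong[OF assms, symmetric]
  by (rule top_part_cong[symmetric]) (rule ev_reorder'[OF assms])

lemma symb_perm: "symb (perm_monom \<sigma> m) = act \<sigma> (symb m)"
  by (subst symb_eqI[OF mset_word_of_perm[symmetric]])
    (simp add: symb_def ev_equivariant w_invariant filter_map comp_def flip: top_part_act)

text \<open>
  Under the splitting by the projections this is the action of polynomials on the generator of
  the associated graded module, which is a module over the commutative polynomial ring.
\<close>
definition symbol_map :: "'n dpoly \<Rightarrow> 'v" where
  "symbol_map p = (\<Sum>m\<in>Poly_Mapping.keys p. scale (Poly_Mapping.lookup p m) (symb m))"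

lemma symbol_map_superset:
  "finite S \<Longrightarrow> Poly_Mapping.keys p \<subseteq> S \<Longrightarrow> symbol_map p = (\<Sum>m\<in>S. scale (Poly_Mapping.lookup p m) (symb m))"
  unfolding symbol_map_def by (rule sum.mono_neutral_left) (auto simp: in_keys_iff)

lemma symbol_map_add: "symbol_map (p + q) = symbol_map p + symbol_map q"
proof -
  let ?S = "Poly_Mapping.keys p \<union> Poly_Mapping.keys q"
  have "symbol_map r = (\<Sum>m\<in>?S. scale (Poly_Mapping.lookup r m) (symb m))" if "Poly_Mapping.keys r \<subseteq> ?S" for r
    by (rule symbol_map_superset[OF _ that]) simp
  from this[of p] this[of q] this[of "p + q"] show ?thesis
    by (simp add: keys_add lookup_add scale_left_distrib sum.distrib)
qed

lemma symbol_map_zero: "symbol_map 0 = 0"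
  by (simp add: symbol_map_def)

lemma symbol_map_single: "symbol_map (Poly_Mapping.single m c) = scale c (symb m)"
  by (cases "c = 0") (simp_all add: symbol_map_def)

lemma symbol_map_dconst: "symbol_map (dconst c * p) = scale c (symbol_map p)"
  by (induction p rule: dpoly_induct)
    (simp_all add: symbol_map_zero symbol_map_add symbol_map_single dconst_def mult_single ring_distribs
      scale_right_distrib)

lemma symbol_map_perm: "symbol_map (perm_poly \<sigma> p) = act \<sigma> (symbol_map p)"
proof -
  interpret L: Vector_Spaces.linear scale scale "act \<sigma>" by (rule act_linear)
  show ?thesis
    by (induction p rule: dpoly_induct)
      (simp_all add: symbol_map_zero symbol_map_add symbol_map_single perm_poly_single perm_poly_add
        symb_perm L.zero act_add act_scale)
qed

lemma subspace_range_symbol_map: "subspace (range symbol_map)"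
  unfolding subspace_def using symbol_map_zero symbol_map_add symbol_map_dconst by auto (metis rangeI)+

text \<open>
  A word differs from the symbol of its monomial by an element of a smaller filtration step,
  so that induction on the degree applies.
\<close>
lemma filt_subset_range: "filt k \<subseteq> range symbol_map"
proof (induction k rule: less_induct)
  case (less k)
  have "ev c w \<in> range symbol_map" if "ydeg c < k" for c
  proof -
    obtain m :: "'n dmonom" where m: "Poly_Mapping.lookup m = count (mset c)"
      by (rule that[of "Abs_poly_mapping (count (mset c))"], subst Abs_poly_mapping_inverse) simp_all
    then have "mset c = mset (word_of m)" by (intro multiset_eqI) (simp add: count_word_of)
    then have "symb m = top_part (ydeg c) (ev c w)" by (rule symb_eqI)
    then have "ev c w = symbol_map (Poly_Mapping.single m 1) + proj (ydeg c) (ev c w)"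
      by (simp add: symbol_map_single top_part_def)
    moreover have "proj (ydeg c) (ev c w) \<in> range symbol_map"
      using less[OF that] proj(2) by blast
    ultimately show ?thesis by (metis rangeI subspace_add[OF subspace_range_symbol_map])
  qed
  then show ?case unfolding filt_def by (intro span_minimal subspace_range_symbol_map) auto
qed

lemma surj_symbol_map: "surj symbol_map"
proof -
  have "ev c w \<in> range symbol_map" for c
    using filt_subset_range ev_in_filt[of c "Suc (ydeg c)"] by blast
  then have "span (range (\<lambda>c. ev c w)) \<subseteq> range symbol_map"
    by (intro span_minimal subspace_range_symbol_map) auto
  then show ?thesis unfolding generates by auto
qed


lemma symbol_map_sum: "symbol_map (sum f S) = (\<Sum>s\<in>S. symbol_map (f s))"
  by (induction S rule: infinite_finite_induct) (simp_all add: symbol_map_zero symbol_map_add)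

lemma sum_single_lookup:
  "(\<Sum>m\<in>Poly_Mapping.keys p. Poly_Mapping.single m (Poly_Mapping.lookup p m)) = p"
  by (rule poly_mapping_eqI)
    (auto simp: lookup_sum lookup_single when_def in_keys_iff sum.delta)

lemma symbol_map_monom_times:
  "symbol_map (Poly_Mapping.single r c * p) =
     (\<Sum>m\<in>Poly_Mapping.keys p. scale (c * Poly_Mapping.lookup p m) (symb (r + m)))"
proof -
  have "Poly_Mapping.single r c * p =
      (\<Sum>m\<in>Poly_Mapping.keys p. Poly_Mapping.single (r + m) (c * Poly_Mapping.lookup p m))"
    by (subst sum_single_lookup[symmetric, of p]) (simp add: sum_distrib_left mult_single)
  then show ?thesis by (simp add: symbol_map_sum symbol_map_single)
qed

definition inv_part :: "'n dpoly \<Rightarrow> nat \<Rightarrow> 'n dmonom set" where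
  "inv_part p j = {m \<in> Poly_Mapping.keys p. ydeg (word_of m) = j}"

lemma ydeg_word_of_perm: "ydeg (word_of (perm_monom \<sigma> m)) = ydeg (word_of m)"
  using ydeg_mset_cong[OF mset_word_of_perm, of \<sigma> m] by (simp add: filter_map comp_def)

lemma lookup_invariant:
  assumes "\<And>\<sigma>. perm_poly \<sigma> p = p"
  shows "Poly_Mapping.lookup p (perm_monom \<sigma> m) = Poly_Mapping.lookup p m"
proof -
  have "Poly_Mapping.lookup (perm_poly \<sigma> p) (perm_monom \<sigma> m) = Poly_Mapping.lookup p m"
    by (simp add: perm_poly_def Poly_Mapping.map_key.rep_eq inj_perm_monom)
  then show ?thesis using assms by simp
qed

lemma x_words_commute:
  assumes "c \<in> lists (range Inl)" "d \<in> lists (range Inl)"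
  shows "ev c (ev d w) = ev d (ev c w)"
proof -
  have "ydeg (c @ d) = 0" using assms by (auto simp: lists_eq_set filter_empty_conv)
  with ev_reorder'[of "c @ d" "d @ c"] show ?thesis by (simp add: filt_0 union_commute)
qed

lemma ev_x_kill:
  assumes "c \<in> lists (range Inl)" "c \<noteq> []" and v: "\<And>i. g (Inl i) v = 0"
  shows "ev c v = 0"
proof -
  from assms obtain d i where "c = d @ [Inl i]"
    by (cases c rule: rev_cases) auto
  moreover have "ev d 0 = 0"
  proof -
    interpret L: Vector_Spaces.linear scale scale "ev d" by (rule ev_linear)
    show ?thesis by (rule L.zero)
  qed
  ultimately show ?thesis by (simp add: v)
qed

text \<open>
  The reason why invariants vanish in the associated graded module. Applied to \<open>w\<close>, the part of
  an invariant of degree \<open>j\<close> is invariant modulo lower order, hence congruent to its average,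
  which is a multiple of \<open>w\<close>. For \<open>j > 0\<close> that multiple is itself of lower order. For
  \<open>j = 0\<close> everything is exact and \<open>w\<close> is an eigenvector; the eigenvalue can be read off
  at a common null vector of the \<open>x\<close>'s, where it is the constant term.
\<close>
lemma inv_part_filt:
  assumes inv: "\<And>\<sigma>. perm_poly \<sigma> p = p" and const: "Poly_Mapping.lookup p 0 = 0"
  shows "(\<Sum>m\<in>inv_part p j. scale (Poly_Mapping.lookup p m) (ev (word_of m) w)) \<in> filt j"
proof -
  define v where "v = (\<Sum>m\<in>inv_part p j. scale (Poly_Mapping.lookup p m) (ev (word_of m) w))"
  have act_v: "v - act \<sigma> v \<in> filt j" for \<sigma>
  proof -
    interpret L: Vector_Spaces.linear scale scale "act \<sigma>" by (rule act_linear)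
    let ?s = "map (map_sum (Perm.apply \<sigma>) (Perm.apply \<sigma>))"
    have "act \<sigma> v = (\<Sum>m\<in>inv_part p j. scale (Poly_Mapping.lookup p m) (ev (?s (word_of m)) w))"
      unfolding v_def by (simp add: L.sum L.scale ev_equivariant w_invariant)
    moreover have "v = (\<Sum>m\<in>inv_part p j. scale (Poly_Mapping.lookup p m) (ev (word_of (perm_monom \<sigma> m)) w))"
      unfolding v_def
      by (rule sum.reindex_bij_witness[of _ "perm_monom \<sigma>" "perm_monom (inverse \<sigma>)"])
        (auto simp: inv_part_def in_keys_iff lookup_invariant[OF inv] ydeg_word_of_perm)
    ultimately have "v - act \<sigma> v = (\<Sum>m\<in>inv_part p j. scale (Poly_Mapping.lookup p m)
        (ev (word_of (perm_monom \<sigma> m)) w - ev (?s (word_of m)) w))"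
      by (simp add: scale_right_diff_distrib sum_subtractf)
    also have "\<dots> \<in> filt j"
    proof (intro subspace_sum[OF subspace_filt] subspace_scale[OF subspace_filt])
      fix m assume "m \<in> inv_part p j"
      then have "ydeg (word_of (perm_monom \<sigma> m)) = j"
        by (simp add: inv_part_def ydeg_word_of_perm)
      then show "ev (word_of (perm_monom \<sigma> m)) w - ev (?s (word_of m)) w \<in> filt j"
        using ev_reorder'[OF mset_word_of_perm, of \<sigma> m] by simp
    qed
    finally show ?thesis .
  qed
  define u where "u = scale (1 / of_nat CARD('n perm)) (\<Sum>\<sigma>\<in>(UNIV :: 'n perm set). act \<sigma> v)"
  have card: "of_nat CARD('n perm) \<noteq> (0 :: complex)"
    using finite_perm_UNIV[where 'n = 'n] by simp
  have "(\<Sum>\<sigma>\<in>(UNIV :: 'n perm set). v - act \<sigma> v) = scale (of_nat CARD('n perm)) v - (\<Sum>\<sigma>\<in>UNIV. act \<sigma> v)"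
    unfolding sum_subtractf sum_constant_scale by simp
  then have "v - u = scale (1 / of_nat CARD('n perm)) (\<Sum>\<sigma>\<in>(UNIV :: 'n perm set). v - act \<sigma> v)"
    using card by (simp add: u_def scale_right_diff_distrib)
  also have "\<dots> \<in> filt j"
    by (intro subspace_sum[OF subspace_filt] subspace_scale[OF subspace_filt] act_v)
  finally have vu: "v - u \<in> filt j" .
  have "act \<tau> u = u" for \<tau>
  proof -
    interpret L: Vector_Spaces.linear scale scale "act \<tau>" by (rule act_linear)
    have "(\<Sum>\<sigma>\<in>UNIV. act (\<tau> * \<sigma>) v) = (\<Sum>\<sigma>\<in>UNIV. act \<sigma> v)"
      by (rule sum.reindex_bij_witness[of _ "\<lambda>\<sigma>. inverse \<tau> * \<sigma>" "\<lambda>\<sigma>. \<tau> * \<sigma>"])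
        (simp_all flip: mult.assoc add: perm.left_inverse perm.right_inverse)
    then show ?thesis by (simp add: u_def L.scale L.sum act_mult)
  qed
  then have "u \<in> span {w}" by (rule invariants)
  then obtain a where a: "u = scale a w" by (auto simp: span_singleton)
  show ?thesis
  proof (cases "j = 0")
    case False
    then have "u \<in> filt j"
      using ev_in_filt[of "[]" j] subspace_filt by (simp add: a subspace_scale)
    then have "v \<in> filt j" using subspace_add[OF subspace_filt vu, of u] by simp
    then show ?thesis by (simp add: v_def)
  next
    case True
    from vu have v: "v = scale a w" by (simp add: True filt_0 a)
    obtain v0 where v0: "v0 \<in> span ((\<lambda>c. ev c w) ` lists (range Inl))" "v0 \<noteq> 0" "\<And>i. g (Inl i) v0 = 0"
      using x_socle by blast
    have x_word: "word_of m \<in> lists (range Inl)" if "m \<in> inv_part p 0" for m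
      using that by (auto simp: inv_part_def filter_empty_conv isl_def)
    have nonempty: "word_of m \<noteq> []" if "m \<in> inv_part p 0" for m
    proof
      assume "word_of m = []"
      then have "Poly_Mapping.lookup m a = 0" for a by (simp flip: count_word_of)
      then have "m = 0" by (intro poly_mapping_eqI) simp
      with that const show False by (simp add: inv_part_def in_keys_iff)
    qed
    define Z where "Z y = (\<Sum>m\<in>inv_part p 0. scale (Poly_Mapping.lookup p m) (ev (word_of m) y))" for y
    have "Vector_Spaces.linear scale scale Z"
    proof (rule linear_scaleI)
      fix y z b
      have add: "ev c (y + z) = ev c y + ev c z" and scl: "ev c (scale b y) = scale b (ev c y)" for c
      proof -
        interpret L: Vector_Spaces.linear scale scale "ev c" by (rule ev_linear)
        show "ev c (y + z) = ev c y + ev c z" "ev c (scale b y) = scale b (ev c y)"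
          by (simp_all add: L.add L.scale)
      qed
      show "Z (y + z) = Z y + Z z"
        by (simp add: Z_def add scale_right_distrib sum.distrib)
      show "Z (scale b y) = scale b (Z y)"
        by (simp add: Z_def scl scale_sum_right mult.commute)
    qed (rule vector_space_axioms)+
    then interpret Z: Vector_Spaces.linear scale scale Z .
    have "Z y = scale a y" if "y \<in> span ((\<lambda>c. ev c w) ` lists (range Inl))" for y
      using that
    proof (induction rule: span_induct_alt)
      case base
      show ?case by (simp add: Z.zero)
    next
      case (step b x y)
      then obtain c where c: "x = ev c w" "c \<in> lists (range Inl)" by auto
      interpret L: Vector_Spaces.linear scale scale "ev c" by (rule ev_linear)
      have "Z x = ev c v"
        by (auto simp: Z_def v_def True c(1) L.sum L.scale intro!: sum.cong x_words_commute x_word c(2))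
      then show ?case using step c by (simp add: Z.add Z.scale v L.scale scale_right_distrib mult.commute)
    qed
    from this[OF v0(1)] have "scale a v0 = Z v0" by simp
    also have "\<dots> = 0"
      unfolding Z_def by (intro sum.neutral ballI) (simp add: ev_x_kill x_word nonempty v0(3))
    finally show ?thesis
      using v0(2) subspace_filt by (simp add: v subspace_0 flip: v_def)
  qed
qed

lemma symbol_map_monom_times_invariant:
  assumes "\<And>\<sigma>. perm_poly \<sigma> p = p" and "Poly_Mapping.lookup p 0 = 0"
  shows "symbol_map (Poly_Mapping.single r c * p) = 0"
proof -
  define J where "J = (\<lambda>m. ydeg (word_of m)) ` Poly_Mapping.keys p"
  have "(\<Sum>m\<in>inv_part p j. scale (c * Poly_Mapping.lookup p m) (symb (r + m))) = 0" for j
  proof -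
    let ?k = "ydeg (word_of r) + j"
    let ?v = "\<Sum>m\<in>inv_part p j. scale (Poly_Mapping.lookup p m) (ev (word_of m) w)"
    interpret T: Vector_Spaces.linear scale scale "top_part ?k" by (rule top_part_linear)
    interpret L: Vector_Spaces.linear scale scale "ev (word_of r)" by (rule ev_linear)
    have symb_rm: "symb (r + m) = top_part ?k (ev (word_of r) (ev (word_of m) w))" if "m \<in> inv_part p j" for m
      using symb_eqI[OF mset_word_of_add[symmetric], of r m] that by (simp add: inv_part_def)
    have "(\<Sum>m\<in>inv_part p j. scale (c * Poly_Mapping.lookup p m) (symb (r + m)))
        = scale c (top_part ?k (ev (word_of r) ?v))"
      by (simp add: T.sum T.scale L.sum L.scale scale_sum_right symb_rm)
    also have "top_part ?k (ev (word_of r) ?v) = 0"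
      by (intro top_part_filt ev_filt inv_part_filt assms)
    finally show ?thesis by simp
  qed
  then have "(\<Sum>j\<in>J. \<Sum>m\<in>inv_part p j. scale (c * Poly_Mapping.lookup p m) (symb (r + m))) = 0"
    by simp
  also have "(\<Sum>j\<in>J. \<Sum>m\<in>inv_part p j. scale (c * Poly_Mapping.lookup p m) (symb (r + m)))
      = (\<Sum>m\<in>Poly_Mapping.keys p. scale (c * Poly_Mapping.lookup p m) (symb (r + m)))"
    unfolding inv_part_def J_def by (rule sum.image_gen[symmetric]) simp
  finally show ?thesis by (simp add: symbol_map_monom_times)
qed

lemma symbol_map_coinv_ideal:
  assumes "p \<in> coinv_ideal"
  shows "symbol_map p = 0"
  using assms unfolding coinv_ideal_def
proof (induction rule: dpoly_module.span_induct_alt)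
  case base
  show ?case by (rule symbol_map_zero)
next
  case (step r p q)
  have "symbol_map (r * p) = 0"
    using step(1)
    by (induction r rule: dpoly_induct)
      (simp_all add: ring_distribs symbol_map_add symbol_map_zero symbol_map_monom_times_invariant
        invariants_pos_def)
  with step show ?case by (simp add: symbol_map_add)
qed

text \<open>
  By the preceding lemmas \<open>symbol_map\<close> is a surjection of representations that factors through
  the coinvariants; complete reducibility turns it around.
\<close>
theorem deformation_contained_in_DH: "contains_subrep (scale_DH :: complex \<Rightarrow> 'n DH \<Rightarrow> 'n DH) perm_DH scale act"
proof -
  define Q where "Q x = symbol_map (rep_DH x)" for x :: "'n DH"
  have Q: "Q (abs_DH p) = symbol_map p" for p :: "'n dpoly"
  proof -
    have "coinv_rel (rep_DH (abs_DH p)) p"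
      by (metis Quotient3_DH rep_abs_rsp_left Quotient3_refl1 equivp_coinv_rel equivp_reflp)
    then have "symbol_map (rep_DH (abs_DH p) - p) = 0"
      unfolding coinv_rel_def by (rule symbol_map_coinv_ideal)
    then have "symbol_map (rep_DH (abs_DH p) - p + p) = symbol_map p"
      unfolding symbol_map_add by simp
    then show ?thesis by (simp add: Q_def)
  qed
  have ex: "\<exists>p. x = abs_DH p" for x :: "'n DH"
    by (metis Quotient3_DH Quotient3_abs_rep)
  show ?thesis
  proof (rule contains_subrep_of_surjection)
    show "sym_rep (scale_DH :: complex \<Rightarrow> 'n DH \<Rightarrow> 'n DH) perm_DH" by (rule DH.sym_rep_axioms)
    show "sym_rep scale act" by (rule sym_rep_axioms)
    show "Vector_Spaces.linear scale_DH scale Q"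
    proof (rule linear_scaleI)
      fix x y :: "'n DH" and c
      obtain p q where "x = abs_DH p" "y = abs_DH q" using ex by metis
      then show "Q (x + y) = Q x + Q y" "Q (scale_DH c x) = scale c (Q x)"
        by (simp_all add: plus_DH.abs_eq scale_DH.abs_eq Q symbol_map_add symbol_map_dconst)
    qed (rule DH.vector_space_axioms vector_space_axioms)+
    show "surj Q"
    proof (rule surjI)
      show "Q (abs_DH (inv symbol_map v)) = v" for v
        unfolding Q by (rule surj_f_inv_f[OF surj_symbol_map])
    qed
    fix \<sigma> :: "'n perm" and x :: "'n DH"
    obtain p where "x = abs_DH p" using ex by metis
    then show "Q (perm_DH \<sigma> x) = act \<sigma> (Q x)"
      by (simp add: perm_DH.abs_eq Q symbol_map_perm)
  qed
qed

end

section \<open>Adjacent transpositions\<close>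

text \<open>
  The index type carries no order, but adjacent transpositions need one; an arbitrary
  enumeration is fixed once and for all.
\<close>

definition idx :: "nat \<Rightarrow> 'n::finite" where
  "idx = (SOME e. bij_betw e {..<CARD('n)} UNIV)"

definition pos :: "'n::finite \<Rightarrow> nat" where
  "pos = the_inv_into {..<CARD('n)} idx"

lemma bij_idx: "bij_betw (idx :: nat \<Rightarrow> 'n::finite) {..<CARD('n)} UNIV"
proof -
  have "\<exists>e :: nat \<Rightarrow> 'n. bij_betw e {..<CARD('n)} UNIV"
    using ex_bij_betw_nat_finite[of "UNIV :: 'n set"] by (auto simp: atLeast0LessThan)
  then show ?thesis unfolding idx_def by (rule someI_ex)
qed

lemma idx_pos [simp]: "idx (pos i) = (i :: 'n::finite)"
  unfolding pos_def using bij_idx[where 'n = 'n]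
  by (intro f_the_inv_into_f) (auto simp: bij_betw_def)

lemma pos_idx [simp]: "k < CARD('n) \<Longrightarrow> pos (idx k :: 'n::finite) = k"
  unfolding pos_def using bij_idx[where 'n = 'n]
  by (intro the_inv_into_f_f) (auto simp: bij_betw_def)

lemma pos_less [simp]: "pos (i :: 'n::finite) < CARD('n)"
  unfolding pos_def using bij_idx[where 'n = 'n] the_inv_into_into[of idx "{..<CARD('n)}" i "{..<CARD('n)}"]
  by (auto simp: bij_betw_def)

lemma pos_inject [simp]: "pos i = pos j \<longleftrightarrow> i = j"
  by (metis idx_pos)

lemma idx_inject: "k < CARD('n) \<Longrightarrow> l < CARD('n) \<Longrightarrow> (idx k :: 'n::finite) = idx l \<longleftrightarrow> k = l"
  by (metis pos_idx)

lemma bij_pos: "bij_betw (pos :: 'n::finite \<Rightarrow> nat) UNIV {..<CARD('n)}"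
  by (rule bij_betw_byWitness[where f' = idx]) auto

definition adj :: "nat \<Rightarrow> 'n::finite perm" where
  "adj k = Perm.swap (idx k) (idx (Suc k))"

lemma adj_adj [simp]: "adj k * adj k = 1" "adj k * (adj k * \<sigma>) = \<sigma>" "\<sigma> * adj k * adj k = \<sigma>"
  by (simp_all add: adj_def mult.assoc) (simp_all flip: mult.assoc)

lemma perm_swap_conj: "\<sigma> * Perm.swap a b = Perm.swap (Perm.apply \<sigma> a) (Perm.apply \<sigma> b) * \<sigma>"
proof (rule perm_eqI)
  fix c
  show "Perm.apply (\<sigma> * Perm.swap a b) c = Perm.apply (Perm.swap (Perm.apply \<sigma> a) (Perm.apply \<sigma> b) * \<sigma>) c"
    by (cases "c = a \<or> c = b") (auto simp: apply_times apply_inj)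
qed

definition descent :: "'n::finite perm \<Rightarrow> nat \<Rightarrow> bool" where
  "descent \<sigma> k \<longleftrightarrow> Suc k < CARD('n) \<and> pos (Perm.apply \<sigma> (idx (Suc k))) < pos (Perm.apply \<sigma> (idx k))"

text \<open>
  A substitute for the number of inversions: it too drops when a descent is removed, and it is
  easier to compute with.
\<close>
definition weight :: "'n::finite perm \<Rightarrow> nat" where
  "weight \<sigma> = (\<Sum>i\<in>UNIV. (CARD('n) - pos i) * pos (Perm.apply \<sigma> i))"

lemma weight_adj:
  assumes "descent (\<sigma> :: 'n::finite perm) k"
  shows "weight (\<sigma> * adj k) < weight \<sigma>"
proof -
  let ?N = "CARD('n)"
  let ?i = "idx k :: 'n" and ?j = "idx (Suc k) :: 'n"
  have k: "Suc k < ?N" and lt: "pos (Perm.apply \<sigma> ?j) < pos (Perm.apply \<sigma> ?i)"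
    using assms by (auto simp: descent_def)
  have ne: "?i \<noteq> ?j" using k by (simp add: idx_inject)
  let ?f = "\<lambda>\<tau> i. (?N - pos i) * pos (Perm.apply \<tau> i)"
  have split: "weight \<tau> = ?f \<tau> ?i + (?f \<tau> ?j + sum (?f \<tau>) (UNIV - {?i, ?j}))" for \<tau> :: "'n perm"
    unfolding weight_def
    by (subst sum.remove[of _ ?i]; simp; subst sum.remove[of _ ?j]) (use ne in \<open>auto simp: insert_commute intro!: sum.cong\<close>)
  have "sum (?f (\<sigma> * adj k)) (UNIV - {?i, ?j}) = sum (?f \<sigma>) (UNIV - {?i, ?j})"
    by (rule sum.cong) (auto simp: apply_times adj_def)
  moreover have "?f (\<sigma> * adj k) ?i + ?f (\<sigma> * adj k) ?j < ?f \<sigma> ?i + ?f \<sigma> ?j"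
  proof -
    have "?N - k = Suc (?N - Suc k)" using k by simp
    then show ?thesis using k lt by (simp add: apply_times adj_def)
  qed
  ultimately show ?thesis unfolding split by linarith
qed

lemma no_descent:
  assumes "\<And>k. \<not> descent (\<sigma> :: 'n::finite perm) k"
  shows "\<sigma> = 1"
proof -
  let ?N = "CARD('n)"
  define f where "f k = pos (Perm.apply \<sigma> (idx k))" for k
  have inj: "f k = f l \<longleftrightarrow> k = l" if "k < ?N" "l < ?N" for k l
    using that by (simp add: f_def apply_inj idx_inject)
  have mono: "f k < f (Suc k)" if "Suc k < ?N" for k
  proof -
    have "f k \<le> f (Suc k)" using assms[of k] that by (simp add: descent_def f_def)
    moreover have "f k \<noteq> f (Suc k)" using inj[of k "Suc k"] that by simp
    ultimately show ?thesis by (rule le_neq_implies_less)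
  qed
  have ge: "k \<le> f k" if "k < ?N" for k
    using that
  proof (induction k)
    case (Suc k)
    then show ?case using mono[of k] by simp
  qed simp
  have "sum f {..<?N} = (\<Sum>i\<in>UNIV. pos (Perm.apply \<sigma> i))"
    unfolding f_def by (rule sum.reindex_bij_betw[OF bij_idx])
  also have "\<dots> = (\<Sum>i\<in>(UNIV :: 'n set). pos i)"
    by (rule sum.reindex_bij_betw) simp
  also have "\<dots> = (\<Sum>k<?N. k)"
    using sum.reindex_bij_betw[OF bij_pos[where 'n = 'n], of "\<lambda>k. k"] by simp
  finally have eq: "sum f {..<?N} = (\<Sum>k<?N. k)" .
  have "f k = k" if "k < ?N" for k
  proof (rule ccontr)
    assume "f k \<noteq> k"
    with ge[OF that] have "k < f k" by simp
    then have "(\<Sum>k<?N. k) < sum f {..<?N}"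
      using that ge by (intro sum_strict_mono_ex1) auto
    with eq show False by simp
  qed
  then have "pos (Perm.apply \<sigma> i) = pos i" for i
    using f_def[of "pos i"] by simp
  then show ?thesis by (intro perm_eqI) simp
qed

text \<open>Sorting a permutation by removing descents, read as an induction principle.\<close>
lemma perm_descent_induct [case_names one descent]:
  assumes "P 1" and "\<And>\<sigma> k. descent \<sigma> k \<Longrightarrow> P (\<sigma> * adj k) \<Longrightarrow> P \<sigma>"
  shows "P (\<sigma> :: 'n::finite perm)"
proof (induction \<sigma> rule: measure_induct_rule[of weight])
  case (less \<sigma>)
  show ?case
    using no_descent[of \<sigma>] assms(1) assms(2)[OF _ less[OF weight_adj]] by blast
qed

text \<open>
  The action of \<open>\<sigma>\<close> when adjacent transpositions act by \<open>t\<close>, read off from the reduced word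
  that always removes the leftmost descent.
\<close>
function coxeter_rep :: "(nat \<Rightarrow> 'a \<Rightarrow> 'a) \<Rightarrow> 'n::finite perm \<Rightarrow> 'a \<Rightarrow> 'a" where
  "coxeter_rep t \<sigma> = (if \<exists>k. descent \<sigma> k
     then coxeter_rep t (\<sigma> * adj (LEAST k. descent \<sigma> k)) \<circ> t (LEAST k. descent \<sigma> k) else id)"
  by auto
termination
  by (relation "measure (\<lambda>(t, \<sigma>). weight \<sigma>)") (auto intro: weight_adj LeastI)

declare coxeter_rep.simps [simp del]

lemma adj_commute:
  assumes "Suc k < l" "Suc l < CARD('n)"
  shows "adj k * adj l = (adj l * adj k :: 'n::finite perm)"
  unfolding adj_def by (subst perm_swap_conj) (use assms in \<open>simp add: idx_inject\<close>)

lemma adj_braid: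
  assumes "Suc (Suc k) < CARD('n)"
  shows "adj k * adj (Suc k) * adj k = (adj (Suc k) * adj k * adj (Suc k) :: 'n::finite perm)"
proof -
  let ?a = "idx k :: 'n" and ?b = "idx (Suc k) :: 'n" and ?c = "idx (Suc (Suc k)) :: 'n"
  have d: "?a \<noteq> ?b" "?a \<noteq> ?c" "?b \<noteq> ?c" using assms by (simp_all add: idx_inject)
  have "adj k * adj (Suc k) = Perm.swap ?a ?c * adj k"
    using d unfolding adj_def by (subst perm_swap_conj) simp
  moreover have "adj (Suc k) * adj k = Perm.swap ?a ?c * adj (Suc k)"
    using d unfolding adj_def by (subst perm_swap_conj) simp
  ultimately show ?thesis by (simp add: adj_def mult.assoc)
qed

context
  fixes t :: "nat \<Rightarrow> 'a \<Rightarrow> 'a" and n :: "'n::finite itself"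
  assumes t_square: "\<And>k. Suc k < CARD('n) \<Longrightarrow> t k \<circ> t k = id"
    and t_braid: "\<And>k. Suc (Suc k) < CARD('n) \<Longrightarrow> t k \<circ> t (Suc k) \<circ> t k = t (Suc k) \<circ> t k \<circ> t (Suc k)"
    and t_commute: "\<And>k l. Suc k < l \<Longrightarrow> Suc l < CARD('n) \<Longrightarrow> t k \<circ> t l = t l \<circ> t k"
begin

text \<open>
  Any descent may be removed first. This is confluence: two descents that are far apart commute,
  and for neighbouring ones both choices lead to removing three descents, where the braid
  relation identifies the results.
\<close>
lemma coxeter_rep_descent: "descent (\<sigma> :: 'n perm) k \<Longrightarrow> coxeter_rep t \<sigma> = coxeter_rep t (\<sigma> * adj k) \<circ> t k"
proof (induction \<sigma> arbitrary: k rule: measure_induct_rule[of weight])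
  case (less \<sigma>)
  define j where "j = (LEAST k. descent \<sigma> k)"
  have j: "descent \<sigma> j" unfolding j_def using less.prems by (rule LeastI)
  have cj: "coxeter_rep t \<sigma> = coxeter_rep t (\<sigma> * adj j) \<circ> t j"
    using less.prems by (subst coxeter_rep.simps) (auto simp: j_def)
  have IH: "coxeter_rep t (\<sigma> * adj i) = coxeter_rep t (\<sigma> * adj i * adj l) \<circ> t l" if "descent \<sigma> i" "descent (\<sigma> * adj i) l" for i l
    by (rule less.IH[OF weight_adj[OF that(1)] that(2)])
  have far: "coxeter_rep t (\<sigma> * adj i) \<circ> t i = coxeter_rep t (\<sigma> * adj l) \<circ> t l"
    if "descent \<sigma> i" "descent \<sigma> l" "Suc i < l" for i l
  proof -
    have l: "Suc l < CARD('n)" and i: "Suc i < CARD('n)" using that by (auto simp: descent_def)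
    have "descent (\<sigma> * adj i) l" "descent (\<sigma> * adj l) i"
      using that i l by (auto simp: descent_def adj_def apply_times idx_inject)
    with that(1,2) have "coxeter_rep t (\<sigma> * adj i) = coxeter_rep t (\<sigma> * adj i * adj l) \<circ> t l"
      "coxeter_rep t (\<sigma> * adj l) = coxeter_rep t (\<sigma> * adj l * adj i) \<circ> t i" by (auto intro: IH)
    then show ?thesis
      using t_commute[OF that(3) l] adj_commute[OF that(3) l] by (simp add: comp_assoc mult.assoc)
  qed
  have near: "coxeter_rep t (\<sigma> * adj i) \<circ> t i = coxeter_rep t (\<sigma> * adj l) \<circ> t l"
    if "descent \<sigma> i" "descent \<sigma> l" "l = Suc i" for i l
  proof -
    have l: "Suc (Suc i) < CARD('n)" using that by (auto simp: descent_def)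
    have d1: "descent (\<sigma> * adj i) l" "descent (\<sigma> * adj l) i"
      using that(1,2) l unfolding that(3) by (auto simp: descent_def adj_def apply_times idx_inject)
    have d2: "descent (\<sigma> * adj i * adj l) i" "descent (\<sigma> * adj l * adj i) l"
      using that(1,2) l unfolding that(3) by (auto simp: descent_def adj_def apply_times idx_inject)
    have w: "weight (\<sigma> * adj i * adj l) < weight \<sigma>" "weight (\<sigma> * adj l * adj i) < weight \<sigma>"
      using d1 that(1,2) by (meson weight_adj less_trans)+
    have "coxeter_rep t (\<sigma> * adj i) \<circ> t i = coxeter_rep t (\<sigma> * adj i * adj l * adj i) \<circ> (t i \<circ> t l \<circ> t i)"
      unfolding IH[OF that(1) d1(1)] less.IH[OF w(1) d2(1)] by (simp add: comp_assoc)
    also have "\<dots> = coxeter_rep t (\<sigma> * adj l * adj i * adj l) \<circ> (t l \<circ> t i \<circ> t l)"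
      using t_braid[OF l] adj_braid[OF l] unfolding that(3) by (simp add: mult.assoc)
    also have "\<dots> = coxeter_rep t (\<sigma> * adj l) \<circ> t l"
      unfolding IH[OF that(2) d1(2)] less.IH[OF w(2) d2(2)] by (simp add: comp_assoc)
    finally show ?thesis .
  qed
  consider "j = k" | "Suc j < k" | "k = Suc j" | "Suc k < j" | "j = Suc k" by linarith
  then have "coxeter_rep t (\<sigma> * adj j) \<circ> t j = coxeter_rep t (\<sigma> * adj k) \<circ> t k"
    using far near j less.prems by cases metis+
  then show ?case by (simp add: cj)
qed

lemma coxeter_rep_one: "coxeter_rep t (1 :: 'n perm) = id"
  by (subst coxeter_rep.simps) (auto simp: descent_def)

lemma coxeter_rep_adj:
  assumes "Suc k < CARD('n)"
  shows "coxeter_rep t (\<sigma> * adj k :: 'n perm) = coxeter_rep t \<sigma> \<circ> t k"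
proof (cases "descent \<sigma> k")
  case True
  then show ?thesis using t_square[OF assms] by (simp add: coxeter_rep_descent comp_assoc)
next
  case False
  have "(idx k :: 'n) \<noteq> idx (Suc k)" using assms by (simp add: idx_inject)
  then have "pos (Perm.apply \<sigma> (idx k)) \<noteq> pos (Perm.apply \<sigma> (idx (Suc k)))"
    by (simp add: apply_inj)
  with False assms have "pos (Perm.apply \<sigma> (idx k)) < pos (Perm.apply \<sigma> (idx (Suc k)))"
    unfolding descent_def by linarith
  with assms have "descent (\<sigma> * adj k) k"
    by (simp add: descent_def adj_def apply_times)
  then show ?thesis using coxeter_rep_descent by fastforce
qed

lemma coxeter_rep_mult: "coxeter_rep t (\<sigma> * \<tau> :: 'n perm) = coxeter_rep t \<sigma> \<circ> coxeter_rep t \<tau>"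
proof (induction \<tau> rule: perm_descent_induct)
  case one
  show ?case by (simp add: coxeter_rep_one)
next
  case (descent \<tau> k)
  then have k: "Suc k < CARD('n)" by (simp add: descent_def)
  have "coxeter_rep t (\<sigma> * (\<tau> * adj k) * adj k) = coxeter_rep t \<sigma> \<circ> (coxeter_rep t (\<tau> * adj k) \<circ> t k)"
    unfolding coxeter_rep_adj[OF k] descent.IH comp_assoc ..
  moreover have "coxeter_rep t (\<tau> * adj k) \<circ> t k = coxeter_rep t \<tau>"
    using coxeter_rep_adj[OF k, of "\<tau> * adj k"] by simp
  ultimately show ?case by (simp add: mult.assoc)
qed

lemma coxeter_rep_gen: "Suc k < CARD('n) \<Longrightarrow> coxeter_rep t (adj k :: 'n perm) = t k"
  using coxeter_rep_adj[of k 1] by (simp add: coxeter_rep_one)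

end

section \<open>Joint eigenvectors and power sums\<close>

definition poly_op :: "(complex \<Rightarrow> 'v::ab_group_add \<Rightarrow> 'v) \<Rightarrow> complex poly \<Rightarrow> ('v \<Rightarrow> 'v) \<Rightarrow> 'v \<Rightarrow> 'v" where
  "poly_op scale p f v = (\<Sum>i\<le>degree p. scale (coeff p i) ((f ^^ i) v))"

context
  fixes scale :: "complex \<Rightarrow> 'v::ab_group_add \<Rightarrow> 'v" and f :: "'v \<Rightarrow> 'v"
  assumes f: "Vector_Spaces.linear scale scale f"
begin

interpretation f: Vector_Spaces.linear scale scale f by (rule f)

lemma poly_op_bound: "degree p \<le> n \<Longrightarrow> poly_op scale p f v = (\<Sum>i\<le>n. scale (coeff p i) ((f ^^ i) v))"
  unfolding poly_op_def
  by (rule sum.mono_neutral_left) (auto simp: coeff_eq_0 not_le)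

lemma poly_op_linear_factor:
  "poly_op scale ([:- a, 1:] * q) f v = f (poly_op scale q f v) - scale a (poly_op scale q f v)"
proof -
  let ?n = "degree q"
  have d: "degree ([:- a, 1:] * q) \<le> Suc ?n"
    by (rule order_trans[OF degree_mult_le]) simp
  have c: "coeff ([:- a, 1:] * q) i = coeff (pCons 0 q) i - a * coeff q i" for i
    by (simp add: mult_pCons_left)
  have "poly_op scale ([:- a, 1:] * q) f v =
      (\<Sum>i\<le>Suc ?n. scale (coeff (pCons 0 q) i) ((f ^^ i) v)) - (\<Sum>i\<le>Suc ?n. scale (a * coeff q i) ((f ^^ i) v))"
    unfolding poly_op_bound[OF d] c by (simp only: f.vs1.scale_left_diff_distrib sum_subtractf)
  also have "(\<Sum>i\<le>Suc ?n. scale (coeff (pCons 0 q) i) ((f ^^ i) v)) = f (poly_op scale q f v)"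
    by (simp add: sum.atMost_Suc_shift poly_op_def f.sum f.scale del: sum.atMost_Suc)
  also have "(\<Sum>i\<le>Suc ?n. scale (a * coeff q i) ((f ^^ i) v)) = scale a (poly_op scale q f v)"
    by (simp add: poly_op_bound[of q "Suc ?n"] f.vs1.scale_sum_right f.vs1.scale_right_distrib del: coeff_eq_0)
  finally show ?thesis .
qed

text \<open>
  Splitting off one linear factor at a time, the last nonzero vector before the
  product of the factors kills \<open>v\<close> is an eigenvector.
\<close>
lemma eigenvector_of_poly_op:
  assumes U: "module.subspace scale U" "\<And>u. u \<in> U \<Longrightarrow> f u \<in> U" and v: "v \<in> U" "v \<noteq> 0"
    and p: "p \<noteq> 0" "poly_op scale p f v = 0"
  shows "\<exists>u\<in>U. u \<noteq> 0 \<and> (\<exists>a. f u = scale a u)"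
  using p
proof (induction "degree p" arbitrary: p rule: less_induct)
  case less
  have "degree p \<noteq> 0"
  proof
    assume d: "degree p = 0"
    with less.prems(1) have "coeff p 0 \<noteq> 0" by (metis leading_coeff_0_iff)
    then show False using less.prems(2) v(2) d by (simp add: poly_op_def)
  qed
  then have "\<not> constant (poly p)" by (simp add: constant_degree)
  then obtain a where "poly p a = 0" using fundamental_theorem_of_algebra by blast
  then obtain q where q: "p = [:- a, 1:] * q" by (auto simp: poly_eq_0_iff_dvd dvd_def)
  with less.prems(1) have q0: "q \<noteq> 0" by auto
  define u where "u = poly_op scale q f v"
  have "(f ^^ i) v \<in> U" for i by (induction i) (simp_all add: U v)
  then have u: "u \<in> U" unfolding u_def poly_op_def
    by (intro f.vs1.subspace_sum[OF U(1)] f.vs1.subspace_scale[OF U(1)])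
  have fu: "f u = scale a u"
    using less.prems(2) unfolding q poly_op_linear_factor u_def by simp
  show ?case
  proof (cases "u = 0")
    case True
    have "degree q < degree p" unfolding q using q0 by (subst degree_mult_eq) auto
    from less.hyps[OF this q0] True show ?thesis by (simp add: u_def)
  qed (use u fu in blast)
qed

lemma eigenvector_exists:
  assumes fin: "finite B" "module.span scale B = UNIV"
    and U: "module.subspace scale U" "\<And>u. u \<in> U \<Longrightarrow> f u \<in> U" and v: "v \<in> U" "v \<noteq> 0"
  shows "\<exists>u\<in>U. u \<noteq> 0 \<and> (\<exists>a. f u = scale a u)"
proof -
  define n where "n = card B"
  define h where "h i = (f ^^ i) v" for i
  have "\<exists>p. p \<noteq> 0 \<and> poly_op scale p f v = 0"
  proof (cases "inj_on h {..n}")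
    case True
    have "module.dependent scale (h ` {..n})"
    proof (rule ccontr)
      assume "\<not> module.dependent scale (h ` {..n})"
      then have "card (h ` {..n}) \<le> card B"
        using f.vs1.independent_span_bound[OF fin(1)] fin(2) by auto
      with True show False by (simp add: card_image n_def)
    qed
    then obtain u where u: "\<exists>x\<in>h ` {..n}. u x \<noteq> 0" "(\<Sum>x\<in>h ` {..n}. scale (u x) x) = 0"
      by (auto simp: f.vs1.dependent_finite)
    define p where "p = (\<Sum>i\<le>n. monom (u (h i)) i)"
    have c: "coeff p i = (if i \<le> n then u (h i) else 0)" for i
      by (simp add: p_def coeff_sum sum.delta)
    have "p \<noteq> 0" using u(1) c by (metis (no_types, lifting) atMost_iff coeff_0 imageE)
    moreover have "degree p \<le> n" by (rule degree_le) (simp add: c)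
    then have "poly_op scale p f v = (\<Sum>i\<le>n. scale (u (h i)) (h i))"
      by (simp add: poly_op_bound c h_def)
    then have "poly_op scale p f v = 0"
      using u(2) by (simp add: sum.reindex[OF True])
    ultimately show ?thesis by blast
  next
    case False
    then obtain i j where ij: "i < j" "h i = h j"
      by (metis inj_on_def nat_neq_iff)
    let ?p = "monom 1 j - monom 1 i :: complex poly"
    have "coeff ?p j \<noteq> 0" using ij by simp
    then have "?p \<noteq> 0" by (metis coeff_0)
    moreover have "degree ?p \<le> j"
      by (intro degree_diff_le degree_monom_le order_trans[OF degree_monom_le]) (use ij in simp)
    then have "poly_op scale ?p f v = (\<Sum>k\<le>j. scale (if j = k then 1 else 0) (h k)) - (\<Sum>k\<le>j. scale (if i = k then 1 else 0) (h k))"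
      by (simp only: poly_op_bound coeff_diff coeff_monom f.vs1.scale_left_diff_distrib sum_subtractf h_def)
    then have "poly_op scale ?p f v = 0"
      using ij by (simp add: if_distrib[of "\<lambda>c. scale c _"] cong: if_cong)
    ultimately show ?thesis by blast
  qed
  with eigenvector_of_poly_op[OF U v] show ?thesis by blast
qed

end

lemma joint_eigenvector_exists:
  fixes scale :: "complex \<Rightarrow> 'v::ab_group_add \<Rightarrow> 'v" and f :: "'i::finite \<Rightarrow> 'v \<Rightarrow> 'v"
  assumes f: "\<And>i. Vector_Spaces.linear scale scale (f i)"
    and comm: "\<And>i j v. f i (f j v) = f j (f i v)"
    and fin: "finite B" "module.span scale B = UNIV"
    and U: "module.subspace scale U" "\<And>i u. u \<in> U \<Longrightarrow> f i u \<in> U" and v: "v \<in> U" "v \<noteq> 0"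
  shows "\<exists>u\<in>U. u \<noteq> 0 \<and> (\<forall>i. \<exists>a. f i u = scale a u)"
proof -
  interpret f: Vector_Spaces.linear scale scale "f undefined" by (rule f)
  have "\<exists>u\<in>U. u \<noteq> 0 \<and> (\<forall>i\<in>S. \<exists>a. f i u = scale a u)" if "finite S" for S
    using that
  proof induction
    case empty
    show ?case using v by auto
  next
    case (insert j S)
    then obtain u where u: "u \<in> U" "u \<noteq> 0" "\<And>i. i \<in> S \<Longrightarrow> \<exists>a. f i u = scale a u" by blast
    then obtain a where a: "\<And>i. i \<in> S \<Longrightarrow> f i u = scale (a i) u" by metis
    let ?W = "{x \<in> U. \<forall>i\<in>S. f i x = scale (a i) x}"
    have lin: "f i (x + y) = f i x + f i y" "f i (scale c x) = scale c (f i x)" "f i 0 = 0" for i x y c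
    proof -
      interpret L: Vector_Spaces.linear scale scale "f i" by (rule f)
      show "f i (x + y) = f i x + f i y" "f i (scale c x) = scale c (f i x)" "f i 0 = 0"
        by (simp_all add: L.add L.scale L.zero)
    qed
    have W: "f.vs1.subspace ?W"
      using U(1) by (auto simp: f.vs1.subspace_def lin f.vs1.scale_right_distrib mult.commute)
    have inv: "f j x \<in> ?W" if "x \<in> ?W" for x
    proof -
      have "f i (f j x) = scale (a i) (f j x)" if "i \<in> S" for i
        using that \<open>x \<in> ?W\<close> by (subst comm) (simp add: lin)
      with that U(2) show ?thesis by simp
    qed
    have "\<exists>x\<in>?W. x \<noteq> 0 \<and> (\<exists>c. f j x = scale c x)"
      by (rule eigenvector_exists[OF f fin W inv, of u]) (use u a in auto)
    then show ?case by blast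
  qed
  from this[OF finite[of UNIV]] show ?thesis by auto
qed

text \<open>
  By linearity the hypothesis extends from powers to all polynomials. A polynomial that vanishes
  at \<open>z\<close> and at all values other than \<open>x i\<close> then shows that \<open>x i\<close> cannot differ from \<open>z\<close>.
\<close>
lemma equal_power_sums:
  fixes x :: "'i::finite \<Rightarrow> complex"
  assumes "\<And>k. (\<Sum>i\<in>UNIV. x i ^ k) = of_nat CARD('i) * z ^ k"
  shows "x i = z"
proof (rule ccontr)
  assume ne: "x i \<noteq> z"
  have p: "(\<Sum>i\<in>UNIV. poly p (x i)) = of_nat CARD('i) * poly p z" for p
  proof -
    have "(\<Sum>i\<in>UNIV. poly p (x i)) = (\<Sum>k\<le>degree p. coeff p k * (\<Sum>i\<in>UNIV. x i ^ k))"
      unfolding poly_altdef sum_distrib_left by (rule sum.swap)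
    also have "\<dots> = of_nat CARD('i) * poly p z"
      unfolding assms poly_altdef sum_distrib_left by (simp add: ac_simps)
    finally show ?thesis .
  qed
  define A where "A = (range x \<union> {z}) - {x i}"
  define q where "q = (\<Prod>a\<in>A. [:- a, 1:])"
  have fin: "finite A" by (simp add: A_def)
  have q: "poly q y = (\<Prod>a\<in>A. y - a)" for y by (simp add: q_def poly_prod)
  have q0: "poly q y = 0 \<longleftrightarrow> y \<in> A" for y using fin by (auto simp: q)
  have "(\<Sum>j\<in>UNIV. poly q (x j)) = (\<Sum>j\<in>{j. x j = x i}. poly q (x i))"
    by (rule sum.mono_neutral_cong_right) (auto simp: q0 A_def)
  also have "\<dots> = of_nat (card {j. x j = x i}) * poly q (x i)" by simp
  finally have "of_nat (card {j. x j = x i}) * poly q (x i) = 0"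
    using p[of q] ne q0[of z] by (simp add: A_def)
  moreover have "poly q (x i) \<noteq> 0" by (simp add: q0 A_def)
  moreover have "card {j. x j = x i} \<noteq> 0" by auto
  ultimately show False by simp
qed

section \<open>Modules over the trigonometric Cherednik algebra\<close>

lemma perm_pair_exists:
  assumes "a \<noteq> b" "i \<noteq> j"
  obtains \<sigma> :: "'n perm" where "Perm.apply \<sigma> a = i" "Perm.apply \<sigma> b = j"
proof -
  let ?s = "Perm.swap a i"
  let ?b = "Perm.apply ?s b"
  have "?b \<noteq> i" using assms(1) by (metis apply_inj apply_swap_simp(1))
  then have "Perm.apply (Perm.swap ?b j) i = i"
    using assms(2) by (metis apply_swap_same)
  then have "Perm.apply (Perm.swap ?b j * ?s) a = i" "Perm.apply (Perm.swap ?b j * ?s) b = j"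
    by (simp_all add: apply_times)
  then show ?thesis by (rule that)
qed

text \<open>
  The cycle that moves every index one place down. Composed with the shift of all positions
  it becomes the translation of the first index by a full period.
\<close>
definition rot :: "'n::finite perm" where
  "rot = Perm (\<lambda>i. idx ((pos i + (CARD('n) - Suc 0)) mod CARD('n)))"

lemma apply_rot: "Perm.apply (rot :: 'n::finite perm) i = idx ((pos i + (CARD('n) - Suc 0)) mod CARD('n))"
proof -
  let ?N = "CARD('n)"
  let ?f = "\<lambda>i::'n. idx ((pos i + (?N - 1)) mod ?N) :: 'n"
  let ?g = "\<lambda>i::'n. idx (Suc (pos i) mod ?N) :: 'n"
  have N: "0 < ?N" by simp
  have "bij ?f"
  proof (rule bij_betw_byWitness[where f' = ?g])
    show "\<forall>i\<in>UNIV. ?g (?f i) = i"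
    proof
      fix i :: 'n
      have "Suc ((pos i + (?N - 1)) mod ?N) mod ?N = pos i"
        using N by (simp add: mod_Suc_eq)
      then show "?g (?f i) = i" by simp
    qed
    show "\<forall>i\<in>UNIV. ?f (?g i) = i"
    proof
      fix i :: 'n
      have "(Suc (pos i) mod ?N + (?N - 1)) mod ?N = (Suc (pos i) + (?N - 1)) mod ?N"
        by (rule mod_add_left_eq)
      also have "Suc (pos i) + (?N - 1) = pos i + ?N" using N by simp
      finally have "(Suc (pos i) mod ?N + (?N - 1)) mod ?N = pos i" by simp
      then show "?f (?g i) = i" by simp
    qed
  qed auto
  then have "?f \<in> {f. bij f \<and> finite {a. f a \<noteq> a}}" by simp
  then show ?thesis unfolding rot_def by (subst Perm_inverse) simp_all
qed

lemma rot_idx_0: "Perm.apply rot (idx 0 :: 'n::finite) = idx (CARD('n) - Suc 0)"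
  by (simp add: apply_rot)

lemma rot_idx_Suc:
  assumes "Suc k < CARD('n)"
  shows "Perm.apply rot (idx (Suc k) :: 'n::finite) = idx k"
proof -
  have "(Suc k + (CARD('n) - Suc 0)) mod CARD('n) = k" using assms by (simp add: Suc_lessD)
  then show ?thesis using assms by (simp add: apply_rot)
qed

lemma apply_adj:
  "Perm.apply (adj k) (idx k) = idx (Suc k)" "Perm.apply (adj k) (idx (Suc k)) = idx k"
  by (simp_all add: adj_def)

definition orig :: "'n::finite" where "orig = idx 0"

lemma pos_orig [simp]: "pos (orig :: 'n::finite) = 0"
  by (simp add: orig_def)

text \<open>
  An operator that commutes with the stabilizer of the first index has well-defined conjugates
  labelled by all indices, and they are permuted by the group.
\<close>
locale stabilizer_commuting = sym_rep scale act
  for scale :: "complex \<Rightarrow> 'v::ab_group_add \<Rightarrow> 'v" and act :: "'n::finite perm \<Rightarrow> 'v \<Rightarrow> 'v" +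
  fixes A :: "'v \<Rightarrow> 'v"
  assumes A_adj: "Suc (Suc k) < CARD('n) \<Longrightarrow> act (adj (Suc k)) (A v) = A (act (adj (Suc k)) v)"
begin

definition spread :: "'n \<Rightarrow> 'v \<Rightarrow> 'v" where
  "spread i v = act (Perm.swap orig i) (A (act (Perm.swap orig i) v))"

lemma spread_orig: "spread orig = A"
  by (simp add: spread_def act_one fun_eq_iff)

lemma A_stabilizer:
  "Perm.apply \<rho> orig = orig \<Longrightarrow> act \<rho> (A v) = A (act \<rho> v)"
proof (induction \<rho> arbitrary: v rule: perm_descent_induct)
  case one
  show ?case by (simp add: act_one)
next
  case (descent \<rho> k)
  have "k \<noteq> 0" using descent by (intro notI) (simp add: descent_def flip: orig_def)
  then obtain l where l: "k = Suc l" by (cases k) auto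
  have k: "Suc k < CARD('n)" using descent by (simp add: descent_def)
  have "Perm.apply (\<rho> * adj k) orig = orig"
    using k descent.prems by (simp add: apply_times adj_def orig_def idx_inject l)
  from descent.IH[OF this, of "act (adj k) v"]
  have "act (\<rho> * adj k) (A (act (adj k) v)) = A (act \<rho> v)" by (simp flip: act_mult)
  moreover have "A (act (adj k) v) = act (adj k) (A v)" using A_adj[of l v] k by (simp add: l)
  ultimately show ?case by (simp flip: act_mult)
qed

lemma spread_equivariant: "act \<sigma> (spread i v) = spread (Perm.apply \<sigma> i) (act \<sigma> v)"
proof -
  let ?\<rho> = "Perm.swap orig (Perm.apply \<sigma> i) * \<sigma> * Perm.swap orig i"
  have "Perm.apply ?\<rho> orig = orig" by (simp add: apply_times)
  from A_stabilizer[OF this, of "act (Perm.swap orig i) v"]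
  have "act ?\<rho> (A (act (Perm.swap orig i) v)) = A (act (Perm.swap orig (Perm.apply \<sigma> i) * \<sigma>) v)"
    by (simp add: mult.assoc flip: act_mult)
  then have "act (Perm.swap orig (Perm.apply \<sigma> i)) (act ?\<rho> (A (act (Perm.swap orig i) v)))
      = spread (Perm.apply \<sigma> i) (act \<sigma> v)"
    by (simp add: spread_def act_mult)
  moreover have "Perm.swap orig (Perm.apply \<sigma> i) * ?\<rho> = \<sigma> * Perm.swap orig i"
    by (simp flip: mult.assoc)
  ultimately show ?thesis by (simp add: spread_def flip: act_mult)
qed

lemma spread_linear:
  assumes "Vector_Spaces.linear scale scale A"
  shows "Vector_Spaces.linear scale scale (spread i)"
proof -
  interpret A: Vector_Spaces.linear scale scale A by fact
  show ?thesis
    by (rule linear_scaleI) (simp_all add: vector_space_axioms spread_def act_add act_scale A.add A.scale)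
qed

end

text \<open>
  Generators and relations of the degenerate double affine Hecke algebra: \<open>P\<close> is the element
  of length zero that rotates the affine Dynkin diagram, and the \<open>z\<^sub>i\<close> are the commuting
  elements, centred so that a common shift does not change them. Centring is responsible for the
  term \<open>P v\<close> in the relation between \<open>z\<close> and \<open>P\<close>.
\<close>
locale trig_module = sym_rep scale act
  for scale :: "complex \<Rightarrow> 'v::ab_group_add \<Rightarrow> 'v" and act :: "'n::finite perm \<Rightarrow> 'v \<Rightarrow> 'v" +
  fixes P :: "'v \<Rightarrow> 'v" and z :: "'n \<Rightarrow> 'v \<Rightarrow> 'v" and m :: complex
  assumes P_linear: "Vector_Spaces.linear scale scale P"
    and z_linear: "Vector_Spaces.linear scale scale (z i)"
    and adj_P: "Suc (Suc k) < CARD('n) \<Longrightarrow> act (adj (Suc k)) (P v) = P (act (adj k) v)"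
    and adj_P_P: "2 \<le> CARD('n) \<Longrightarrow> act (adj 0) (P (P v)) = P (P (act (adj (CARD('n) - 2)) v))"
    and z_commute: "z i (z j v) = z j (z i v)"
    and adj_z: "Suc k < CARD('n) \<Longrightarrow>
      act (adj k) (z (idx k) v) = z (idx (Suc k)) (act (adj k) v) + scale m v"
    and adj_z_other: "Suc k < CARD('n) \<Longrightarrow> i \<noteq> idx k \<Longrightarrow> i \<noteq> idx (Suc k) \<Longrightarrow>
      act (adj k) (z i v) = z i (act (adj k) v)"
    and z_P: "Suc k < CARD('n) \<Longrightarrow> z (idx (Suc k)) (P v) = P (z (idx k) v) + P v"
    and z_P_0: "z (idx 0) (P v) = P (z (idx (CARD('n) - Suc 0)) v) + scale (1 - of_nat CARD('n)) (P v)"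
begin

sublocale P: Vector_Spaces.linear scale scale P by (rule P_linear)
sublocale z: Vector_Spaces.linear scale scale "z i" for i by (rule z_linear)
sublocale act: Vector_Spaces.linear scale scale "act \<sigma>" for \<sigma> by (rule act_linear)

sublocale XS: stabilizer_commuting scale act "\<lambda>v. P (act rot v)"
proof
  fix k v
  assume k: "Suc (Suc k) < CARD('n)"
  have "rot * adj (Suc k) = (adj k * rot :: 'n perm)"
    unfolding adj_def by (subst perm_swap_conj) (use k in \<open>simp add: rot_idx_Suc\<close>)
  then show "act (adj (Suc k)) (P (act rot v)) = P (act rot (act (adj (Suc k)) v))"
    using k by (simp add: adj_P flip: act_mult)
qed

sublocale Y: stabilizer_commuting scale act "z orig"
  by unfold_locales (rule adj_z_other; simp add: orig_def idx_inject)

text \<open>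
  The translations \<open>X\<^sub>i\<close> commute with each other and are permuted by the group. So are the
  \<open>Y\<^sub>i\<close>, which differ from the \<open>z\<^sub>i\<close> by elements of the group algebra; they no longer
  commute, but their commutators have degree at most one.
\<close>
definition X :: "'n \<Rightarrow> 'v \<Rightarrow> 'v" where "X = XS.spread"
abbreviation Y :: "'n \<Rightarrow> 'v \<Rightarrow> 'v" where "Y \<equiv> Y.spread"

lemma X_equivariant: "act \<sigma> (X i v) = X (Perm.apply \<sigma> i) (act \<sigma> v)"
  unfolding X_def by (rule XS.spread_equivariant)

lemmas Y_equivariant = Y.spread_equivariant

lemma X_linear: "Vector_Spaces.linear scale scale (X i)"
  unfolding X_def by (rule XS.spread_linear) (rule linear_scaleI, simp_all add: vector_space_axioms act_add act_scale P.add P.scale)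

sublocale X: Vector_Spaces.linear scale scale "X i" for i by (rule X_linear)
sublocale Y: Vector_Spaces.linear scale scale "Y i" for i by (rule Y.spread_linear) (rule z_linear)

lemma X_orig: "X orig v = P (act rot v)"
  unfolding X_def XS.spread_orig ..

lemma Y_orig: "Y orig v = z orig v"
  by (simp add: Y.spread_orig)

lemma P_X: "P v = X orig (act (inverse rot) v)"
  by (simp add: X_orig)

text \<open>
  Writing \<open>P\<close> as \<open>X orig\<close> times a cycle, the relation for two \<open>P\<close>'s becomes the
  commutation of the first two translations, up to an identity between permutations.
\<close>
lemma X_commute_first:
  assumes N: "2 \<le> CARD('n)"
  shows "X (idx (Suc 0)) (X orig u) = X orig (X (idx (Suc 0)) u)"
proof -
  define r :: "'n perm" where "r = inverse rot"
  define s :: "'n perm" where "s = adj 0"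
  define \<rho> where "\<rho> = s * r"
  have s: "s = Perm.swap orig (idx (Suc 0))" by (simp add: s_def adj_def orig_def)
  have rot_r: "Perm.apply rot (Perm.apply r i) = i" "Perm.apply r (Perm.apply rot i) = i" for i
    by (simp_all add: r_def)
  have r_Suc: "Perm.apply r (idx k) = idx (Suc k)" if "Suc k < CARD('n)" for k
    by (metis rot_r(2) rot_idx_Suc[OF that])
  have r_last: "Perm.apply r (idx (CARD('n) - Suc 0)) = orig"
    by (metis rot_r(2) rot_idx_0 orig_def)
  have sr: "s * \<rho> = r" by (simp add: \<rho>_def s_def)
  have "Perm.apply \<rho> orig = orig"
    using N r_Suc[of 0] by (simp add: \<rho>_def apply_times s flip: orig_def)
  then have \<rho>X: "act \<rho> (X orig v) = X orig (act \<rho> v)" for v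
    by (simp add: X_equivariant)
  have sX: "act s (X orig v) = X (idx (Suc 0)) (act s v)" for v
    by (simp add: X_equivariant s)
  have ss: "act s (act s v) = v" for v by (simp add: s_def act_one flip: act_mult)
  have rX: "act r (X orig v) = X (idx (Suc 0)) (act r v)" for v
  proof -
    have "act r (X orig v) = act s (act \<rho> (X orig v))" by (simp add: sr flip: act_mult)
    also have "\<dots> = X (idx (Suc 0)) (act (s * \<rho>) v)" by (simp only: \<rho>X sX act_mult)
    finally show ?thesis by (simp add: sr)
  qed
  have rr: "r * r * adj (CARD('n) - 2) = s * (r * r)"
  proof -
    have e: "Suc (CARD('n) - 2) = CARD('n) - Suc 0" using N by simp
    have "Perm.apply r (idx (CARD('n) - 2)) = idx (CARD('n) - Suc 0)"
      using r_Suc[of "CARD('n) - 2"] N by (simp add: e)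
    moreover have "Perm.apply r orig = idx (Suc 0)" using r_Suc[of 0] N by (simp add: orig_def)
    ultimately show ?thesis
      unfolding adj_def e s by (subst perm_swap_conj) (simp add: apply_times r_last)
  qed
  have "X (idx (Suc 0)) (X orig (act (s * (r * r)) v)) = X orig (X (idx (Suc 0)) (act (s * (r * r)) v))" for v
  proof -
    have PP: "P (P u) = X orig (X (idx (Suc 0)) (act (r * r) u))" for u
    proof -
      have Pr: "P v = X orig (act r v)" for v unfolding r_def by (rule P_X)
      have "P (P u) = X orig (act r (P u))" by (rule Pr)
      also have "\<dots> = X orig (act r (X orig (act r u)))" by (subst Pr) (rule refl)
      finally show ?thesis by (simp only: rX act_mult)
    qed
    have sX': "act s (X (idx (Suc 0)) u) = X orig (act s u)" for u
      by (simp add: X_equivariant s)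
    have "X (idx (Suc 0)) (X orig (act (s * (r * r)) v)) = act s (P (P v))"
      by (simp only: PP sX sX' act_mult)
    also have "\<dots> = P (P (act (adj (CARD('n) - 2)) v))"
      unfolding s_def by (rule adj_P_P[OF N])
    also have "\<dots> = X orig (X (idx (Suc 0)) (act (s * (r * r)) v))"
      by (simp only: PP rr flip: act_mult)
    finally show ?thesis .
  qed
  from this[of "act (inverse (s * (r * r))) u"] show ?thesis by (simp only: act_inverse)
qed

lemma X_commute: "X i (X j v) = X j (X i v)"
proof (cases "i = j")
  case False
  have N: "2 \<le> CARD('n)"
    using card_mono[of "UNIV :: 'n set" "{i, j}"] False by simp
  then have "orig \<noteq> (idx (Suc 0) :: 'n)" by (simp add: orig_def idx_inject)
  from perm_pair_exists[OF this False] obtain \<sigma> where \<sigma>: "Perm.apply \<sigma> orig = i" "Perm.apply \<sigma> (idx (Suc 0)) = j" .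
  have "act \<sigma> (X orig (X (idx (Suc 0)) (act (inverse \<sigma>) v))) = act \<sigma> (X (idx (Suc 0)) (X orig (act (inverse \<sigma>) v)))"
    by (simp only: X_commute_first[OF N])
  then show ?thesis by (simp add: X_equivariant \<sigma>)
qed simp

text \<open>The correction term is a Jucys--Murphy element.\<close>
lemma Y_eq: "Y i v = z i v + scale m (\<Sum>j\<in>{j. pos j < pos i}. act (Perm.swap j i) v)"
proof -
  have "Y (idx k) v = z (idx k) v + scale m (\<Sum>j\<in>{j. pos j < k}. act (Perm.swap j (idx k)) v)"
    if "k < CARD('n)" for k v
    using that
  proof (induction k arbitrary: v)
    case 0
    show ?case by (simp add: Y_orig flip: orig_def)
  next
    case (Suc k)
    let ?a = "idx k :: 'n" and ?b = "idx (Suc k) :: 'n"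
    have k: "k < CARD('n)" using Suc.prems by simp
    have ab: "?a \<noteq> ?b" using Suc.prems by (simp add: idx_inject)
    have aa: "act (adj k) (act (adj k) v) = v" by (simp add: act_one flip: act_mult)
    have "Y ?b v = act (adj k) (Y ?a (act (adj k) v))"
      by (simp add: Y_equivariant aa apply_adj)
    also have "\<dots> = act (adj k) (z ?a (act (adj k) v)) +
        scale m (\<Sum>j\<in>{j. pos j < k}. act (adj k) (act (Perm.swap j ?a) (act (adj k) v)))"
      by (simp add: Suc.IH[OF k] act_add act_scale act.sum)
    also have "act (adj k) (z ?a (act (adj k) v)) = z ?b v + scale m (act (adj k) v)"
      using adj_z[OF Suc.prems, of "act (adj k) v"] by (simp add: aa)
    also have "(\<Sum>j\<in>{j. pos j < k}. act (adj k) (act (Perm.swap j ?a) (act (adj k) v)))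
        = (\<Sum>j\<in>{j. pos j < k}. act (Perm.swap j ?b) v)"
    proof (rule sum.cong[OF refl])
      fix j :: 'n assume "j \<in> {j. pos j < k}"
      then have "j \<noteq> ?a" "j \<noteq> ?b" using Suc.prems by auto
      then have "adj k * Perm.swap j ?a = Perm.swap j ?b * adj k"
        by (subst perm_swap_conj) (simp add: adj_def)
      then have "act (adj k) (act (Perm.swap j ?a) (act (adj k) v)) = act (Perm.swap j ?b) (act (adj k) (act (adj k) v))"
        by (metis act_mult)
      then show "act (adj k) (act (Perm.swap j ?a) (act (adj k) v)) = act (Perm.swap j ?b) v"
        by (simp add: aa)
    qed
    also have "z ?b v + scale m (act (adj k) v) + scale m (\<Sum>j\<in>{j. pos j < k}. act (Perm.swap j ?b) v)
        = z ?b v + scale m (\<Sum>j\<in>{j. pos j < Suc k}. act (Perm.swap j ?b) v)"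
    proof -
      have "{j. pos j < Suc k} = insert ?a {j :: 'n. pos j < k}"
        using k by (auto simp: less_Suc_eq)
      moreover have "?a \<notin> {j. pos j < k}" using k by simp
      ultimately show ?thesis by (simp add: adj_def scale_right_distrib add.assoc)
    qed
    finally show ?case .
  qed
  from this[of "pos i"] show ?thesis by simp
qed

lemma z_eq: "z i v = Y i v - scale m (\<Sum>j\<in>{j. pos j < pos i}. act (Perm.swap j i) v)"
  by (simp add: Y_eq)


text \<open>
  Moving \<open>z\<close> past the cycle in \<open>X orig\<close> is easiest after replacing it by the equivariant
  \<open>Y\<close>: the cycle maps all but one of the transpositions in the Jucys--Murphy element to those
  of the next one, and the missing transposition is the commutator.
\<close>
lemma z_X_orig:
  assumes "i \<noteq> orig"
  shows "z i (X orig v) = X orig (z i v) + X orig v + scale m (X orig (act (Perm.swap orig i) v))"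
proof -
  have "pos i \<noteq> 0" using assms by (metis pos_orig pos_inject)
  then obtain k where k: "pos i = Suc k" by (cases "pos i") auto
  have Sk: "Suc k < CARD('n)" using pos_less[of i] by (simp add: k)
  have i: "i = idx (Suc k)" by (metis idx_pos k)
  let ?a = "idx k :: 'n"
  have rot_i: "Perm.apply rot i = ?a" using Sk by (simp add: i rot_idx_Suc)
  have "z ?a (act rot v) = Y ?a (act rot v) - scale m (\<Sum>j\<in>{j. pos j < k}. act (Perm.swap j ?a) (act rot v))"
    using Sk by (simp add: z_eq)
  also have "(\<Sum>j\<in>{j. pos j < k}. act (Perm.swap j ?a) (act rot v))
      = (\<Sum>j\<in>{j. pos j < pos i} - {orig}. act rot (act (Perm.swap j i) v))"
  proof (rule sum.reindex_bij_witness[of _ "Perm.apply rot" "Perm.apply (inverse rot)"])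
    fix j :: 'n assume j: "j \<in> {j. pos j < pos i} - {orig}"
    then have "pos j \<noteq> 0" by (metis DiffD2 pos_inject pos_orig singletonI)
    then obtain l where l: "pos j = Suc l" by (cases "pos j") auto
    then have "Suc l < CARD('n)" using pos_less[of j] by simp
    then have rj: "Perm.apply rot j = idx l" using rot_idx_Suc[of l] by (metis idx_pos l)
    show "Perm.apply rot j \<in> {j. pos j < k}" using j \<open>Suc l < CARD('n)\<close> by (simp add: rj l k)
    show "Perm.apply (inverse rot) (Perm.apply rot j) = j" by simp
  next
    fix j :: 'n assume j: "j \<in> {j. pos j < k}"
    then have "Suc (pos j) < CARD('n)" using Sk by simp
    from rot_idx_Suc[OF this] have rj: "Perm.apply (inverse rot) j = idx (Suc (pos j))"
      by (metis idx_pos perm_apply_inverse(1))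
    have "idx (Suc (pos j)) \<noteq> (orig :: 'n)"
      using \<open>Suc (pos j) < CARD('n)\<close> by (metis nat.distinct(1) pos_idx pos_orig)
    then show "Perm.apply (inverse rot) j \<in> {j. pos j < pos i} - {orig}"
      using j \<open>Suc (pos j) < CARD('n)\<close> by (simp add: rj k)
    show "Perm.apply rot (Perm.apply (inverse rot) j) = j" by simp
    show "act rot (act (Perm.swap (Perm.apply (inverse rot) j) i) v) = act (Perm.swap j ?a) (act rot v)"
      by (simp flip: act_mult add: perm_swap_conj rot_i)
  qed
  also have "Y ?a (act rot v) = act rot (Y i v)" by (simp add: Y_equivariant rot_i)
  also have "Y i v = z i v + scale m (\<Sum>j\<in>{j. pos j < pos i} - {orig}. act (Perm.swap j i) v)
      + scale m (act (Perm.swap orig i) v)"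
  proof -
    have "orig \<in> {j. pos j < pos i}" by (simp add: k)
    then show ?thesis
      unfolding Y_eq by (subst sum.remove[of _ orig]) (simp_all add: scale_right_distrib add_ac)
  qed
  finally have "z ?a (act rot v) = act rot (z i v) + scale m (act rot (act (Perm.swap orig i) v))"
    by (simp add: act_add act_scale act.sum)
  then show ?thesis
    using z_P[OF Sk, of "act rot v"] by (simp add: X_orig P.add P.scale i)
qed

lemma Y_X_orig:
  assumes "i \<noteq> orig"
  shows "Y i (X orig v) = X orig (Y i v) + X orig v + scale m (act (Perm.swap orig i) (X orig v))"
proof -
  let ?J = "{j. pos j < pos i} - {orig}"
  have "pos i \<noteq> 0" using assms by (metis pos_orig pos_inject)
  then have o: "orig \<in> {j. pos j < pos i}" by simp
  have Y: "Y i u = z i u + (scale m (act (Perm.swap orig i) u) + scale m (\<Sum>j\<in>?J. act (Perm.swap j i) u))" for u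
    unfolding Y_eq by (subst sum.remove[OF _ o]) (simp_all add: scale_right_distrib)
  have "act (Perm.swap j i) (X orig v) = X orig (act (Perm.swap j i) v)" if "j \<in> ?J" for j
  proof -
    have "Perm.apply (Perm.swap j i) orig = orig"
      using that assms by (intro apply_swap_same) auto
    then show ?thesis by (simp add: X_equivariant)
  qed
  then have "(\<Sum>j\<in>?J. act (Perm.swap j i) (X orig v)) = X orig (\<Sum>j\<in>?J. act (Perm.swap j i) v)"
    by (simp add: X.sum)
  then show ?thesis
    by (simp add: Y z_X_orig[OF assms] X.add X.scale)
qed

lemma Y_X:
  assumes "i \<noteq> j"
  shows "Y i (X j v) = X j (Y i v) + X j v + scale m (X i (act (Perm.swap j i) v))"
proof (cases "CARD('n) \<ge> 2")
  case True
  then have "orig \<noteq> (idx (Suc 0) :: 'n)" by (simp add: orig_def idx_inject)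
  from perm_pair_exists[OF this assms[symmetric]] obtain \<sigma>
    where \<sigma>: "Perm.apply \<sigma> orig = j" "Perm.apply \<sigma> (idx (Suc 0)) = i" .
  have "act \<sigma> (Y (idx (Suc 0)) (X orig (act (inverse \<sigma>) v))) =
      act \<sigma> (X orig (Y (idx (Suc 0)) (act (inverse \<sigma>) v)) + X orig (act (inverse \<sigma>) v) +
        scale m (X (idx (Suc 0)) (act (Perm.swap orig (idx (Suc 0))) (act (inverse \<sigma>) v))))"
    by (subst Y_X_orig) (use \<open>orig \<noteq> idx (Suc 0)\<close> in \<open>simp_all add: X_equivariant\<close>)
  moreover have "act \<sigma> (act (Perm.swap orig (idx (Suc 0))) (act (inverse \<sigma>) v)) = act (Perm.swap j i) v"
    using perm_swap_conj[of \<sigma> orig "idx (Suc 0)"] \<sigma>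
    by (metis act_inverse(2) act_mult)
  ultimately show ?thesis
    by (simp add: X_equivariant Y_equivariant \<sigma> act_add act_scale)
next
  case False
  then show ?thesis using assms card_mono[of "UNIV :: 'n set" "{i, j}"] by simp
qed

lemma Y_X_orig_orig:
  "Y orig (X orig v) = X orig (Y orig v) + scale (1 - of_nat CARD('n)) (X orig v)
     - scale m (\<Sum>j\<in>UNIV - {orig}. X orig (act (Perm.swap orig j) v))"
proof -
  let ?a = "idx (CARD('n) - Suc 0) :: 'n"
  have rot_o: "Perm.apply rot orig = ?a" by (simp add: orig_def rot_idx_0)
  have pos_a: "pos ?a = CARD('n) - Suc 0" by (rule pos_idx) simp
  have "z ?a (act rot v) = Y ?a (act rot v) - scale m (\<Sum>j\<in>{j. pos j < pos ?a}. act (Perm.swap j ?a) (act rot v))"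
    by (simp add: z_eq)
  also have "(\<Sum>j\<in>{j. pos j < pos ?a}. act (Perm.swap j ?a) (act rot v))
      = (\<Sum>j\<in>UNIV - {orig}. act rot (act (Perm.swap orig j) v))"
  proof (rule sum.reindex_bij_witness[of _ "Perm.apply rot" "Perm.apply (inverse rot)"])
    fix j :: 'n assume j: "j \<in> UNIV - {orig}"
    then have "Perm.apply rot j \<noteq> ?a" by (metis DiffD2 apply_inj rot_o singletonI)
    then have "pos (Perm.apply rot j) \<noteq> CARD('n) - Suc 0" by (metis pos_a pos_inject)
    then show "Perm.apply rot j \<in> {j. pos j < pos ?a}"
      using pos_less[of "Perm.apply rot j"] unfolding pos_a mem_Collect_eq by linarith
    show "Perm.apply (inverse rot) (Perm.apply rot j) = j" by simp
  next
    fix j :: 'n assume "j \<in> {j. pos j < pos ?a}"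
    then have "j \<noteq> Perm.apply rot orig" by (auto simp: rot_o)
    then show "Perm.apply (inverse rot) j \<in> UNIV - {orig}"
      by (metis DiffI UNIV_I perm_apply_inverse(2) singletonD)
    show "Perm.apply rot (Perm.apply (inverse rot) j) = j" by simp
    show "act rot (act (Perm.swap orig (Perm.apply (inverse rot) j)) v) = act (Perm.swap j ?a) (act rot v)"
      by (simp flip: act_mult add: perm_swap_conj rot_o) (simp add: swap_sym)
  qed
  also have "Y ?a (act rot v) = act rot (z orig v)"
    by (simp add: Y_equivariant rot_o flip: Y_orig)
  finally show ?thesis
    using z_P_0[of "act rot v"]
    by (simp add: X_orig Y_orig P.diff P.scale P.sum flip: orig_def)
qed

lemma Y_X_same:
  "Y i (X i v) = X i (Y i v) + scale (1 - of_nat CARD('n)) (X i v)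
     - scale m (\<Sum>j\<in>UNIV - {i}. X i (act (Perm.swap i j) v))"
proof -
  let ?\<sigma> = "Perm.swap orig i"
  have "act ?\<sigma> (Y orig (X orig (act ?\<sigma> v))) = act ?\<sigma> (X orig (Y orig (act ?\<sigma> v))
      + scale (1 - of_nat CARD('n)) (X orig (act ?\<sigma> v))
      - scale m (\<Sum>j\<in>UNIV - {orig}. X orig (act (Perm.swap orig j) (act ?\<sigma> v))))"
    by (subst Y_X_orig_orig) (rule refl)
  moreover have "(\<Sum>j\<in>UNIV - {orig}. act ?\<sigma> (X orig (act (Perm.swap orig j) (act ?\<sigma> v))))
      = (\<Sum>j\<in>UNIV - {i}. X i (act (Perm.swap i j) v))"
  proof (rule sum.reindex_bij_witness[of _ "Perm.apply ?\<sigma>" "Perm.apply ?\<sigma>"])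
    have inv: "Perm.apply ?\<sigma> (Perm.apply ?\<sigma> j) = j" for j
      by (simp add: apply_sequence)
    show "Perm.apply ?\<sigma> (Perm.apply ?\<sigma> j) = j" "Perm.apply ?\<sigma> (Perm.apply ?\<sigma> j) = j" for j
      by (rule inv)+
    show "Perm.apply ?\<sigma> j \<in> UNIV - {i}" if "j \<in> UNIV - {orig}" for j
      using that by simp
    show "Perm.apply ?\<sigma> j \<in> UNIV - {orig}" if "j \<in> UNIV - {i}" for j
      using that by simp
    fix j :: 'n
    have "?\<sigma> * Perm.swap orig j * ?\<sigma> = Perm.swap i (Perm.apply ?\<sigma> j)"
      by (subst perm_swap_conj) (simp add: mult.assoc)
    then have "act ?\<sigma> (act (Perm.swap orig j) (act ?\<sigma> v)) = act (Perm.swap i (Perm.apply ?\<sigma> j)) v"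
      by (metis act_mult)
    then show "X i (act (Perm.swap i (Perm.apply ?\<sigma> j)) v) = act ?\<sigma> (X orig (act (Perm.swap orig j) (act ?\<sigma> v)))"
      by (simp add: X_equivariant)
  qed
  moreover have "act ?\<sigma> (act ?\<sigma> v) = v" by (simp add: act_one flip: act_mult)
  ultimately show ?thesis
    by (simp add: X_equivariant Y_equivariant act_add act.diff act_scale act.sum)
qed

text \<open>
  All transpositions cancel in the commutator with the symmetric function \<open>\<Sum>\<^sub>j X\<^sub>j\<close>; what
  remains is the derivative of that function, centred.
\<close>
lemma Y_sum_X:
  "Y i (\<Sum>j\<in>UNIV. X j v) = (\<Sum>j\<in>UNIV. X j (Y i v)) + (\<Sum>j\<in>UNIV. X j v) - scale (of_nat CARD('n)) (X i v)"
proof -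
  have split: "(\<Sum>j\<in>UNIV. h j) = h i + (\<Sum>j\<in>UNIV - {i}. h j)" for h :: "'n \<Rightarrow> 'v"
    by (rule sum.remove) simp_all
  have "(\<Sum>j\<in>UNIV - {i}. Y i (X j v)) = (\<Sum>j\<in>UNIV - {i}. X j (Y i v) + X j v + scale m (X i (act (Perm.swap i j) v)))"
    by (rule sum.cong) (auto simp: Y_X swap_sym)
  then show ?thesis
    unfolding Y.sum split[of "\<lambda>j. Y i (X j v)"] Y_X_same
    by (simp add: split[of "\<lambda>j. X j v"] split[of "\<lambda>j. X j (Y i v)"] sum.distrib scale_sum_right
      scale_left_diff_distrib algebra_simps)
qed

end

section \<open>One-dimensional invariants force unipotency\<close>

locale spherical_trig_module = trig_module scale act P z m
  for scale :: "complex \<Rightarrow> 'v::ab_group_add \<Rightarrow> 'v" and act :: "'n::finite perm \<Rightarrow> 'v \<Rightarrow> 'v"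
    and P :: "'v \<Rightarrow> 'v" and z :: "'n \<Rightarrow> 'v \<Rightarrow> 'v" and m :: complex +
  fixes w :: 'v and B :: "'v set"
  assumes w_nonzero: "w \<noteq> 0"
    and w_invariant: "act \<sigma> w = w"
    and invariants: "(\<And>\<sigma>. act \<sigma> v = v) \<Longrightarrow> v \<in> span {w}"
    and finite_B: "finite B" and span_B: "span B = UNIV"
    and irreducible: "subspace S \<Longrightarrow> w \<in> S \<Longrightarrow> (\<And>\<sigma> v. v \<in> S \<Longrightarrow> act \<sigma> v \<in> S) \<Longrightarrow>
      (\<And>v. v \<in> S \<Longrightarrow> P v \<in> S) \<Longrightarrow> (\<And>i v. v \<in> S \<Longrightarrow> z i v \<in> S) \<Longrightarrow> S = UNIV"
begin

abbreviation X_sum :: "'v \<Rightarrow> 'v" where "X_sum v \<equiv> \<Sum>j\<in>UNIV. X j v"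

definition center :: complex where
  "center = (SOME c. X_sum w = scale (of_nat CARD('n) * c) w)"

lemma X_pow_equivariant: "act \<sigma> ((X i ^^ k) v) = (X (Perm.apply \<sigma> i) ^^ k) (act \<sigma> v)"
  by (induction k) (simp_all add: X_equivariant)

lemma X_pow_commute: "(X i ^^ k) (X j v) = X j ((X i ^^ k) v)"
  by (induction k) (simp_all add: X_commute)

lemma X_pow_linear: "Vector_Spaces.linear scale scale (X i ^^ k)"
proof (induction k)
  case 0
  show ?case using linear_id by (simp add: id_def)
next
  case (Suc k)
  show ?case unfolding funpow.simps by (rule Vector_Spaces.linear_compose[OF Suc X_linear])
qed

sublocale X_pow: Vector_Spaces.linear scale scale "X i ^^ k" for i k
  by (rule X_pow_linear)

lemma equivariant_sum_scalar:
  assumes "\<And>\<sigma> i. act \<sigma> (h i) = h (Perm.apply \<sigma> i)"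
  shows "\<exists>c. (\<Sum>i\<in>UNIV. h i) = scale c w"
proof -
  have "act \<sigma> (\<Sum>i\<in>UNIV. h i) = (\<Sum>i\<in>UNIV. h i)" for \<sigma>
    unfolding act.sum assms by (rule sum.reindex_bij_betw) simp
  then have "(\<Sum>i\<in>UNIV. h i) \<in> span {w}" by (rule invariants)
  then show ?thesis by (auto simp: span_singleton)
qed

lemma center: "X_sum w = scale (of_nat CARD('n) * center) w"
proof -
  have "\<exists>c. X_sum w = scale c w"
    by (rule equivariant_sum_scalar) (simp add: X_equivariant w_invariant)
  then obtain c where "X_sum w = scale c w" ..
  then have "X_sum w = scale (of_nat CARD('n) * (c / of_nat CARD('n))) w" by simp
  then show ?thesis unfolding center_def by (rule someI)
qed

text \<open>
  As the invariants are a line, \<open>E = \<Sum>\<^sub>i X\<^sub>i\<^sup>k Y\<^sub>i\<close> and \<open>\<Sum>\<^sub>j X\<^sub>j\<close> act on \<open>w\<close> by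
  scalars, so their commutator kills \<open>w\<close>. Computing it expresses the power sum of degree
  \<open>k + 1\<close> by those of degrees \<open>k\<close> and \<open>1\<close>. The power sums are therefore those of a single
  point with all coordinates equal.
\<close>
lemma power_sum_w: "(\<Sum>i\<in>UNIV. (X i ^^ k) w) = scale (of_nat CARD('n) * center ^ k) w"
proof (induction k)
  case 0
  show ?case unfolding funpow_0 sum_constant_scale by simp
next
  case (Suc k)
  let ?N = "of_nat CARD('n) :: complex"
  let ?E = "\<Sum>i\<in>UNIV. (X i ^^ k) (Y i w)"
  have X_sum_linear: "X_sum (scale c v) = scale c (X_sum v)" for c v
    by (simp add: X.scale scale_sum_right)
  have "\<exists>c. ?E = scale c w"
    by (rule equivariant_sum_scalar) (simp add: X_pow_equivariant Y_equivariant w_invariant)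
  then obtain c where c: "?E = scale c w" ..
  have "scale (?N * center) ?E = (\<Sum>i\<in>UNIV. (X i ^^ k) (Y i (X_sum w)))"
    by (simp add: center Y.scale X_pow.scale scale_sum_right)
  also have "\<dots> = (\<Sum>i\<in>UNIV. (X i ^^ k) (X_sum (Y i w))) + (\<Sum>i\<in>UNIV. (X i ^^ k) (X_sum w))
      - scale ?N (\<Sum>i\<in>UNIV. (X i ^^ Suc k) w)"
    by (simp add: Y_sum_X X_pow.add X_pow.diff X_pow.scale sum.distrib sum_subtractf scale_sum_right X_pow_commute)
  also have "(\<Sum>i\<in>UNIV. (X i ^^ k) (X_sum (Y i w))) = X_sum ?E"
    by (simp add: X_pow.sum X.sum X_pow_commute) (rule sum.swap)
  also have "X_sum ?E = scale (?N * center) ?E"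
    unfolding c X_sum_linear center by (simp add: mult.commute)
  also have "(\<Sum>i\<in>UNIV. (X i ^^ k) (X_sum w)) = scale (?N * center) (scale (?N * center ^ k) w)"
    unfolding center X_pow.scale Suc.IH[symmetric] scale_sum_right ..
  finally have "scale ?N (\<Sum>i\<in>UNIV. (X i ^^ Suc k) w) = scale ?N (scale (?N * center ^ Suc k) w)"
    by (simp add: ac_simps)
  then show ?case by (subst (asm) scale_cancel_left) auto
qed

text \<open>The \<open>X\<^sub>i\<close> are recentred at their common eigenvalue, so as to become nilpotent.\<close>
definition gen :: "'n + 'n \<Rightarrow> 'v \<Rightarrow> 'v" where
  "gen a = (case a of Inl i \<Rightarrow> \<lambda>v. X i v - scale center v | Inr i \<Rightarrow> Y i)"

lemma gen_simps [simp]: "gen (Inl i) v = X i v - scale center v" "gen (Inr i) v = Y i v"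
  by (simp_all add: gen_def)

lemma gen_linear: "Vector_Spaces.linear scale scale (gen a)"
  by (rule linear_scaleI, rule vector_space_axioms, rule vector_space_axioms; cases a)
    (simp_all add: X.add X.scale Y.add Y.scale scale_right_distrib scale_right_diff_distrib mult.commute)

lemma foldr_gen_linear: "Vector_Spaces.linear scale scale (foldr gen c)"
proof (induction c)
  case Nil
  show ?case using linear_id by (simp add: id_def[abs_def])
next
  case (Cons a c)
  from Vector_Spaces.linear_compose[OF Cons gen_linear[of a]] show ?case by (simp add: comp_def)
qed

definition x_words :: "'v set" where
  "x_words = span ((\<lambda>c. foldr gen c w) ` lists (range Inl))"

lemma X_x_words: "v \<in> x_words \<Longrightarrow> X i v \<in> x_words"
  unfolding x_words_def
proof (induction rule: span_induct_alt)
  case base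
  show ?case by (simp add: X.zero span_zero)
next
  case (step a x y)
  then obtain c where c: "x = foldr gen c w" "c \<in> lists (range Inl)" by auto
  have "X i x = foldr gen (Inl i # c) w + scale center (foldr gen c w)" by (simp add: c)
  moreover have "foldr gen (Inl i # c) w + scale center (foldr gen c w) \<in> span ((\<lambda>c. foldr gen c w) ` lists (range Inl))"
    by (intro span_add span_scale span_base imageI) (use c in auto)
  ultimately show ?case using step by (simp add: X.add X.scale span_add span_scale)
qed

lemma power_sum_x_words:
  "v \<in> x_words \<Longrightarrow> (\<Sum>i\<in>UNIV. (X i ^^ k) v) = scale (of_nat CARD('n) * center ^ k) v"
  unfolding x_words_def
proof (induction rule: span_induct_alt)
  case base
  show ?case by (simp add: X_pow.zero)
next
  case (step a x y)
  then obtain c where c: "x = foldr gen c w" "c \<in> lists (range Inl)" by auto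
  interpret L: Vector_Spaces.linear scale scale "foldr gen c" by (rule foldr_gen_linear)
  have "(X i ^^ k) (foldr gen c v) = foldr gen c ((X i ^^ k) v)" for i v
    using c(2) by (induction c) (auto simp: X_pow.diff X_pow.scale X_pow_commute)
  then have "(\<Sum>i\<in>UNIV. (X i ^^ k) x) = foldr gen c (\<Sum>i\<in>UNIV. (X i ^^ k) w)"
    by (simp add: c L.sum)
  then have "(\<Sum>i\<in>UNIV. (X i ^^ k) x) = scale (of_nat CARD('n) * center ^ k) x"
    by (simp add: power_sum_w L.scale c)
  then show ?case
    using step by (simp add: X_pow.add X_pow.scale sum.distrib scale_right_distrib mult.commute flip: scale_sum_right)
qed

lemma x_socle: "\<exists>v\<in>x_words. v \<noteq> 0 \<and> (\<forall>i. gen (Inl i) v = 0)"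
proof -
  have w: "w \<in> x_words" unfolding x_words_def by (rule span_base) (auto intro!: image_eqI[of _ _ "[]"])
  have "subspace x_words" by (simp add: x_words_def)
  from joint_eigenvector_exists[of scale X B x_words w, OF X_linear X_commute finite_B span_B this X_x_words w w_nonzero]
  obtain v a where v: "v \<in> x_words" "v \<noteq> 0" and a: "\<And>i. X i v = scale (a i) v" by metis
  have pow: "(X i ^^ k) v = scale (a i ^ k) v" for i k
    by (induction k) (simp_all add: X.scale a mult.commute)
  have "(\<Sum>i\<in>UNIV. a i ^ k) = of_nat CARD('n) * center ^ k" for k
  proof -
    have "scale (\<Sum>i\<in>UNIV. a i ^ k) v = scale (of_nat CARD('n) * center ^ k) v"
      using power_sum_x_words[OF v(1), of k] by (simp add: pow scale_sum_left)
    with v(2) show ?thesis by simp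
  qed
  then have "a i = center" for i by (rule equal_power_sums)
  with v a show ?thesis by auto
qed

text \<open>
  Between an \<open>X\<close> and a \<open>Y\<close> the commutator relations have no \<open>Y\<close> on the right-hand side.
  Between two \<open>Y\<close>'s the commutator is compared with that of the commuting \<open>z\<close>'s.
\<close>
lemma gen_commutator:
  "gen a (gen b v) - gen b (gen a v) \<in> span {foldr gen c (act \<sigma> v) | c \<sigma>. ydeg c < ydeg [a, b]}"
    (is "_ \<in> span (?S a b)")
proof -
  have word: "foldr gen c (act \<sigma> v) \<in> span (?S a b)" if "ydeg c < ydeg [a, b]" for c a b \<sigma>
    by (rule span_base) (use that in blast)
  have act0: "act \<sigma> v \<in> span (?S a b)" if "0 < ydeg [a, b]" for a b \<sigma>
    using word[of "[]" a b \<sigma>] that by simp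
  have X0: "X i (act \<sigma> v) \<in> span (?S a b)" if "0 < ydeg [a, b]" for i a b \<sigma>
  proof -
    have "X i (act \<sigma> v) = foldr gen [Inl i] (act \<sigma> v) + scale center (act \<sigma> v)" by simp
    also have "\<dots> \<in> span (?S a b)"
      by (intro span_add span_scale word act0 that) (use that in simp)
    finally show ?thesis .
  qed
  have X0': "X i v \<in> span (?S a b)" if "0 < ydeg [a, b]" for i a b
    using X0[OF that, of i 1] by (simp add: act_one)
  have YX: "Y i (X j v) - X j (Y i v) \<in> span (?S a b)" if "0 < ydeg [a, b]" for i j a b
  proof (cases "i = j")
    case True
    have "Y i (X j v) - X j (Y i v) = scale (1 - of_nat CARD('n)) (X i v)
        - scale m (\<Sum>l\<in>UNIV - {i}. X i (act (Perm.swap i l) v))"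
      by (simp add: True[symmetric] Y_X_same)
    also have "\<dots> \<in> span (?S a b)"
      by (intro span_diff span_sum span_scale X0' X0 that)
    finally show ?thesis .
  next
    case False
    have "Y i (X j v) - X j (Y i v) = X j v + scale m (X i (act (Perm.swap j i) v))"
      by (simp add: Y_X[OF False])
    also have "\<dots> \<in> span (?S a b)"
      by (intro span_add span_scale X0' X0 that)
    finally show ?thesis .
  qed
  have Y0: "Y i (act \<sigma> v) \<in> span (?S a b)" if "1 < ydeg [a, b]" for i a b \<sigma>
    using word[of "[Inr i]" a b \<sigma>] that by simp
  show ?thesis
  proof (cases a; cases b)
    fix i j assume ab: "a = Inl i" "b = Inl j"
    have "gen a (gen b v) - gen b (gen a v) = 0"
      by (simp add: ab X.diff X.scale scale_right_diff_distrib X_commute[of i j])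
    then show ?thesis by (simp add: span_zero)
  next
    fix i j assume ab: "a = Inr i" "b = Inl j"
    have "gen a (gen b v) - gen b (gen a v) = Y i (X j v) - X j (Y i v)"
      by (simp add: ab Y.diff Y.scale)
    moreover have "Y i (X j v) - X j (Y i v) \<in> span (?S a b)"
      by (rule YX) (simp add: ab)
    ultimately show ?thesis by (simp only:)
  next
    fix i j assume ab: "a = Inl i" "b = Inr j"
    have "gen a (gen b v) - gen b (gen a v) = - (Y j (X i v) - X i (Y j v))"
      by (simp add: ab Y.diff Y.scale)
    moreover have "- (Y j (X i v) - X i (Y j v)) \<in> span (?S a b)"
      by (rule span_neg, rule YX) (simp add: ab)
    ultimately show ?thesis by (simp only:)
  next
    fix i j assume ab: "a = Inr i" "b = Inr j"
    define q where "q i v = scale m (\<Sum>l\<in>{l. pos l < pos i}. act (Perm.swap l i) v)" for i v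
    have zq: "z i v = Y i v - q i v" for i v unfolding q_def by (rule z_eq)
    have q_diff: "q i (u - v) = q i u - q i v" for i u v
      by (simp add: q_def act.diff sum_subtractf scale_right_diff_distrib)
    have two: "1 < ydeg [a, b]" "0 < ydeg [a, b]" by (simp_all add: ab)
    have qY: "q i (Y j v) \<in> span (?S a b)" for i j
      unfolding q_def Y_equivariant by (intro span_scale span_sum Y0 two)
    have Yq: "Y i (q j v) \<in> span (?S a b)" for i j
      unfolding q_def Y.scale Y.sum by (intro span_scale span_sum Y0 two)
    have qq: "q i (q j v) \<in> span (?S a b)" for i j
      unfolding q_def act_scale act.sum act_mult[symmetric] by (intro span_scale span_sum act0 two)
    have "z i (z j v) = z j (z i v)" by (rule z_commute)
    then have "Y i (Y j v) - Y j (Y i v) =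
        (q i (Y j v) + Y i (q j v) - q i (q j v)) - (q j (Y i v) + Y j (q i v) - q j (q i v))"
      by (simp add: zq Y.diff q_diff algebra_simps)
    also have "\<dots> \<in> span (?S a b)" by (intro span_diff span_add qY Yq qq)
    finally show ?thesis by (simp only: ab gen_simps)
  qed
qed

lemma gen_generates: "span (range (\<lambda>c. foldr gen c w)) = UNIV"
proof -
  let ?S = "span (range (\<lambda>c. foldr gen c w))"
  have gen_S: "gen a v \<in> ?S" if "v \<in> ?S" for a v
  proof -
    interpret L: Vector_Spaces.linear scale scale "gen a" by (rule gen_linear)
    show ?thesis using that
    proof (induction rule: span_induct_alt)
      case base
      show ?case by (simp add: L.zero span_zero)
    next
      case (step b x y)
      then obtain c where "x = foldr gen c w" by auto
      then have "gen a x = foldr gen (a # c) w" by simp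
      then have "gen a x \<in> ?S" by (metis rangeI span_base)
      with step show ?case by (simp add: L.add L.scale span_add span_scale del: gen_simps)
    qed
  qed
  have word_act: "act \<sigma> (foldr gen c w) = foldr gen (map (map_sum (Perm.apply \<sigma>) (Perm.apply \<sigma>)) c) w" for \<sigma> c
  proof (induction c)
    case (Cons a c)
    then show ?case by (cases a) (simp_all add: act.diff act_scale X_equivariant Y_equivariant)
  qed (simp add: w_invariant)
  have act_S: "act \<sigma> v \<in> ?S" if "v \<in> ?S" for \<sigma> v
    using that
  proof (induction rule: span_induct_alt)
    case base
    show ?case by (simp add: act.zero span_zero)
  next
    case (step b x y)
    then obtain c where "x = foldr gen c w" by auto
    then have "act \<sigma> x \<in> ?S" by (metis word_act rangeI span_base)
    with step show ?case by (simp add: act_add act_scale span_add span_scale)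
  qed
  have X_S: "X i v \<in> ?S" if "v \<in> ?S" for i v
  proof -
    have "X i v = gen (Inl i) v + scale center v" by simp
    with gen_S[OF that, of "Inl i"] that show ?thesis by (metis span_add span_scale)
  qed
  show ?thesis
  proof (rule irreducible)
    show "w \<in> ?S" by (rule span_base) (auto intro!: range_eqI[of _ _ "[]"])
    show "act \<sigma> v \<in> ?S" if "v \<in> ?S" for \<sigma> v using that by (rule act_S)
    show "P v \<in> ?S" if "v \<in> ?S" for v
      using X_S[OF act_S[OF that, of "inverse rot"], of orig] by (simp only: P_X[symmetric])
    show "z i v \<in> ?S" if "v \<in> ?S" for i v
    proof -
      have "Y i v \<in> ?S" using gen_S[OF that, of "Inr i"] by simp
      then have "Y i v - scale m (\<Sum>j\<in>{j. pos j < pos i}. act (Perm.swap j i) v) \<in> ?S"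
        by (intro span_diff span_scale span_sum act_S that)
      then show ?thesis by (simp only: z_eq[symmetric])
    qed
  qed simp
qed

theorem spherical_module_contained_in_DH: "contains_subrep (scale_DH :: complex \<Rightarrow> 'n DH \<Rightarrow> 'n DH) perm_DH scale act"
proof -
  have equi: "act \<sigma> (gen a v) = gen (map_sum (Perm.apply \<sigma>) (Perm.apply \<sigma>) a) (act \<sigma> v)" for \<sigma> a v
    by (cases a) (simp_all add: act.diff act_scale X_equivariant Y_equivariant)
  interpret deformed_coinvariants scale act gen w
  proof (rule deformed_coinvariants.intro[OF sym_rep_axioms deformed_coinvariants_axioms.intro])
    show "v \<in> span {w}" if "\<And>\<sigma>. act \<sigma> v = v" for v using that by (rule invariants)
  qed (rule gen_linear equi gen_commutator w_invariant gen_generates x_socle[unfolded x_words_def])+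
  show ?thesis by (rule deformation_contained_in_DH)
qed

end

section \<open>Difference operators on affine permutations\<close>

text \<open>
  Values rather than positions are the spectral parameters: \<open>val u i\<close> will be the eigenvalue of
  the \<open>i\<close>-th commuting operator at \<open>u\<close>. Injectivity keeps all denominators nonzero.
\<close>

typedef (overloaded) 'n aff =
  "{u :: int \<Rightarrow> int. inj u \<and> (\<forall>i. u (i + int CARD('n::finite)) = u i + int CARD('n))}"
  morphisms val Aff
  by (rule exI[of _ id]) simp

setup_lifting type_definition_aff

lemma val_inject [simp]: "val u i = val u j \<longleftrightarrow> i = j"
  using val[of u] by (auto simp: inj_eq)

lemma val_add: "val (u :: 'n::finite aff) (i + int CARD('n)) = val u i + int CARD('n)"
  using val[of u] by auto

lemma val_add_mult: "val (u :: 'n::finite aff) (i + int CARD('n) * k) = val u i + int CARD('n) * k"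
proof (induction k rule: int_induct[of _ 0])
  case base
  show ?case by simp
next
  case (step1 k)
  then show ?case using val_add[of u "i + int CARD('n) * k"] by (simp add: algebra_simps)
next
  case (step2 k)
  then show ?case using val_add[of u "i + int CARD('n) * (k - 1)"] by (simp add: algebra_simps)
qed

text \<open>
  Any window of one period determines \<open>u\<close>. Choosing the window to start at \<open>i\<close> makes the
  affine transpositions of \<open>i\<close> and its neighbours look like ordinary ones.
\<close>
lemma aff_eqI:
  assumes "\<And>j. a \<le> j \<Longrightarrow> j < a + int CARD('n) \<Longrightarrow> val u j = val v j"
  shows "u = (v :: 'n::finite aff)"
proof -
  have "val u j = val v j" for j
  proof -
    let ?N = "int CARD('n)"
    have "0 \<le> (j - a) mod ?N" "(j - a) mod ?N < ?N" by simp_all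
    then have "val u (a + (j - a) mod ?N) = val v (a + (j - a) mod ?N)" by (intro assms) auto
    moreover have "j = a + (j - a) mod ?N + ?N * ((j - a) div ?N)" by simp
    ultimately show ?thesis by (metis val_add_mult)
  qed
  then show ?thesis by (metis val_inverse ext)
qed

text \<open>Exchange of the positions \<open>i\<close> and \<open>i + 1\<close>, and of all their translates by the period \<open>N\<close>.\<close>
definition sw :: "int \<Rightarrow> int \<Rightarrow> int \<Rightarrow> int" where
  "sw N i j = (if N dvd j - i then j + 1 else if N dvd j - (i + 1) then j - 1 else j)"

lemma dvd_small: "(N :: int) dvd a \<Longrightarrow> \<bar>a\<bar> < N \<Longrightarrow> a = 0"
  using zdvd_imp_le[of N "\<bar>a\<bar>"] by fastforce

lemma sw_window:
  assumes "i \<le> a + N - 2" "a \<le> i" "a \<le> j" "j < a + N"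
  shows "sw N i j = (if j = i then i + 1 else if j = i + 1 then i else j)"
  using dvd_small[of N "j - i"] dvd_small[of N "j - (i + 1)"] assms by (auto simp: sw_def)

lemma sw_add: "sw N i (j + N) = sw N i j + N"
proof -
  have "N dvd j + N - k \<longleftrightarrow> N dvd j - k" for k
  proof -
    have "j + N - k = (j - k) + N" by simp
    then show ?thesis by (metis dvd_add_triv_right_iff)
  qed
  then show ?thesis unfolding sw_def by simp
qed

lemma sw_inj: "inj (sw N i)"
proof (cases "N dvd 1")
  case True
  then have "N dvd k" for k by (metis dvd_trans one_dvd)
  then show ?thesis by (auto simp: sw_def inj_def)
next
  case False
  have "sw N i (sw N i j) = j" for j
  proof -
    have *: "\<not> N dvd a + 1" if "N dvd a" for a
    proof
      assume "N dvd a + 1"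
      from dvd_diff[OF this that] False show False by simp
    qed
    have e: "j + 1 - i = j - i + 1" "j + 1 - (i + 1) = j - i" "j - 1 - i = j - (i + 1)"
      by simp_all
    consider "N dvd j - i" | "\<not> N dvd j - i" "N dvd j - (i + 1)" | "\<not> N dvd j - i" "\<not> N dvd j - (i + 1)"
      by blast
    then show ?thesis
    proof cases
      case 1
      then show ?thesis using *[OF 1] unfolding sw_def e(1)[symmetric] by (simp only: e if_True if_False; simp)
    next
      case 2
      then show ?thesis unfolding sw_def by (simp only: e if_True if_False; simp)
    next
      case 3
      then show ?thesis unfolding sw_def by (simp only: if_False)
    qed
  qed
  then show ?thesis by (rule inj_on_inverseI)
qed

lemma inj_comp_sw: "inj u \<Longrightarrow> inj (\<lambda>j. u (sw N i j))"
  using inj_compose[OF _ sw_inj[of N i], of u] by (simp add: comp_def)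

lemma inj_comp_succ: "inj u \<Longrightarrow> inj (\<lambda>j. u (j + 1 :: int))"
  by (rule injI) (drule (1) injD, simp)

lemma periodic_comp_succ:
  "\<forall>i. u (i + N) = u i + N \<Longrightarrow> u (i + N + 1) = u (i + 1) + (N :: int)"
  by (drule spec[of _ "i + 1"]) (simp add: ac_simps)

lift_definition swp :: "int \<Rightarrow> 'n::finite aff \<Rightarrow> 'n aff" is "\<lambda>i u j. u (sw (int CARD('n)) i j)"
  by (simp add: inj_comp_sw sw_add)

lift_definition sh :: "'n::finite aff \<Rightarrow> 'n aff" is "\<lambda>u j. u (j + 1)"
  by (simp add: inj_comp_succ periodic_comp_succ)

lift_definition up :: "int \<Rightarrow> 'n::finite aff \<Rightarrow> 'n aff" is "\<lambda>c u j. u j + c"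
  by (auto simp: inj_def)

lemma val_up [simp]: "val (up c u) j = val u j + c"
  by transfer simp

lemma val_sh [simp]: "val (sh u) j = val u (j + 1)"
  by transfer simp

lemma val_swp: "val (swp i (u :: 'n::finite aff)) j = val u (sw (int CARD('n)) i j)"
  by transfer simp

lemma val_swp_window:
  assumes "i \<le> a + int CARD('n) - 2" "a \<le> i" "a \<le> j" "j < a + int CARD('n)"
  shows "val (swp i (u :: 'n::finite aff)) j = (if j = i then val u (i + 1) else if j = i + 1 then val u i else val u j)"
  by (simp add: val_swp sw_window[OF assms])

lemma up_0 [simp]: "up 0 u = u"
  by transfer simp

lemma swp_up: "swp i (up c u) = up c (swp i u)"
  by transfer simp

lemma sh_up: "sh (up c u) = up c (sh u)"
  by transfer simp

lemma sh_swp: "sh (swp (i + 1) u) = swp i (sh u)"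
  by transfer (auto simp: sw_def fun_eq_iff algebra_simps)

lemma swp_add_period: "swp (i + int CARD('n)) u = swp i (u :: 'n::finite aff)"
proof -
  have "int CARD('n) dvd j - (k + int CARD('n)) \<longleftrightarrow> int CARD('n) dvd j - k" for j k
  proof -
    have "j - k = (j - (k + int CARD('n))) + int CARD('n)" by simp
    then show ?thesis by (metis dvd_add_triv_right_iff)
  qed
  from this[of _ i] this[of _ "i + 1"] show ?thesis
    by transfer (auto simp: sw_def fun_eq_iff algebra_simps)
qed

lemma swp_swp [simp]:
  assumes "2 \<le> CARD('n)"
  shows "swp i (swp i u) = (u :: 'n::finite aff)"
  by (rule aff_eqI[of i]) (use assms in \<open>simp add: val_swp_window[of i i]\<close>)

lemma swp_commute:
  assumes "i + 1 < j" "j + 1 < i + int CARD('n)"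
  shows "swp i (swp j u) = swp j (swp i (u :: 'n::finite aff))"
  by (rule aff_eqI[of i]) (use assms in \<open>auto simp: val_swp_window[of _ i]\<close>)

lemma swp_braid:
  assumes "3 \<le> CARD('n)"
  shows "swp i (swp (i + 1) (swp i u)) = swp (i + 1) (swp i (swp (i + 1) (u :: 'n::finite aff)))"
  by (rule aff_eqI[of i]) (use assms in \<open>auto simp: val_swp_window[of _ i]\<close>)

text \<open>
  With \<open>a = amp i u\<close> the reflection acts by \<open>- (a + (1 - a) swp i)\<close>: a Demazure--Lusztig
  operator, that is, Young's seminormal form, for the coupling constant \<open>n + 1\<close> and period \<open>n\<close>.
  The sign makes the stabilizers below act by the sign character, so that the generating vector
  can be invariant.
\<close>
definition amp :: "int \<Rightarrow> 'n::finite aff \<Rightarrow> complex" where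
  "amp i u = (of_nat CARD('n) + 1) / of_int (val u (i + 1) - val u i)"

definition hop :: "int \<Rightarrow> ('n::finite aff \<Rightarrow> complex) \<Rightarrow> 'n aff \<Rightarrow> complex" where
  "hop i \<phi> u = - (amp i u * \<phi> u + (1 - amp i u) * \<phi> (swp i u))"

definition turn :: "('n::finite aff \<Rightarrow> complex) \<Rightarrow> 'n aff \<Rightarrow> complex" where
  "turn \<phi> u = \<phi> (sh u)"

definition mean :: "'n::finite aff \<Rightarrow> complex" where
  "mean u = (\<Sum>k<CARD('n). of_int (val u (int k))) / of_nat CARD('n)"

definition diag :: "'n::finite \<Rightarrow> ('n aff \<Rightarrow> complex) \<Rightarrow> 'n aff \<Rightarrow> complex" where
  "diag i \<phi> u = (of_int (val u (int (pos i))) - mean u) * \<phi> u"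

lemma divide_of_int_diff_swap: "c / of_int (a - b) = - (c / (of_int (b - a) :: complex))"
  by (metis minus_diff_eq minus_divide_right of_int_minus)

lemma amp_swp:
  assumes "2 \<le> CARD('n)"
  shows "amp i (swp i (u :: 'n::finite aff)) = - amp i u"
  unfolding amp_def
  by (subst divide_of_int_diff_swap) (use assms in \<open>simp add: val_swp_window[of i i]\<close>)

lemma hop_hop:
  assumes "2 \<le> CARD('n)"
  shows "hop i (hop i \<phi>) = (\<phi> :: 'n::finite aff \<Rightarrow> complex)"
  using assms by (auto simp: hop_def amp_swp fun_eq_iff algebra_simps)

lemma hop_commute:
  assumes "i + 1 < j" "j + 1 < i + int CARD('n)"
  shows "hop i (hop j \<phi>) = hop j (hop i (\<phi> :: 'n::finite aff \<Rightarrow> complex))"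
proof
  fix u :: "'n aff"
  have "amp i (swp j u) = amp i u" "amp j (swp i u) = amp j u"
    using assms by (auto simp: amp_def val_swp_window[of _ i])
  then show "hop i (hop j \<phi>) u = hop j (hop i \<phi>) u"
    by (simp add: hop_def swp_commute[OF assms] algebra_simps)
qed

lemma mult_div_add_eq:
  assumes "x \<noteq> 0" "y \<noteq> 0" "x + y \<noteq> (0 :: complex)"
  shows "c / x * (c / y) = c / (x + y) * (c / x + c / y)"
proof -
  have "c / x + c / y = c * (x + y) / (x * y)"
    using assms by (simp add: add_frac_eq distrib_left mult.commute)
  then show ?thesis using assms by simp
qed

text \<open>
  Both sides involve the six rearrangements of three values. Their amplitudes are, up to sign,
  the three numbers \<open>p, q, r\<close>, related by \<open>p q = r (p + q)\<close>, and the braid relation is a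
  polynomial consequence of that.
\<close>
lemma hop_braid:
  assumes "3 \<le> CARD('n)"
  shows "hop i (hop (i + 1) (hop i \<phi>)) = hop (i + 1) (hop i (hop (i + 1) (\<phi> :: 'n::finite aff \<Rightarrow> complex)))"
proof
  fix u :: "'n aff"
  define p where "p = amp i u"
  define q where "q = amp (i + 1) u"
  define r where "r = (of_nat CARD('n) + 1) / (of_int (val u (i + 2) - val u i) :: complex)"
  have nz: "of_int (val u (i + 1) - val u i) \<noteq> (0 :: complex)" "of_int (val u (i + 2) - val u (i + 1)) \<noteq> (0 :: complex)"
    "of_int (val u (i + 2) - val u i) \<noteq> (0 :: complex)"
    by (simp_all only: of_int_eq_0_iff eq_iff_diff_eq_0[symmetric] val_inject)
  have pqr: "p * q = r * (p + q)"
  proof -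
    have "r = (of_nat CARD('n) + 1) / (of_int (val u (i + 1) - val u i) + of_int (val u (i + 2) - val u (i + 1)))"
      by (simp add: r_def)
    with nz show ?thesis
      unfolding p_def q_def amp_def
      using mult_div_add_eq[of "of_int (val u (i + 1) - val u i)" "of_int (val u (i + 2) - val u (i + 1))"
          "of_nat CARD('n) + 1 :: complex"] by (simp add: add.assoc)
  qed
  define s where "s j v = swp j v" for j and v :: "'n aff"
  have w: "val (s i v) i = val v (i + 1)" "val (s i v) (i + 1) = val v i" "val (s i v) (i + 2) = val v (i + 2)"
    "val (s (i + 1) v) i = val v i" "val (s (i + 1) v) (i + 1) = val v (i + 2)" "val (s (i + 1) v) (i + 2) = val v (i + 1)" for v
    using assms by (simp_all add: s_def val_swp_window[of _ i])
  have amps: "amp i u = p" "amp (i + 1) u = q" "amp i (s i u) = - p" "amp (i + 1) (s i u) = r"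
    "amp i (s (i + 1) u) = r" "amp (i + 1) (s (i + 1) u) = - q"
    "amp i (s (i + 1) (s i u)) = q" "amp (i + 1) (s (i + 1) (s i u)) = - r"
    "amp i (s i (s (i + 1) u)) = - r" "amp (i + 1) (s i (s (i + 1) u)) = p"
    by (simp_all add: amp_def w p_def q_def r_def add.assoc del: of_int_diff) (subst divide_of_int_diff_swap, rule refl)+
  have ss: "s j (s j v) = v" for j v using assms by (simp add: s_def)
  have braid: "s (i + 1) (s i (s (i + 1) u)) = s i (s (i + 1) (s i u))"
    using swp_braid[OF assms, of i u] by (simp add: s_def)
  show "hop i (hop (i + 1) (hop i \<phi>)) u = hop (i + 1) (hop i (hop (i + 1) \<phi>)) u"
    unfolding hop_def s_def[symmetric] ss braid amps
    using pqr by algebra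
qed

definition hop_perm :: "'n::finite perm \<Rightarrow> ('n aff \<Rightarrow> complex) \<Rightarrow> 'n aff \<Rightarrow> complex" where
  "hop_perm = coxeter_rep (\<lambda>k. hop (int k))"

lemma hop_coxeter:
  "Suc k < CARD('n) \<Longrightarrow> hop (int k) \<circ> hop (int k) = (id :: ('n::finite aff \<Rightarrow> complex) \<Rightarrow> _)"
  "Suc (Suc k) < CARD('n) \<Longrightarrow> hop (int k) \<circ> hop (int (Suc k)) \<circ> hop (int k)
     = (hop (int (Suc k)) \<circ> hop (int k) \<circ> hop (int (Suc k)) :: ('n aff \<Rightarrow> complex) \<Rightarrow> _)"
  "Suc k < l \<Longrightarrow> Suc l < CARD('n) \<Longrightarrow>
     hop (int k) \<circ> hop (int l) = (hop (int l) \<circ> hop (int k) :: ('n aff \<Rightarrow> complex) \<Rightarrow> _)"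
proof -
  show "hop (int k) \<circ> hop (int k) = (id :: ('n aff \<Rightarrow> complex) \<Rightarrow> _)" if "Suc k < CARD('n)"
    using that by (intro ext) (simp add: hop_hop)
  show "hop (int k) \<circ> hop (int (Suc k)) \<circ> hop (int k)
     = (hop (int (Suc k)) \<circ> hop (int k) \<circ> hop (int (Suc k)) :: ('n aff \<Rightarrow> complex) \<Rightarrow> _)"
    if "Suc (Suc k) < CARD('n)"
  proof
    fix \<phi> :: "'n aff \<Rightarrow> complex"
    have "3 \<le> CARD('n)" using that by simp
    from hop_braid[OF this, of "int k" \<phi>]
    show "(hop (int k) \<circ> hop (int (Suc k)) \<circ> hop (int k)) \<phi> = (hop (int (Suc k)) \<circ> hop (int k) \<circ> hop (int (Suc k))) \<phi>"
      by (simp add: add.commute)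
  qed
  show "hop (int k) \<circ> hop (int l) = (hop (int l) \<circ> hop (int k) :: ('n aff \<Rightarrow> complex) \<Rightarrow> _)"
    if "Suc k < l" "Suc l < CARD('n)"
  proof
    fix \<phi> :: "'n aff \<Rightarrow> complex"
    show "(hop (int k) \<circ> hop (int l)) \<phi> = (hop (int l) \<circ> hop (int k)) \<phi>"
      unfolding comp_apply by (rule hop_commute) (use that in auto)
  qed
qed

lemma hop_perm_one: "hop_perm 1 = id"
  unfolding hop_perm_def by (rule coxeter_rep_one[where t = "\<lambda>k. hop (int k)", OF hop_coxeter])

lemma hop_perm_mult: "hop_perm (\<sigma> * \<tau>) = hop_perm \<sigma> \<circ> hop_perm \<tau>"
  unfolding hop_perm_def by (rule coxeter_rep_mult[where t = "\<lambda>k. hop (int k)", OF hop_coxeter])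

lemma hop_perm_adj: "Suc k < CARD('n) \<Longrightarrow> hop_perm (adj k :: 'n::finite perm) = hop (int k)"
  unfolding hop_perm_def by (rule coxeter_rep_gen[where t = "\<lambda>k. hop (int k)", OF hop_coxeter])

lemma trans_hop: "turn (hop i \<phi>) = hop (i + 1) (turn \<phi>)"
  by (rule ext) (simp add: turn_def hop_def amp_def sh_swp)

lemma hop_add_period: "hop (i + int CARD('n)) = (hop i :: ('n::finite aff \<Rightarrow> complex) \<Rightarrow> _)"
proof -
  have "val u (i + int CARD('n) + 1) = val u (i + 1) + int CARD('n)" for u :: "'n aff"
    using val_add[of u "i + 1"] by (simp add: ac_simps)
  then show ?thesis by (intro ext) (simp add: hop_def amp_def swp_add_period val_add)
qed

lemma mean_swp:
  assumes "Suc k < CARD('n)"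
  shows "mean (swp (int k) (u :: 'n::finite aff)) = mean u"
proof -
  have "val (swp (int k) u) (int l) = val u (int (transpose k (Suc k) l))" if "l < CARD('n)" for l
    using assms that by (subst val_swp_window[of _ 0]) (auto simp: transpose_def)
  moreover have "transpose k (Suc k) permutes {..<CARD('n)}"
    using assms by (intro permutes_swap_id) auto
  then have "(\<Sum>l<CARD('n). of_int (val u (int l)) :: complex) = (\<Sum>l<CARD('n). of_int (val u (int (transpose k (Suc k) l))))"
    by (rule sum.permute[unfolded comp_def])
  ultimately show ?thesis by (simp add: mean_def)
qed

lemma mean_sh: "mean (sh (u :: 'n::finite aff)) = mean u + 1"
proof -
  have "(\<Sum>k<CARD('n). of_int (val u (int k + 1)) :: complex) - (\<Sum>k<CARD('n). of_int (val u (int k)))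
      = (\<Sum>k<CARD('n). of_int (val u (int (Suc k))) - of_int (val u (int k)))"
    by (simp add: sum_subtractf add.commute)
  also have "\<dots> = of_int (val u (int CARD('n))) - of_int (val u (int 0))"
    by (rule sum_lessThan_telescope)
  also have "\<dots> = of_nat CARD('n)" using val_add[of u 0] by simp
  finally show ?thesis by (simp add: mean_def field_simps)
qed

lemma mean_up: "mean (up c (u :: 'n::finite aff)) = mean u + of_int c"
  by (simp add: mean_def sum.distrib add_divide_distrib)

lemma hop_diag:
  assumes k: "Suc k < CARD('n)"
  shows "hop (int k) (diag (idx k) \<phi>) u =
    diag (idx (Suc k)) (hop (int k) \<phi>) u + (of_nat CARD('n) + 1) * \<phi> (u :: 'n::finite aff)"
proof -
  have "of_int (val u (int k + 1) - val u (int k)) \<noteq> (0 :: complex)"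
    by (simp only: of_int_eq_0_iff eq_iff_diff_eq_0[symmetric] val_inject; simp)
  then have amp: "amp (int k) u * (of_int (val u (int k + 1)) - of_int (val u (int k))) = of_nat CARD('n) + 1"
    by (simp add: amp_def)
  have "val (swp (int k) u) (int k) = val u (int k + 1)"
    using k by (simp add: val_swp_window[of _ 0])
  then have "hop (int k) (diag (idx k) \<phi>) u - diag (idx (Suc k)) (hop (int k) \<phi>) u
      = amp (int k) u * (of_int (val u (int k + 1)) - of_int (val u (int k))) * \<phi> u"
    using k by (simp add: hop_def diag_def mean_swp add.commute[of 1]) (simp add: algebra_simps)
  then show ?thesis unfolding amp by (simp add: algebra_simps)
qed

lemma hop_diag_other:
  assumes k: "Suc k < CARD('n)" and "i \<noteq> idx k" "i \<noteq> idx (Suc k)"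
  shows "hop (int k) (diag i \<phi>) = diag i (hop (int k) (\<phi> :: 'n::finite aff \<Rightarrow> complex))"
proof
  fix u :: "'n aff"
  have "pos i \<noteq> k" "pos i \<noteq> Suc k" using assms(2,3) idx_pos[of i] by metis+
  then have "val (swp (int k) u) (int (pos i)) = val u (int (pos i))"
    using k by (subst val_swp_window[of _ 0]) auto
  then show "hop (int k) (diag i \<phi>) u = diag i (hop (int k) \<phi>) u"
    using k by (simp add: hop_def diag_def mean_swp algebra_simps)
qed

lemma diag_trans:
  assumes "Suc k < CARD('n)"
  shows "diag (idx (Suc k)) (turn \<phi>) u = turn (diag (idx k) \<phi>) u + turn \<phi> (u :: 'n::finite aff)"
  using assms by (simp add: diag_def turn_def mean_sh algebra_simps)

lemma diag_trans_0:
  "diag (idx 0) (turn \<phi>) u = turn (diag (idx (CARD('n) - 1)) \<phi>) u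
     + (1 - of_nat CARD('n)) * turn \<phi> (u :: 'n::finite aff)"
proof -
  have "val u (int (CARD('n) - 1) + 1) = val u 0 + int CARD('n)"
    using val_add[of u 0] by (simp add: of_nat_diff)
  then show ?thesis by (simp add: diag_def turn_def mean_sh algebra_simps)
qed

text \<open>
  A value and its successor in steps of the coupling constant must occur in this order. A
  reflection leaves the dominant region only through a wall on which \<open>amp i u = 1\<close>, where it
  has no transition amplitude; hence the functions vanishing on the region are stable.
\<close>
definition dominant :: "'n::finite aff \<Rightarrow> bool" where
  "dominant u \<longleftrightarrow> (\<forall>i j. val u j = val u i + int CARD('n) + 1 \<longrightarrow> i < j)"

lemma dom_up [simp]: "dominant (up c u) = dominant u"
  by (simp add: dominant_def add.assoc)

lemma dom_sh: "dominant u \<Longrightarrow> dominant (sh u)"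
  by (fastforce simp: dominant_def)

text \<open>Positions move by at most one, so only adjacent exchanged positions can change order.\<close>
lemma sw_order_reversing:
  assumes "a < b" "sw N i b \<le> sw N i a"
  shows "N dvd a - i" "b = a + 1"
proof -
  have "sw N i a \<noteq> sw N i b" using assms(1) injD[OF sw_inj[of N i], of a b] by auto
  moreover have bd: "sw N i a \<le> a + 1" "b - 1 \<le> sw N i b" by (simp_all add: sw_def)
  ultimately have b: "b = a + 1" using assms by linarith
  have "N dvd a - i"
  proof (rule ccontr)
    assume n: "\<not> N dvd a - i"
    then have "sw N i a \<le> a" by (simp add: sw_def)
    moreover have "b - (i + 1) = a - i" using b by simp
    then have "b \<le> sw N i b" using n unfolding sw_def by (simp only: if_False) simp
    ultimately show False using assms b by linarith
  qed
  then show "N dvd a - i" "b = a + 1" using b by blast+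
qed

lemma dom_swp:
  assumes u: "dominant (u :: 'n::finite aff)" and "\<not> dominant (swp i u)"
  shows "val u (i + 1) = val u i + int CARD('n) + 1"
proof -
  let ?N = "int CARD('n)"
  from assms(2) obtain p q where pq: "val u (sw ?N i q) = val u (sw ?N i p) + ?N + 1" "q \<le> p"
    by (auto simp: dominant_def val_swp)
  have lt: "sw ?N i p < sw ?N i q" using u pq(1) by (auto simp: dominant_def)
  then have "q < p" using pq(2) by (cases "q = p") auto
  note r = sw_order_reversing[OF this less_imp_le[OF lt]]
  then have "sw ?N i q = q + 1" by (simp add: sw_def)
  moreover have "sw ?N i p = q"
  proof -
    have "\<not> sw ?N i p = q + 1" using lt \<open>sw ?N i q = q + 1\<close> by simp
    moreover have "p - (i + 1) = q - i" using r(2) by simp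
    ultimately show ?thesis using r lt \<open>sw ?N i q = q + 1\<close> unfolding sw_def by (auto split: if_splits)
  qed
  moreover obtain k where "q = i + ?N * k" using r(1) by (metis dvdE diff_eq_eq add.commute)
  ultimately have "val u (i + 1 + ?N * k) = val u (i + ?N * k) + ?N + 1"
    using pq(1) by (simp add: algebra_simps)
  then show ?thesis unfolding val_add_mult by simp
qed

lemma amp_wall: "val u (i + 1) = val u i + int CARD('n) + 1 \<Longrightarrow> amp i (u :: 'n::finite aff) = 1"
proof -
  have "of_nat CARD('n) + 1 \<noteq> (0 :: complex)"
    using of_nat_neq_0[of "CARD('n)", where 'a = complex] by (simp add: add.commute)
  then show "val u (i + 1) = val u i + int CARD('n) + 1 \<Longrightarrow> amp i u = 1"
    by (simp add: amp_def)
qed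

section \<open>Dominant affine permutations and parking functions\<close>

text \<open>
  Values matter up to a common shift only; they are normalised to have minimum 0 on the window of
  one period.
\<close>

definition low :: "'n::finite aff \<Rightarrow> int" where
  "low u = Min ((\<lambda>k. val u (int k)) ` {..<CARD('n)})"

definition nval :: "'n::finite aff \<Rightarrow> nat \<Rightarrow> int" where
  "nval u k = val u (int k) - low u"

lemma nval_nonneg: "k < CARD('n) \<Longrightarrow> 0 \<le> nval (u :: 'n::finite aff) k"
  unfolding nval_def low_def by (simp add: Min_le)

lemma nval_zero: "\<exists>k<CARD('n). nval (u :: 'n::finite aff) k = 0"
proof -
  have "low u \<in> (\<lambda>k. val u (int k)) ` {..<CARD('n)}"
    unfolding low_def by (rule Min_in) (auto simp: lessThan_empty_iff)
  then show ?thesis by (auto simp: nval_def)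
qed

lemma low_eqI:
  assumes "\<And>k. k < CARD('n) \<Longrightarrow> c \<le> val u (int k)" "k < CARD('n)" "val u (int k) = c"
  shows "low (u :: 'n::finite aff) = c"
  unfolding low_def using assms by (intro Min_eqI) auto

lemma nval_up [simp]: "nval (up c u) k = nval (u :: 'n::finite aff) k"
proof -
  obtain l where l: "l < CARD('n)" "nval u l = 0" using nval_zero by blast
  have "low (up c u) = low u + c"
    by (rule low_eqI[of _ _ l]) (use l nval_nonneg[of _ u] in \<open>auto simp: nval_def\<close>)
  then show ?thesis by (simp add: nval_def)
qed

text \<open>
  Residue and quotient of a normalised value encode a permutation and a parking function. For
  dominant \<open>u\<close> the former turns out to be the standardisation of the latter, so that the
  parking function alone determines \<open>u\<close> by the formula \<open>nval_eq\<close>.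
\<close>
definition rk :: "'n::finite aff \<Rightarrow> nat \<Rightarrow> int" where
  "rk u k = nval u k mod int CARD('n)"

definition park_coord :: "'n::finite aff \<Rightarrow> nat \<Rightarrow> int" where
  "park_coord u k = rk u k - nval u k div int CARD('n)"

lemma nval_eq: "nval (u :: 'n::finite aff) k = (int CARD('n) + 1) * rk u k - int CARD('n) * park_coord u k"
  using mult_div_mod_eq[of "int CARD('n)" "nval u k"] by (simp add: rk_def park_coord_def algebra_simps)

lemma rk_inj: "inj_on (rk (u :: 'n::finite aff)) {..<CARD('n)}"
proof (rule inj_onI)
  let ?N = "int CARD('n)"
  fix k l assume kl: "k \<in> {..<CARD('n)}" "l \<in> {..<CARD('n)}" and "rk u k = rk u l"
  then have "?N dvd nval u k - nval u l" by (simp add: rk_def mod_eq_dvd_iff)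
  then obtain c where "nval u k = nval u l + ?N * c" by (metis dvdE diff_eq_eq add.commute)
  then have "val u (int k) = val u (int l + ?N * c)" by (simp add: nval_def val_add_mult)
  then have "int k = int l + ?N * c" by simp
  then have "int k - int l = 0" using kl by (intro dvd_small[of ?N]) auto
  then show "k = l" by simp
qed

lemma rk_image: "rk (u :: 'n::finite aff) ` {..<CARD('n)} = {0..<int CARD('n)}"
proof (rule card_subset_eq)
  show "card (rk u ` {..<CARD('n)}) = card {0..<int CARD('n)}"
    by (simp add: card_image[OF rk_inj])
qed (auto simp: rk_def)

definition lex_less :: "(nat \<Rightarrow> int) \<Rightarrow> nat \<Rightarrow> nat \<Rightarrow> bool" where
  "lex_less f k l \<longleftrightarrow> f k < f l \<or> (f k = f l \<and> k < l)"

lemma lex_less_trans: "lex_less f k l \<Longrightarrow> lex_less f l j \<Longrightarrow> lex_less f k j"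
  by (auto simp: lex_less_def)

lemma lex_less_irrefl: "\<not> lex_less f k k"
  by (simp add: lex_less_def)

text \<open>
  Two positions with consecutive residues have values that differ by \<open>n + 1\<close> up to a multiple of
  \<open>n\<close>. Translating one of the positions removes the multiple, and dominance then compares them.
\<close>
lemma rk_step:
  assumes u: "dominant (u :: 'n::finite aff)" and k: "k < CARD('n)" and l: "l < CARD('n)"
    and r: "rk u l = rk u k + 1"
  shows "lex_less (park_coord u) k l"
proof -
  let ?N = "int CARD('n)"
  define d where "d = park_coord u k - park_coord u l"
  have "nval u l = nval u k + ?N + 1 + ?N * d"
    by (simp add: nval_eq r d_def algebra_simps)
  then have "val u (int l + ?N * (- d)) = val u (int k) + ?N + 1"
    by (simp only: val_add_mult) (simp add: nval_def)
  then have *: "int k < int l - ?N * d" using u by (auto simp: dominant_def)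
  have "d \<le> 0"
  proof (rule ccontr)
    assume "\<not> d \<le> 0"
    then have "?N * 1 \<le> ?N * d" by (intro mult_left_mono) auto
    moreover have "int l < ?N" using l by simp
    ultimately show False using * by linarith
  qed
  moreover have "k < l" if "d = 0" using * that by simp
  ultimately show ?thesis by (auto simp: lex_less_def d_def)
qed

lemma rk_less_lex_less:
  assumes u: "dominant (u :: 'n::finite aff)"
  shows "k < CARD('n) \<Longrightarrow> l < CARD('n) \<Longrightarrow> rk u k < rk u l \<Longrightarrow> lex_less (park_coord u) k l"
proof (induction "nat (rk u l - rk u k)" arbitrary: l rule: less_induct)
  case less
  have "0 \<le> rk u k" "rk u l < int CARD('n)" by (simp_all add: rk_def)
  then have "rk u l - 1 \<in> rk u ` {..<CARD('n)}"
    using less.prems(3) by (simp add: rk_image)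
  then obtain j where j: "j < CARD('n)" "rk u l = rk u j + 1" by auto
  then have jl: "lex_less (park_coord u) j l" using rk_step[OF u j(1) less.prems(2)] by simp
  show ?case
  proof (cases "rk u k = rk u j")
    case True
    then have "k = j" using inj_onD[OF rk_inj True] less.prems j by auto
    then show ?thesis using jl by simp
  next
    case False
    then have "lex_less (park_coord u) k j" using less.prems j by (intro less.hyps) auto
    then show ?thesis using jl by (rule lex_less_trans)
  qed
qed

lemma rk_less_iff:
  assumes u: "dominant (u :: 'n::finite aff)" and k: "k < CARD('n)" and l: "l < CARD('n)"
  shows "rk u k < rk u l \<longleftrightarrow> lex_less (park_coord u) k l"
proof
  assume "lex_less (park_coord u) k l"
  then have "\<not> lex_less (park_coord u) l k" "k \<noteq> l" using lex_less_trans lex_less_irrefl by blast+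
  then have "\<not> rk u l < rk u k" "rk u k \<noteq> rk u l"
    using rk_less_lex_less[OF u l k] inj_onD[OF rk_inj, of u k l] k l by auto
  then show "rk u k < rk u l" by simp
qed (rule rk_less_lex_less[OF u k l])

text \<open>The standardisation: ties are broken from left to right.\<close>
definition std :: "nat \<Rightarrow> (nat \<Rightarrow> int) \<Rightarrow> nat \<Rightarrow> int" where
  "std N f k = int (card {l. l < N \<and> lex_less f l k})"

lemma rk_std:
  assumes u: "dominant (u :: 'n::finite aff)" and k: "k < CARD('n)"
  shows "rk u k = std CARD('n) (park_coord u) k"
proof -
  have "{l. l < CARD('n) \<and> lex_less (park_coord u) l k} = {l. l < CARD('n) \<and> rk u l < rk u k}"
    using rk_less_iff[OF u _ k] by auto
  moreover have "rk u ` {l. l < CARD('n) \<and> rk u l < rk u k} = {0..<rk u k}"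
  proof
    show "rk u ` {l. l < CARD('n) \<and> rk u l < rk u k} \<subseteq> {0..<rk u k}"
      by (auto simp: rk_def)
    show "{0..<rk u k} \<subseteq> rk u ` {l. l < CARD('n) \<and> rk u l < rk u k}"
    proof
      fix r assume r: "r \<in> {0..<rk u k}"
      have "rk u k < int CARD('n)" by (simp add: rk_def)
      then have "r \<in> rk u ` {..<CARD('n)}" using r by (simp add: rk_image)
      then show "r \<in> rk u ` {l. l < CARD('n) \<and> rk u l < rk u k}" using r by auto
    qed
  qed
  moreover have "inj_on (rk u) {l. l < CARD('n) \<and> rk u l < rk u k}"
    by (rule inj_on_subset[OF rk_inj]) auto
  ultimately have "int (card {l. l < CARD('n) \<and> lex_less (park_coord u) l k}) = int (card {0..<rk u k})"
    by (metis card_image)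
  moreover have "0 \<le> rk u k" by (simp add: rk_def)
  ultimately show ?thesis by (simp add: std_def)
qed

lemma std_cong: "(\<And>l. l < N \<Longrightarrow> f l = g l) \<Longrightarrow> k < N \<Longrightarrow> std N f k = std N g k"
  unfolding std_def lex_less_def by (intro arg_cong[of _ _ int] arg_cong[of _ _ card]) auto

lemma park_coord_determines:
  assumes u: "dominant (u :: 'n::finite aff)" and v: "dominant v" and eq: "\<And>k. k < CARD('n) \<Longrightarrow> park_coord u k = park_coord v k"
  shows "v = up (low v - low u) u"
proof (rule aff_eqI[of 0])
  fix j :: int assume "0 \<le> j" "j < 0 + int CARD('n)"
  then obtain k where k: "j = int k" "k < CARD('n)" by (metis add_0 nonneg_int_cases of_nat_less_iff)
  have "rk u k = rk v k" using rk_std[OF u k(2)] rk_std[OF v k(2)] std_cong[OF eq k(2)] by simp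
  then have "nval u k = nval v k" using eq[OF k(2)] by (simp add: nval_eq)
  then show "val v j = val (up (low v - low u) u) j" by (simp add: nval_def k)
qed

text \<open>
  That the parking coordinate is at most the rank is the nonnegativity of the normalised values;
  it is equivalent to the defining inequalities of parking functions.
\<close>
lemma park_coord_bounds:
  assumes u: "dominant (u :: 'n::finite aff)" and k: "k < CARD('n)"
  shows "0 \<le> park_coord u k" "park_coord u k \<le> rk u k"
proof -
  show "park_coord u k \<le> rk u k" using nval_nonneg[OF k, of u] by (simp add: park_coord_def pos_imp_zdiv_nonneg_iff)
  obtain l where l: "l < CARD('n)" "nval u l = 0" using nval_zero by blast
  then have "rk u l = 0" "park_coord u l = 0" by (simp_all add: rk_def park_coord_def)
  moreover have "0 \<le> rk u k" by (simp add: rk_def)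
  ultimately show "0 \<le> park_coord u k"
    using rk_less_iff[OF u l(1) k] inj_onD[OF rk_inj, of u l k] k l by (cases "k = l") (auto simp: lex_less_def)
qed

text \<open>Parking functions as functions of positions, with values starting at 0.\<close>
lift_definition pfun :: "'n::finite pf \<Rightarrow> nat \<Rightarrow> int" is "\<lambda>f k. int (f (idx k)) - 1" .

lemma Rep_pf_pfun: "int (Rep_pf f i) = pfun f (pos i) + 1"
  by transfer simp

lemma pf_eqI:
  assumes "\<And>k. k < CARD('n) \<Longrightarrow> pfun f k = pfun g k"
  shows "f = (g :: 'n::finite pf)"
proof -
  have "Rep_pf f i = Rep_pf g i" for i
    using assms[of "pos i"] Rep_pf_pfun[of f i] Rep_pf_pfun[of g i] by simp
  then show ?thesis by (metis Rep_pf_inverse ext)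
qed

lemma card_vimage_pos: "card {i :: 'n::finite. P (pos i)} = card {k. k < CARD('n) \<and> P k}"
proof -
  have "pos ` {i :: 'n. P (pos i)} = {k. k < CARD('n) \<and> P k}"
  proof
    show "{k. k < CARD('n) \<and> P k} \<subseteq> pos ` {i :: 'n. P (pos i)}"
    proof
      fix k assume "k \<in> {k. k < CARD('n) \<and> P k}"
      then have "k = pos (idx k :: 'n)" "(idx k :: 'n) \<in> {i. P (pos i)}" by auto
      then show "k \<in> pos ` {i :: 'n. P (pos i)}" by (rule image_eqI)
    qed
  qed auto
  moreover have "inj_on pos {i :: 'n. P (pos i)}" by (auto simp: inj_on_def)
  ultimately show ?thesis using card_image by fastforce
qed

lemma parking_iff:
  "(\<lambda>i. nat (f (pos i)) + 1) \<in> (parking_functions :: ('n::finite \<Rightarrow> nat) set) \<longleftrightarrow>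
    (\<forall>k<CARD('n). f k < int CARD('n)) \<and>
    (\<forall>s\<in>{1..CARD('n)}. s \<le> card {k. k < CARD('n) \<and> f k < int s})" if "\<And>k. k < CARD('n) \<Longrightarrow> 0 \<le> f k"
proof -
  have "(\<lambda>i::'n. nat (f (pos i)) + 1) -` {1..s} = {i. f (pos i) < int s}" for s
    using that by (auto simp: nat_less_iff Suc_le_eq)
  then have "card ((\<lambda>i::'n. nat (f (pos i)) + 1) -` {1..s}) = card {k. k < CARD('n) \<and> f k < int s}" for s
    using card_vimage_pos[of "\<lambda>k. f k < int s"] by simp
  moreover have "range (\<lambda>i::'n. nat (f (pos i)) + 1) \<subseteq> {1..CARD('n)} \<longleftrightarrow> (\<forall>k<CARD('n). f k < int CARD('n))"
  proof
    assume r: "range (\<lambda>i::'n. nat (f (pos i)) + 1) \<subseteq> {1..CARD('n)}"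
    show "\<forall>k<CARD('n). f k < int CARD('n)"
    proof (intro allI impI)
      fix k assume k: "k < CARD('n)"
      have "nat (f (pos (idx k :: 'n))) + 1 \<in> {1..CARD('n)}" using r by blast
      then show "f k < int CARD('n)" using k by (simp add: Suc_le_eq nat_less_iff that)
    qed
  next
    assume "\<forall>k<CARD('n). f k < int CARD('n)"
    then show "range (\<lambda>i::'n. nat (f (pos i)) + 1) \<subseteq> {1..CARD('n)}"
      using that by (auto simp: Suc_le_eq nat_less_iff)
  qed
  ultimately show ?thesis by (simp add: parking_functions_def)
qed

lemma pfun_nonneg: "k < CARD('n) \<Longrightarrow> 0 \<le> pfun (f :: 'n::finite pf) k"
proof -
  have "range (Rep_pf f) \<subseteq> {1..CARD('n)}"
    using Rep_pf[of f] by (simp add: parking_functions_def)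
  then have "Rep_pf f (idx k) \<in> {1..CARD('n)}" by blast
  then show ?thesis by (simp add: pfun.rep_eq)
qed

lemma pfun_card:
  assumes "s \<le> CARD('n)"
  shows "s \<le> card {k. k < CARD('n) \<and> pfun (f :: 'n::finite pf) k < int s}"
proof -
  have "Rep_pf f = (\<lambda>i. nat (pfun f (pos i)) + 1)"
  proof
    fix i :: 'n
    show "Rep_pf f i = nat (pfun f (pos i)) + 1"
      using Rep_pf_pfun[of f i] pfun_nonneg[OF pos_less, of f i] by linarith
  qed
  then have "(\<lambda>i. nat (pfun f (pos i)) + 1) \<in> (parking_functions :: ('n \<Rightarrow> nat) set)"
    using Rep_pf[of f] by simp
  with parking_iff[where 'n = 'n and f = "pfun f"]
  have "\<forall>s\<in>{1..CARD('n)}. s \<le> card {k. k < CARD('n) \<and> pfun f k < int s}"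
    using pfun_nonneg by blast
  then show ?thesis using assms by (cases "s = 0") auto
qed

definition pf_of :: "'n::finite aff \<Rightarrow> 'n pf" where
  "pf_of u = Abs_pf (\<lambda>i. nat (park_coord u (pos i)) + 1)"

lemma pfun_pf_of:
  assumes u: "dominant (u :: 'n::finite aff)" and k: "k < CARD('n)"
  shows "pfun (pf_of u) k = park_coord u k"
proof -
  have "(\<lambda>i::'n. nat (park_coord u (pos i)) + 1) \<in> parking_functions"
  proof (subst parking_iff)
    show "(\<forall>k<CARD('n). park_coord u k < int CARD('n)) \<and> (\<forall>s\<in>{1..CARD('n)}. s \<le> card {k. k < CARD('n) \<and> park_coord u k < int s})"
    proof (intro conjI allI impI ballI)
      fix k assume "k < CARD('n)"
      from park_coord_bounds(2)[OF u this] show "park_coord u k < int CARD('n)"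
        by (rule le_less_trans) (simp add: rk_def)
    next
      fix s assume s: "s \<in> {1..CARD('n)}"
      have "s = card {0..<int s}" by simp
      also have "{0..<int s} = rk u ` {k. k < CARD('n) \<and> rk u k < int s}"
      proof
        show "{0..<int s} \<subseteq> rk u ` {k. k < CARD('n) \<and> rk u k < int s}"
        proof
          fix r assume r: "r \<in> {0..<int s}"
          then have "r \<in> rk u ` {..<CARD('n)}" using s by (simp add: rk_image)
          then show "r \<in> rk u ` {k. k < CARD('n) \<and> rk u k < int s}" using r by auto
        qed
      qed (auto simp: rk_def)
      also have "card \<dots> \<le> card {k. k < CARD('n) \<and> rk u k < int s}"
        by (rule card_image_le) simp
      also have "\<dots> \<le> card {k. k < CARD('n) \<and> park_coord u k < int s}"
        using park_coord_bounds(2)[OF u] by (intro card_mono) (auto intro: le_less_trans)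
      finally show "s \<le> card {k. k < CARD('n) \<and> park_coord u k < int s}" .
    qed
  qed (rule park_coord_bounds[OF u])
  then have "pfun (pf_of u) k = int (nat (park_coord u (pos (idx k :: 'n))) + 1) - 1"
    unfolding pf_of_def pfun.rep_eq by (simp add: Abs_pf_inverse)
  then show ?thesis using k park_coord_bounds(1)[OF u k] by simp
qed

lemma pf_of_up [simp]: "pf_of (up c u) = pf_of u"
  by (simp add: pf_of_def park_coord_def rk_def)

lemma pf_of_eq_iff:
  assumes "dominant u" "dominant v"
  shows "pf_of u = pf_of v \<longleftrightarrow> (\<exists>c. v = up c u)"
proof
  assume "pf_of u = pf_of v"
  then have "park_coord u k = park_coord v k" if "k < CARD('a)" for k
    using pfun_pf_of[OF assms(1) that] pfun_pf_of[OF assms(2) that] by simp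
  from park_coord_determines[OF assms this] show "\<exists>c. v = up c u" by blast
qed auto

lemma pfun_less: "k < CARD('n) \<Longrightarrow> pfun (f :: 'n::finite pf) k < int CARD('n)"
proof -
  have "range (Rep_pf f) \<subseteq> {1..CARD('n)}"
    using Rep_pf[of f] by (simp add: parking_functions_def)
  then have "Rep_pf f (idx k) \<in> {1..CARD('n)}" by blast
  then show ?thesis by (simp add: pfun.rep_eq)
qed

lemma std_less:
  assumes "lex_less f k l" "k < N"
  shows "std N f k < std N f l"
proof -
  have "{j. j < N \<and> lex_less f j k} \<subset> {j. j < N \<and> lex_less f j l}"
    using assms lex_less_trans[OF _ assms(1)] lex_less_irrefl[of f k] by blast
  then show ?thesis unfolding std_def by (simp add: psubset_card_mono)
qed

lemma lex_less_total: "k \<noteq> l \<Longrightarrow> lex_less f k l \<or> lex_less f l k"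
  by (auto simp: lex_less_def)

lemma std_less_iff:
  assumes "k < N" "l < N"
  shows "std N f k < std N f l \<longleftrightarrow> lex_less f k l"
  using std_less[OF _ assms(1), of f l] std_less[OF _ assms(2), of f k] lex_less_total[of k l f]
  by (cases "k = l") (auto simp: lex_less_irrefl)

lemma std_inj: "inj_on (std N f) {..<N}"
proof (rule inj_onI)
  fix k l assume "k \<in> {..<N}" "l \<in> {..<N}" "std N f k = std N f l"
  then show "k = l" using std_less_iff[of k N l f] std_less_iff[of l N k f] lex_less_total[of k l f] by auto
qed

lemma std_bounds:
  assumes "k < N"
  shows "0 \<le> std N f k" "std N f k < int N"
proof -
  have "{j. j < N \<and> lex_less f j k} \<subset> {..<N}" using assms lex_less_irrefl[of f k] by auto
  then have "card {j. j < N \<and> lex_less f j k} < card {..<N}" by (intro psubset_card_mono) auto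
  then show "0 \<le> std N f k" "std N f k < int N" by (simp_all add: std_def)
qed

lemma std_image: "std N f ` {..<N} = {0..<int N}"
proof (rule card_subset_eq)
  show "std N f ` {..<N} \<subseteq> {0..<int N}" using std_bounds[of _ N f] by auto
  show "card (std N f ` {..<N}) = card {0..<int N}" by (simp add: card_image[OF std_inj])
qed simp

text \<open>
  The inverse construction: the values \<open>(n + 1) r - n F\<close>, with \<open>r\<close> the standardisation of the
  parking function \<open>F\<close>, extended periodically. The values in a window are \<open>v\<close>.
\<close>
lemma dom_exists:
  fixes f :: "'n::finite pf"
  shows "\<exists>u. dominant u \<and> pf_of u = f"
proof -
  let ?N = "int CARD('n)"
  define F where "F = pfun f"
  define r where "r = std CARD('n) F"
  define v where "v k = r k + ?N * (r k - F k)" for k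
  define x where "x j = v (nat (j mod ?N)) + ?N * (j div ?N)" for j
  have res: "nat (j mod ?N) < CARD('n)" for j by (simp add: nat_less_iff)
  have r_bd: "0 \<le> r k" "r k < ?N" if "k < CARD('n)" for k
    using std_bounds[OF that, of F] by (simp_all add: r_def)
  have F_bd: "0 \<le> F k" "F k < ?N" if "k < CARD('n)" for k
    using that by (simp_all add: F_def pfun_nonneg pfun_less)
  have r_inj: "k = l" if "r k = r l" "k < CARD('n)" "l < CARD('n)" for k l
    using inj_onD[OF std_inj, of "CARD('n)" F k l] that by (simp add: r_def)
  have "inj x"
  proof (rule injI)
    fix i j assume eq: "x i = x j"
    let ?a = "nat (i mod ?N)" and ?b = "nat (j mod ?N)"
    have "r ?a - r ?b = ?N * ((r ?b - F ?b) + j div ?N - (r ?a - F ?a) - i div ?N)"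
      using eq by (simp add: x_def v_def algebra_simps)
    then have "?N dvd r ?a - r ?b" by (rule dvdI)
    moreover have "\<bar>r ?a - r ?b\<bar> < ?N"
      using r_bd[OF res, of i] r_bd[OF res, of j] by linarith
    ultimately have "r ?a - r ?b = 0" by (rule dvd_small)
    then have ab: "?a = ?b" by (intro r_inj res) simp
    then have "i mod ?N = j mod ?N" by (simp add: nat_eq_iff)
    moreover have "i div ?N = j div ?N" using eq ab by (simp add: x_def)
    ultimately show "i = j" by (metis mult_div_mod_eq)
  qed
  moreover have "x (i + ?N) = x i + ?N" for i
    by (simp add: x_def algebra_simps)
  ultimately have mem: "x \<in> {u. inj u \<and> (\<forall>i. u (i + ?N) = u i + ?N)}" by simp
  define u where "u = (Aff x :: 'n aff)"
  have u: "val u = x" unfolding u_def by (rule Aff_inverse[OF mem])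
  have "dominant u"
    unfolding dominant_def u
  proof (intro allI impI)
    fix i j assume eq: "x j = x i + ?N + 1"
    define a b p q where "a = nat (i mod ?N)" and "b = nat (j mod ?N)" and "p = i div ?N" and "q = j div ?N"
    have a: "a < CARD('n)" and b: "b < CARD('n)" by (simp_all add: a_def b_def res)
    have i: "i = int a + ?N * p" and j: "j = int b + ?N * q" by (simp_all add: a_def b_def p_def q_def)
    have eq': "r b - r a - 1 = ?N * (1 + (r a - F a) + p - (r b - F b) - q)"
      using eq by (simp add: x_def v_def flip: a_def b_def p_def q_def) (simp add: algebra_simps)
    define t where "t = 1 + (r a - F a) + p - (r b - F b) - q"
    have eqt: "?N * t = r b - r a - 1" unfolding t_def by (rule eq'[symmetric])
    have "?N * t < ?N * 1" unfolding eqt using r_bd[OF a] r_bd[OF b] by linarith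
    then have t1: "t < 1" by (simp only: mult_less_cancel_left; auto)
    have "?N * (- 2) < ?N * t" unfolding eqt using r_bd[OF a] r_bd[OF b] by linarith
    then have t2: "- 2 < t" by (simp only: mult_less_cancel_left; auto)
    have qp: "i < j" if "p < q"
    proof -
      have "?N * (p + 1) \<le> ?N * q" using that by (intro mult_left_mono) auto
      then show ?thesis using a by (simp add: i j algebra_simps)
    qed
    consider "t = 0" | "t = - 1" using t1 t2 by linarith
    then show "i < j"
    proof cases
      case 1
      then have rb: "r b = r a + 1" using eqt by simp
      then have "lex_less F a b" using std_less_iff[OF a b, of F] by (simp add: r_def)
      moreover have "q - p = F b - F a" using 1 rb by (simp add: t_def)
      ultimately show ?thesis using qp by (auto simp: lex_less_def i j)
    next
      case 2
      then have "r b = r a + 1 - ?N" using eqt by simp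
      moreover have "q = 2 + (r a - F a) + p - (r b - F b)" using 2 by (simp add: t_def)
      ultimately have "q - p = ?N + 1 + F b - F a" by simp
      then have "p < q" using F_bd[OF a] F_bd[OF b] by linarith
      then show ?thesis by (rule qp)
    qed
  qed
  have uk: "val u (int k) = v k" if "k < CARD('n)" for k
    using that by (simp add: u x_def)
  have Fr: "F k \<le> r k" if k: "k < CARD('n)" for k
  proof -
    have "nat (F k) \<le> CARD('n)" using F_bd[OF k] by (simp add: nat_le_iff)
    from pfun_card[OF this, of f] have "nat (F k) \<le> card {l. l < CARD('n) \<and> F l < F k}"
      using F_bd[OF k] by (simp add: F_def)
    also have "\<dots> \<le> card {l. l < CARD('n) \<and> lex_less F l k}"
      by (rule card_mono) (auto simp: lex_less_def)
    finally show ?thesis by (simp add: r_def std_def nat_le_iff)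
  qed
  have "low u = 0"
  proof -
    have "0 \<in> std CARD('n) F ` {..<CARD('n)}" by (simp add: std_image)
    then obtain k where k: "k < CARD('n)" "r k = 0" by (auto simp: r_def)
    then have "F k = 0" using Fr[OF k(1)] F_bd[OF k(1)] by simp
    then have "v k = 0" using k by (simp add: v_def)
    show ?thesis
    proof (rule low_eqI[of _ _ k])
      fix l assume l: "l < CARD('n)"
      have "0 \<le> ?N * (r l - F l)" using Fr[OF l] by simp
      then show "0 \<le> val u (int l)" using r_bd[OF l] by (simp add: uk[OF l] v_def)
    qed (use k \<open>v k = 0\<close> in \<open>simp_all add: uk\<close>)
  qed
  then have nv: "nval u k = r k + ?N * (r k - F k)" if "k < CARD('n)" for k
    by (simp add: nval_def uk[OF that] v_def)
  have "park_coord u k = F k" if k: "k < CARD('n)" for k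
    using r_bd[OF k] by (simp add: park_coord_def rk_def nv[OF k] mod_pos_pos_trivial div_pos_pos_trivial)
  then have "pf_of u = f"
    by (intro pf_eqI) (simp add: pfun_pf_of[OF \<open>dominant u\<close>] F_def)
  with \<open>dominant u\<close> show ?thesis by blast
qed

definition aff_of :: "'n::finite pf \<Rightarrow> 'n aff" where
  "aff_of f = (SOME u. dominant u \<and> pf_of u = f)"

lemma aff_of: "dominant (aff_of f)" "pf_of (aff_of f) = f"
  using someI_ex[OF dom_exists[of f]] by (simp_all add: aff_of_def)

lemma aff_of_pf_of: "dominant u \<Longrightarrow> \<exists>c. u = up c (aff_of (pf_of u))"
  using pf_of_eq_iff[OF aff_of(1)] aff_of(2) by metis

lemma val_swp_nat:
  assumes "Suc k < CARD('n)" "l < CARD('n)"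
  shows "val (swp (int k) (u :: 'n::finite aff)) (int l) = val u (int (transpose k (Suc k) l))"
  using assms by (subst val_swp_window[of _ 0]) (auto simp: transpose_def add.commute)

lemma low_swp:
  assumes k: "Suc k < CARD('n)"
  shows "low (swp (int k) u) = low (u :: 'n::finite aff)"
proof -
  have t: "transpose k (Suc k) l < CARD('n)" if "l < CARD('n)" for l
    using k that by (simp add: transpose_def)
  obtain l where l: "l < CARD('n)" "nval u l = 0" using nval_zero by blast
  show ?thesis
    by (rule low_eqI[of _ _ "transpose k (Suc k) l"])
      (use l t nval_nonneg[of _ u] in \<open>simp_all add: val_swp_nat[OF k] nval_def\<close>)
qed

lemma pfun_pf_of_swp:
  assumes k: "Suc k < CARD('n)" and l: "l < CARD('n)" and u: "dominant (u :: 'n::finite aff)" "dominant (swp (int k) u)"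
  shows "pfun (pf_of (swp (int k) u)) l = pfun (pf_of u) (transpose k (Suc k) l)"
proof -
  have t: "transpose k (Suc k) l < CARD('n)" using k l by (simp add: transpose_def)
  have "nval (swp (int k) u) l = nval u (transpose k (Suc k) l)"
    by (simp add: nval_def low_swp[OF k] val_swp_nat[OF k l])
  then show ?thesis by (simp add: pfun_pf_of u l t park_coord_def rk_def)
qed

text \<open>
  The walls between neighbouring positions are exactly the coincidences of the parking function:
  if the values of the parking function agree but there is no wall, the exchange stays dominant
  with the same parking function, which is impossible.
\<close>
lemma wall_iff:
  assumes k: "Suc k < CARD('n)" and u: "dominant (u :: 'n::finite aff)"
  shows "val u (int k + 1) = val u (int k) + int CARD('n) + 1 \<longleftrightarrow> park_coord u k = park_coord u (Suc k)"
proof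
  let ?N = "int CARD('n)"
  have k': "k < CARD('n)" using k by simp
  assume "val u (int k + 1) = val u (int k) + ?N + 1"
  then have "nval u (Suc k) = nval u k + ?N + 1" by (simp add: nval_def add.commute)
  then have eq: "?N * (park_coord u (Suc k) - park_coord u k) = (?N + 1) * (rk u (Suc k) - rk u k - 1)"
    by (simp add: nval_eq algebra_simps)
  have bd: "0 \<le> rk u j" "rk u j < ?N" for j by (simp_all add: rk_def)
  have fb: "0 \<le> park_coord u j" "park_coord u j < ?N" if "j < CARD('n)" for j
    using park_coord_bounds[OF u that] bd[of j] by linarith+
  define d where "d = park_coord u (Suc k) - park_coord u k"
  have "?N * d = ?N * (rk u (Suc k) - rk u k - 1) + (rk u (Suc k) - rk u k - 1)"
    using eq by (simp add: d_def algebra_simps)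
  then have e: "rk u (Suc k) - rk u k - 1 = ?N * (d - (rk u (Suc k) - rk u k - 1))"
    by (simp add: algebra_simps)
  define t where "t = d - (rk u (Suc k) - rk u k - 1)"
  have "?N * t < ?N * 1" using e bd[of k] bd[of "Suc k"] by (simp add: t_def)
  then have t1: "t < 1" by (simp only: mult_less_cancel_left; auto)
  have "?N * (- 2) < ?N * t" using e bd[of k] bd[of "Suc k"] by (simp add: t_def)
  then have t2: "- 2 < t" by (simp only: mult_less_cancel_left; auto)
  consider "t = 0" | "t = - 1" using t1 t2 by linarith
  then show "park_coord u k = park_coord u (Suc k)"
  proof cases
    case 1
    then show ?thesis using e by (simp add: t_def d_def)
  next
    case 2
    have "rk u (Suc k) - rk u k - 1 = ?N * t" using e by (simp only: t_def)
    then have "rk u (Suc k) - rk u k - 1 = - ?N" by (simp add: 2)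
    then have "d = - ?N - 1" using 2 unfolding t_def by linarith
    then show ?thesis using fb[OF k] fb[OF k'] by (simp add: d_def)
  qed
next
  let ?N = "int CARD('n)"
  have k': "k < CARD('n)" using k by simp
  assume f: "park_coord u k = park_coord u (Suc k)"
  show "val u (int k + 1) = val u (int k) + ?N + 1"
  proof (rule ccontr)
    assume "val u (int k + 1) \<noteq> val u (int k) + ?N + 1"
    with dom_swp[OF u] have s: "dominant (swp (int k) u)" by blast
    have "pf_of (swp (int k) u) = pf_of u"
    proof (rule pf_eqI)
      fix l assume l: "l < CARD('n)"
      show "pfun (pf_of (swp (int k) u)) l = pfun (pf_of u) l"
        using k k' l f by (simp add: pfun_pf_of_swp[OF k l u s] pfun_pf_of[OF u] transpose_def)
    qed
    then obtain c where c: "u = up c (swp (int k) u)" using pf_of_eq_iff[OF s u] by blast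
    obtain l where l: "l < CARD('n)" "nval (swp (int k) u) l = 0" using nval_zero by blast
    have "low u = low (swp (int k) u) + c"
      by (subst c, rule low_eqI[of _ _ l])
        (use l nval_nonneg[of _ "swp (int k) u"] in \<open>auto simp: nval_def\<close>)
    then have "c = 0" by (simp add: low_swp[OF k])
    with c have "val u (int k) = val (swp (int k) u) (int k)" by simp
    then show False using k by (simp add: val_swp_nat)
  qed
qed

section \<open>The module on parking functions\<close>

definition scaleF :: "complex \<Rightarrow> ('a \<Rightarrow> complex) \<Rightarrow> 'a \<Rightarrow> complex" where
  "scaleF c \<phi> = (\<lambda>f. c * \<phi> f)"

lemma scaleF_apply [simp]: "scaleF c \<phi> f = c * \<phi> f"
  by (simp add: scaleF_def)

lemma vector_space_scaleF: "vector_space scaleF"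
  by unfold_locales (auto simp: fun_eq_iff algebra_simps)

text \<open>
  Functions on parking functions are identified with the shift-invariant functions on affine
  permutations modulo those that vanish on the dominant region. Relations between operators that
  respect both conditions are therefore inherited.
\<close>
definition extend :: "('n::finite pf \<Rightarrow> complex) \<Rightarrow> 'n aff \<Rightarrow> complex" where
  "extend \<phi> u = (if dominant u then \<phi> (pf_of u) else 0)"

definition descend :: "(('n::finite aff \<Rightarrow> complex) \<Rightarrow> 'n aff \<Rightarrow> complex) \<Rightarrow> ('n pf \<Rightarrow> complex) \<Rightarrow> 'n pf \<Rightarrow> complex" where
  "descend G \<phi> f = G (extend \<phi>) (aff_of f)"

definition shinv :: "('n::finite aff \<Rightarrow> complex) \<Rightarrow> bool" where
  "shinv \<phi> \<longleftrightarrow> (\<forall>c u. \<phi> (up c u) = \<phi> u)"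

definition descends :: "(('n::finite aff \<Rightarrow> complex) \<Rightarrow> 'n aff \<Rightarrow> complex) \<Rightarrow> bool" where
  "descends G \<longleftrightarrow> (\<forall>\<phi> \<psi>. (\<forall>u. dominant u \<longrightarrow> \<phi> u = \<psi> u) \<longrightarrow> (\<forall>u. dominant u \<longrightarrow> G \<phi> u = G \<psi> u)) \<and>
     (\<forall>\<phi>. shinv \<phi> \<longrightarrow> shinv (G \<phi>)) \<and>
     (\<forall>\<phi> \<psi>. G (\<phi> + \<psi>) = G \<phi> + G \<psi>) \<and> (\<forall>c \<phi>. G (scaleF c \<phi>) = scaleF c (G \<phi>))"

lemma shinv_extend: "shinv (extend \<phi>)"
  by (simp add: shinv_def extend_def)

lemma extend_descend:
  assumes "descends G" "dominant u"
  shows "extend (descend G \<phi>) u = G (extend \<phi>) u"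
proof -
  obtain c where c: "u = up c (aff_of (pf_of u))" using aff_of_pf_of[OF assms(2)] ..
  have "shinv (G (extend \<phi>))" using assms(1) shinv_extend unfolding descends_def by blast
  then have "G (extend \<phi>) (aff_of (pf_of u)) = G (extend \<phi>) (up c (aff_of (pf_of u)))" by (simp add: shinv_def)
  then show ?thesis using assms(2) c by (simp add: extend_def descend_def)
qed

lemma descends_cong: "descends G \<Longrightarrow> (\<And>u. dominant u \<Longrightarrow> \<phi> u = \<psi> u) \<Longrightarrow> dominant u \<Longrightarrow> G \<phi> u = G \<psi> u"
  unfolding descends_def by blast

lemma descend_down:
  assumes "descends G" "descends H"
  shows "descend G (descend H \<phi>) = descend (G \<circ> H) \<phi>"
proof
  fix f
  have "G (extend (descend H \<phi>)) (aff_of f) = G (H (extend \<phi>)) (aff_of f)"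
    by (rule descends_cong[OF assms(1)]) (simp_all add: extend_descend assms aff_of)
  then show "descend G (descend H \<phi>) f = descend (G \<circ> H) \<phi> f" by (simp add: descend_def)
qed

lemma descends_comp: "descends G \<Longrightarrow> descends H \<Longrightarrow> descends (G \<circ> H)"
  unfolding descends_def by simp

lemma descends_id: "descends id"
  by (simp add: descends_def)

lemma descend_id: "descend id = id"
  by (rule ext, rule ext) (simp add: descend_def extend_def aff_of)

lemma extend_add: "extend (\<phi> + \<psi>) = extend \<phi> + extend \<psi>"
  by (simp add: fun_eq_iff extend_def)

lemma extend_scale: "extend (scaleF c \<phi>) = scaleF c (extend \<phi>)"
  by (simp add: fun_eq_iff extend_def)

lemma descend_linear: "descends G \<Longrightarrow> Vector_Spaces.linear scaleF scaleF (descend G)"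
  by (rule linear_scaleI) (simp_all add: vector_space_scaleF fun_eq_iff descend_def extend_add extend_scale descends_def)

lemma amp_up: "amp i (up c u) = amp i u"
  by (simp add: amp_def)

lemma descends_hop: "descends (hop i :: ('n::finite aff \<Rightarrow> complex) \<Rightarrow> _)"
proof -
  have "hop i \<phi> u = hop i \<psi> u" if eq: "\<And>u. dominant u \<Longrightarrow> \<phi> u = \<psi> u" and u: "dominant u"
    for \<phi> \<psi> :: "'n aff \<Rightarrow> complex" and u
  proof (cases "dominant (swp i u)")
    case True
    then show ?thesis using eq u by (simp add: hop_def)
  next
    case False
    then have "amp i u = 1" using dom_swp[OF u] amp_wall by blast
    then show ?thesis using eq u by (simp add: hop_def)
  qed
  then show ?thesis
    by (auto simp: descends_def shinv_def hop_def amp_up swp_up fun_eq_iff algebra_simps)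
qed

lemma descends_turn: "descends turn"
  by (auto simp: descends_def shinv_def turn_def sh_up fun_eq_iff dom_sh)

lemma descends_diag: "descends (diag i)"
  by (auto simp: descends_def shinv_def diag_def mean_up fun_eq_iff algebra_simps)

lemma hop_perm_descent:
  assumes "descent \<sigma> k"
  shows "hop_perm \<sigma> = hop_perm (\<sigma> * adj k) \<circ> hop (int k)"
proof -
  have k: "Suc k < CARD('a)" using assms by (simp add: descent_def)
  have "hop_perm (\<sigma> * adj k * adj k) = hop_perm (\<sigma> * adj k) \<circ> hop (int k)"
    unfolding hop_perm_mult[of "\<sigma> * adj k"] hop_perm_adj[OF k] ..
  then show ?thesis by simp
qed

lemma descends_hop_perm: "descends (hop_perm \<sigma>)"
proof (induction \<sigma> rule: perm_descent_induct)
  case one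
  show ?case unfolding hop_perm_one by (rule descends_id)
next
  case (descent \<sigma> k)
  show ?case unfolding hop_perm_descent[OF descent(1)] by (rule descends_comp[OF descent(2) descends_hop])
qed

definition pf_act :: "'n::finite perm \<Rightarrow> ('n pf \<Rightarrow> complex) \<Rightarrow> 'n pf \<Rightarrow> complex" where
  "pf_act \<sigma> = descend (hop_perm \<sigma>)"

definition pf_trans :: "('n::finite pf \<Rightarrow> complex) \<Rightarrow> 'n pf \<Rightarrow> complex" where
  "pf_trans = descend turn"

definition pf_diag :: "'n::finite \<Rightarrow> ('n pf \<Rightarrow> complex) \<Rightarrow> 'n pf \<Rightarrow> complex" where
  "pf_diag i = descend (diag i)"

lemma sym_rep_pf_act: "sym_rep scaleF (pf_act :: 'n::finite perm \<Rightarrow> _)"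
proof -
  interpret vector_space scaleF by (rule vector_space_scaleF)
  show ?thesis
  proof
    fix \<sigma> \<tau> :: "'n perm" and v w c
    interpret L: Vector_Spaces.linear scaleF scaleF "pf_act \<sigma>"
      unfolding pf_act_def by (rule descend_linear[OF descends_hop_perm])
    show "pf_act \<sigma> (v + w) = pf_act \<sigma> v + pf_act \<sigma> w" by (rule L.add)
    show "pf_act \<sigma> (scaleF c v) = scaleF c (pf_act \<sigma> v)" by (rule L.scale)
    show "pf_act 1 v = v" by (simp add: pf_act_def hop_perm_one descend_id)
    show "pf_act (\<sigma> * \<tau>) v = pf_act \<sigma> (pf_act \<tau> v)"
      by (simp add: pf_act_def descend_down descends_hop_perm hop_perm_mult)
  qed
qed

lemma trig_module_pf:
  "trig_module scaleF (pf_act :: 'n::finite perm \<Rightarrow> _) pf_trans pf_diag (of_nat CARD('n) + 1)"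
proof (rule trig_module.intro[OF sym_rep_pf_act trig_module_axioms.intro])
  fix v :: "'n pf \<Rightarrow> complex" and i j :: 'n and k
  show "Vector_Spaces.linear scaleF scaleF (pf_trans :: ('n pf \<Rightarrow> complex) \<Rightarrow> _)"
    unfolding pf_trans_def by (rule descend_linear[OF descends_turn])
  show "Vector_Spaces.linear scaleF scaleF (pf_diag i)"
    unfolding pf_diag_def by (rule descend_linear[OF descends_diag])
  note defs = pf_act_def pf_trans_def pf_diag_def descend_down descends_hop descends_hop_perm descends_turn descends_diag descends_comp
  show "pf_act (adj (Suc k)) (pf_trans v) = pf_trans (pf_act (adj k) v)" if "Suc (Suc k) < CARD('n)"
  proof -
    have "hop (int (Suc k)) \<circ> turn = turn \<circ> (hop (int k) :: ('n aff \<Rightarrow> complex) \<Rightarrow> _)"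
      by (rule ext) (simp add: trans_hop add.commute)
    then show ?thesis using that by (simp add: defs hop_perm_adj)
  qed
  show "pf_act (adj 0) (pf_trans (pf_trans v)) = pf_trans (pf_trans (pf_act (adj (CARD('n) - 2)) v))"
    if "2 \<le> CARD('n)"
  proof -
    have "hop (int (CARD('n) - 2)) = (hop (- 2) :: ('n aff \<Rightarrow> complex) \<Rightarrow> _)"
      using hop_add_period[of "- 2", where 'n = 'n] that by (simp add: of_nat_diff)
    then have "hop 0 \<circ> (turn \<circ> turn) = turn \<circ> (turn \<circ> (hop (int (CARD('n) - 2)) :: ('n aff \<Rightarrow> complex) \<Rightarrow> _))"
      by (intro ext) (simp add: trans_hop)
    then show ?thesis using that by (simp add: defs hop_perm_adj)
  qed
  show "pf_diag i (pf_diag j v) = pf_diag j (pf_diag i v)"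
  proof -
    have "diag i \<circ> diag j = diag j \<circ> (diag i :: ('n aff \<Rightarrow> complex) \<Rightarrow> _)"
      by (intro ext) (simp add: diag_def)
    then show ?thesis by (simp add: defs)
  qed
  show "pf_act (adj k) (pf_diag (idx k) v) = pf_diag (idx (Suc k)) (pf_act (adj k) v) + scaleF (of_nat CARD('n) + 1) v"
    if "Suc k < CARD('n)"
    using that by (simp add: defs hop_perm_adj) (simp add: fun_eq_iff descend_def hop_diag extend_def aff_of)
  show "pf_act (adj k) (pf_diag i v) = pf_diag i (pf_act (adj k) v)"
    if "Suc k < CARD('n)" "i \<noteq> idx k" "i \<noteq> idx (Suc k)"
    using that by (simp add: defs hop_perm_adj) (simp add: fun_eq_iff descend_def hop_diag_other)
  show "pf_diag (idx (Suc k)) (pf_trans v) = pf_trans (pf_diag (idx k) v) + pf_trans v" if "Suc k < CARD('n)"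
    using that by (simp add: defs) (simp add: fun_eq_iff descend_def diag_trans)
  show "pf_diag (idx 0) (pf_trans v) = pf_trans (pf_diag (idx (CARD('n) - Suc 0)) v)
      + scaleF (1 - of_nat CARD('n)) (pf_trans v)"
    by (simp add: defs) (simp add: fun_eq_iff descend_def diag_trans_0[simplified])
qed

lemma pfun_perm_pf: "pfun (perm_pf \<sigma> f) k = pfun f (pos (Perm.apply (inverse \<sigma>) (idx k)))"
  by transfer simp

lemma pfun_perm_adj:
  assumes "Suc k < CARD('n)" "l < CARD('n)"
  shows "pfun (perm_pf (adj k) (f :: 'n::finite pf)) l = pfun f (transpose k (Suc k) l)"
proof -
  have "pos (Perm.apply (adj k) (idx l :: 'n)) = transpose k (Suc k) l"
    using assms by (cases "l = k \<or> l = Suc k") (auto simp: apply_adj, simp add: adj_def idx_inject)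
  then show ?thesis by (simp add: pfun_perm_pf adj_def)
qed

lemma perm_adj_same:
  assumes "Suc k < CARD('n)" "pfun f k = pfun f (Suc k)"
  shows "perm_pf (adj k) f = (f :: 'n::finite pf)"
  by (rule pf_eqI) (use assms in \<open>simp add: pfun_perm_adj transpose_def\<close>)

text \<open>
  In terms of parking functions, an adjacent transposition acts by \<open>-1\<close> if it fixes the parking
  function, and otherwise mixes the two parking functions it exchanges with nonzero coefficients.
\<close>
lemma pf_act_adj_same:
  assumes "Suc k < CARD('n)" "pfun (f :: 'n::finite pf) k = pfun f (Suc k)"
  shows "pf_act (adj k) \<phi> f = - \<phi> f"
proof -
  let ?u = "aff_of f"
  have "park_coord ?u k = park_coord ?u (Suc k)"
    using assms pfun_pf_of[OF aff_of(1), of k f] pfun_pf_of[OF aff_of(1), of "Suc k" f] by (simp add: aff_of(2))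
  then have "amp (int k) ?u = 1" using wall_iff[OF assms(1) aff_of(1)] amp_wall by blast
  then show ?thesis
    using assms(1) by (simp add: pf_act_def hop_perm_adj descend_def hop_def extend_def aff_of)
qed

lemma pf_act_adj:
  assumes k: "Suc k < CARD('n)" and ne: "pfun (f :: 'n::finite pf) k \<noteq> pfun f (Suc k)"
  shows "\<exists>a. a \<noteq> 1 \<and> a \<noteq> - 1 \<and>
    (\<forall>\<phi>. pf_act (adj k) \<phi> f = - (a * \<phi> f + (1 - a) * \<phi> (perm_pf (adj k) f)))"
proof -
  let ?u = "aff_of f"
  let ?d = "val ?u (int k + 1) - val ?u (int k)"
  have "park_coord ?u k \<noteq> park_coord ?u (Suc k)"
    using k ne pfun_pf_of[OF aff_of(1), of k f] pfun_pf_of[OF aff_of(1), of "Suc k" f] by (simp add: aff_of(2))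
  then have "val ?u (int k + 1) \<noteq> val ?u (int k) + int CARD('n) + 1"
    using wall_iff[OF k aff_of(1)] by blast
  then have wall: "?d \<noteq> int CARD('n) + 1" by linarith
  have wall': "- ?d \<noteq> int CARD('n) + 1"
  proof
    assume "- ?d = int CARD('n) + 1"
    then have "val ?u (int k) = val ?u (int k + 1) + int CARD('n) + 1" by simp
    then have "int k + 1 < int k" using aff_of(1)[of f] unfolding dominant_def by blast
    then show False by simp
  qed
  have d0: "of_int ?d \<noteq> (0 :: complex)"
    by (simp only: of_int_eq_0_iff eq_iff_diff_eq_0[symmetric] val_inject; simp)
  have cast: "of_nat CARD('n) + 1 = (of_int (int CARD('n) + 1) :: complex)" by simp
  have 1: "amp (int k) ?u \<noteq> 1"
  proof
    assume "amp (int k) ?u = 1"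
    then have "of_int (int CARD('n) + 1) = 1 * (of_int ?d :: complex)"
      unfolding amp_def cast by (simp only: nonzero_divide_eq_eq[OF d0])
    then show False using wall by (simp only: mult_1_left of_int_eq_iff)
  qed
  have 2: "amp (int k) ?u \<noteq> - 1"
  proof
    assume "amp (int k) ?u = - 1"
    then have "of_int (int CARD('n) + 1) = - 1 * (of_int ?d :: complex)"
      unfolding amp_def cast by (simp only: nonzero_divide_eq_eq[OF d0])
    then have "of_int (int CARD('n) + 1) = (of_int (- ?d) :: complex)" by (simp only: of_int_minus mult_minus1)
    then show False using wall' by (simp only: of_int_eq_iff)
  qed
  have s: "dominant (swp (int k) ?u)"
  proof (rule ccontr)
    assume "\<not> dominant (swp (int k) ?u)"
    from dom_swp[OF aff_of(1) this] wall show False by simp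
  qed
  have "pf_of (swp (int k) ?u) = perm_pf (adj k) f"
    by (rule pf_eqI) (simp add: pfun_pf_of_swp[OF k _ aff_of(1) s] pfun_perm_adj[OF k] aff_of(2))
  then have "pf_act (adj k) \<phi> f = - (amp (int k) ?u * \<phi> f + (1 - amp (int k) ?u) * \<phi> (perm_pf (adj k) f))" for \<phi>
    using k s by (simp add: pf_act_def hop_perm_adj descend_def hop_def extend_def aff_of)
  with 1 2 show ?thesis by blast
qed

lemma pf_perm_closed:
  assumes "\<And>f k. Suc k < CARD('n) \<Longrightarrow> Q f \<Longrightarrow> Q (perm_pf (adj k) f)" "Q (f :: 'n::finite pf)"
  shows "Q (perm_pf \<sigma> f)"
  using assms(2)
proof (induction \<sigma> arbitrary: f rule: perm_descent_induct)
  case one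
  then show ?case by (simp add: perm_pf_one)
next
  case (descent \<sigma> k)
  have "Suc k < CARD('n)" using descent(1) by (simp add: descent_def)
  then have "Q (perm_pf (adj k) f)" using assms(1) descent.prems by blast
  then have "Q (perm_pf (\<sigma> * adj k) (perm_pf (adj k) f))" by (rule descent.IH)
  then show ?case by (simp flip: perm_pf_mult)
qed

section \<open>Irreducibility and the invariant vector\<close>

definition delta :: "'a \<Rightarrow> 'a \<Rightarrow> complex" where
  "delta f g = (if g = f then 1 else 0)"

lemma finite_pf: "finite (UNIV :: 'n::finite pf set)"
proof (rule finite_imageD)
  show "inj (Rep_pf :: 'n pf \<Rightarrow> _)" by (simp add: inj_def Rep_pf_inject)
  have "range (Rep_pf :: 'n pf \<Rightarrow> _) \<subseteq> (UNIV :: 'n set) \<rightarrow>\<^sub>E {1..CARD('n)}"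
    using Rep_pf by (fastforce simp: parking_functions_def PiE_def)
  then show "finite (range (Rep_pf :: 'n pf \<Rightarrow> _))"
    by (rule finite_subset) (simp add: finite_PiE)
qed

instance pf :: (finite) finite
  by standard (rule finite_pf)

lemma sum_delta_expand: "\<phi> = (\<Sum>f\<in>UNIV. scaleF (\<phi> f) (delta (f :: 'a::finite)))"
proof
  fix g
  have "(\<Sum>f\<in>UNIV. scaleF (\<phi> f) (delta f)) g = (\<Sum>f\<in>UNIV. \<phi> f * delta f g)"
    by (induction rule: infinite_finite_induct) simp_all
  also have "\<dots> = \<phi> g" by (simp add: delta_def if_distrib[of "\<lambda>c. _ * c"] cong: if_cong)
  finally show "\<phi> g = (\<Sum>f\<in>UNIV. scaleF (\<phi> f) (delta f)) g" by simp
qed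

lemma span_delta: "module.span scaleF (range delta) = (UNIV :: ('a::finite \<Rightarrow> complex) set)"
proof -
  interpret vector_space scaleF by (rule vector_space_scaleF)
  have "\<phi> \<in> span (range delta)" for \<phi> :: "'a \<Rightarrow> complex"
    by (subst sum_delta_expand) (intro span_sum span_scale span_base rangeI)
  then show ?thesis by blast
qed

text \<open>
  Exchanging adjacent positions changes a single factor, from \<open>d - m\<close> to \<open>- d - m\<close>, where \<open>m\<close>
  is the coupling constant; this is exactly what invariance requires. The product vanishes at
  dominant elements whose parking function has a repeated value.
\<close>
definition discriminant :: "'n::finite aff \<Rightarrow> complex" where
  "discriminant u = (\<Prod>(i, j)\<in>{(i, j). i < j \<and> j < CARD('n)}. of_int (val u (int j) - val u (int i) - int CARD('n) - 1))"

lemma finite_pairs: "finite {(i, j). i < j \<and> j < (N :: nat)}"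
  by (rule finite_subset[of _ "{..<N} \<times> {..<N}"]) auto

lemma hop_discriminant:
  assumes k: "Suc k < CARD('n)"
  shows "hop (int k) discriminant = (discriminant :: 'n::finite aff \<Rightarrow> complex)"
proof
  fix u :: "'n aff"
  let ?Pr = "{(i, j). i < j \<and> j < CARD('n)}"
  let ?\<tau> = "transpose k (Suc k)"
  define h where "h = (\<lambda>(i, j). of_int (val u (int j) - val u (int i) - int CARD('n) - 1) :: complex)"
  define h' where "h' = (\<lambda>(i, j). of_int (val (swp (int k) u) (int j) - val (swp (int k) u) (int i) - int CARD('n) - 1) :: complex)"
  define K where "K = prod h (?Pr - {(k, Suc k)})"
  have mem: "(k, Suc k) \<in> ?Pr" using k by simp
  have "discriminant u = prod h ?Pr" by (simp add: discriminant_def h_def)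
  also have "\<dots> = h (k, Suc k) * K"
    unfolding K_def by (rule prod.remove[OF finite_pairs mem])
  finally have v: "discriminant u = h (k, Suc k) * K" .
  have "discriminant (swp (int k) u) = prod h' ?Pr" by (simp add: discriminant_def h'_def)
  also have "\<dots> = h' (k, Suc k) * prod h' (?Pr - {(k, Suc k)})"
    by (rule prod.remove[OF finite_pairs mem])
  also have "prod h' (?Pr - {(k, Suc k)}) = K"
    unfolding K_def
  proof (rule prod.reindex_bij_witness[of _ "\<lambda>(i, j). (?\<tau> i, ?\<tau> j)" "\<lambda>(i, j). (?\<tau> i, ?\<tau> j)"])
    fix x assume x: "x \<in> ?Pr - {(k, Suc k)}"
    obtain i j where ij: "x = (i, j)" by (cases x)
    with x have i: "i < j" "j < CARD('n)" "\<not> (i = k \<and> j = Suc k)" by auto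
    then show "(case x of (i, j) \<Rightarrow> (?\<tau> i, ?\<tau> j)) \<in> ?Pr - {(k, Suc k)}"
      using k by (auto simp: ij transpose_def)
    show "(case (case x of (i, j) \<Rightarrow> (?\<tau> i, ?\<tau> j)) of (i, j) \<Rightarrow> (?\<tau> i, ?\<tau> j)) = x"
      by (simp add: ij)
    show "h (case x of (i, j) \<Rightarrow> (?\<tau> i, ?\<tau> j)) = h' x"
      using i by (simp add: ij h_def h'_def val_swp_nat[OF k])
  next
    fix x assume x: "x \<in> ?Pr - {(k, Suc k)}"
    obtain i j where ij: "x = (i, j)" by (cases x)
    with x have i: "i < j" "j < CARD('n)" "\<not> (i = k \<and> j = Suc k)" by auto
    then show "(case x of (i, j) \<Rightarrow> (?\<tau> i, ?\<tau> j)) \<in> ?Pr - {(k, Suc k)}"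
      using k by (auto simp: ij transpose_def)
    show "(case (case x of (i, j) \<Rightarrow> (?\<tau> i, ?\<tau> j)) of (i, j) \<Rightarrow> (?\<tau> i, ?\<tau> j)) = x"
      by (simp add: ij)
  qed
  finally have v': "discriminant (swp (int k) u) = h' (k, Suc k) * K" .
  define d where "d = (of_int (val u (int k + 1) - val u (int k)) :: complex)"
  define m where "m = (of_nat CARD('n) + 1 :: complex)"
  have d0: "d \<noteq> 0"
    unfolding d_def by (simp only: of_int_eq_0_iff eq_iff_diff_eq_0[symmetric] val_inject; simp)
  have "h (k, Suc k) = d - m" by (simp add: h_def d_def m_def add.commute)
  moreover have "h' (k, Suc k) = - d - m"
  proof -
    have "val (swp (int k) u) (1 + int k) = val u (int k)" "val (swp (int k) u) (int k) = val u (1 + int k)"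
      using val_swp_nat[OF k k, of u] val_swp_nat[OF k Suc_lessD[OF k], of u] by simp_all
    then show ?thesis by (simp add: h'_def d_def m_def add.commute)
  qed
  moreover have "amp (int k) u = m / d" by (simp add: amp_def d_def m_def)
  ultimately have "hop (int k) discriminant u = - (m / d * ((d - m) * K) + (1 - m / d) * ((- d - m) * K))"
    by (simp add: hop_def v v')
  also have "\<dots> = (d - m) * K" using d0 by (simp add: field_simps)
  finally show "hop (int k) discriminant u = discriminant u" using v \<open>h (k, Suc k) = d - m\<close> by simp
qed

lemma hop_perm_discriminant: "hop_perm \<sigma> discriminant = (discriminant :: 'n::finite aff \<Rightarrow> complex)"
proof (induction \<sigma> rule: perm_descent_induct)
  case one
  show ?case by (simp add: hop_perm_one)
next
  case (descent \<sigma> k)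
  then have "Suc k < CARD('n)" by (simp add: descent_def)
  then show ?case using descent by (simp add: hop_perm_descent[OF descent(1)] hop_discriminant)
qed

definition pf_discriminant :: "'n::finite pf \<Rightarrow> complex" where
  "pf_discriminant f = discriminant (aff_of f)"

lemma shinv_discriminant: "shinv discriminant"
  by (simp add: shinv_def discriminant_def)

lemma extend_pf_discriminant: "dominant u \<Longrightarrow> extend pf_discriminant u = discriminant u"
proof -
  assume u: "dominant u"
  obtain c where c: "u = up c (aff_of (pf_of u))" using aff_of_pf_of[OF u] ..
  have "discriminant u = discriminant (up c (aff_of (pf_of u)))" using c by simp
  also have "\<dots> = discriminant (aff_of (pf_of u))" using shinv_discriminant unfolding shinv_def by blast
  finally show "extend pf_discriminant u = discriminant u" using u by (simp add: extend_def pf_discriminant_def)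
qed

lemma pf_act_discriminant: "pf_act \<sigma> pf_discriminant = pf_discriminant"
proof
  fix f
  have "hop_perm \<sigma> (extend pf_discriminant) (aff_of f) = hop_perm \<sigma> discriminant (aff_of f)"
    by (rule descends_cong[OF descends_hop_perm]) (simp_all add: extend_pf_discriminant aff_of)
  then show "pf_act \<sigma> pf_discriminant f = pf_discriminant f" by (simp add: pf_act_def descend_def hop_perm_discriminant pf_discriminant_def)
qed

lemma pf_discriminant_nonzero:
  assumes inj: "inj_on (pfun f) {..<CARD('n)}"
  shows "pf_discriminant (f :: 'n::finite pf) \<noteq> 0"
proof -
  let ?u = "aff_of f" and ?N = "int CARD('n)"
  have "val ?u (int j) - val ?u (int i) - ?N - 1 \<noteq> 0" if ij: "i < j" "j < CARD('n)" for i j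
  proof
    assume eq: "val ?u (int j) - val ?u (int i) - ?N - 1 = 0"
    have f: "park_coord ?u k = pfun f k" if "k < CARD('n)" for k
      using pfun_pf_of[OF aff_of(1) that, of f] by (simp add: aff_of(2))
    have "nval ?u j = nval ?u i + ?N + 1" using eq by (simp add: nval_def)
    then have "pfun f j - pfun f i = (?N + 1) * (1 + rk ?u i - rk ?u j + (pfun f j - pfun f i))"
      using ij by (simp add: nval_eq f algebra_simps)
    then have "?N + 1 dvd pfun f j - pfun f i" by (rule dvdI)
    moreover have "\<bar>pfun f j - pfun f i\<bar> < ?N + 1"
      using pfun_nonneg[of i f] pfun_nonneg[of j f] pfun_less[of i f] pfun_less[of j f] ij by auto
    ultimately have "pfun f j - pfun f i = 0" by (rule dvd_small)
    then have "i = j" using inj_onD[OF inj, of i j] ij by simp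
    with ij show False by simp
  qed
  then show ?thesis unfolding pf_discriminant_def discriminant_def
    by (subst prod_zero_iff[OF finite_pairs]) (auto simp only: of_int_eq_0_iff split: prod.splits)
qed

lemma sorted_pf_exists: "\<exists>f :: 'n::finite pf. \<forall>k<CARD('n). pfun f k = int k"
proof -
  have "(\<lambda>i::'n. nat (int (pos i)) + 1) \<in> parking_functions"
  proof (subst parking_iff[of int])
    show "(\<forall>k<CARD('n). int k < int CARD('n)) \<and> (\<forall>s\<in>{1..CARD('n)}. s \<le> card {k. k < CARD('n) \<and> int k < int s})"
    proof (intro conjI allI impI ballI)
      fix s assume "s \<in> {1..CARD('n)}"
      then have "{k. k < CARD('n) \<and> int k < int s} = {..<s}" by auto
      then show "s \<le> card {k. k < CARD('n) \<and> int k < int s}" by simp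
    qed simp
  qed simp
  then have "\<forall>k<CARD('n). pfun (Abs_pf (\<lambda>i::'n. nat (int (pos i)) + 1)) k = int k"
    by (simp add: pfun.rep_eq Abs_pf_inverse)
  then show ?thesis by blast
qed

definition base_pf :: "'n::finite pf" where
  "base_pf = (SOME f. \<forall>k<CARD('n). pfun f k = int k)"

lemma base_pf: "k < CARD('n) \<Longrightarrow> pfun (base_pf :: 'n::finite pf) k = int k"
  using someI_ex[OF sorted_pf_exists] unfolding base_pf_def by blast

lemma base_pf_discriminant: "pf_discriminant (base_pf :: 'n::finite pf) \<noteq> 0"
  by (rule pf_discriminant_nonzero) (auto simp: inj_on_def base_pf)

lemma perm_of_inj:
  assumes "inj (\<pi> :: 'n::finite \<Rightarrow> 'n)"
  shows "\<exists>\<sigma>. Perm.apply \<sigma> = \<pi>"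
proof -
  have "bij \<pi>" by (simp add: bij_def assms finite_UNIV_inj_surj[OF _ assms])
  then have "\<pi> \<in> {f. bij f \<and> finite {a. f a \<noteq> a}}" by simp
  from Perm_inverse[OF this] show ?thesis by blast
qed

text \<open>
  An invariant function vanishes at every parking function with a repeated value, because such a
  value can be moved to two neighbouring positions where a transposition acts by \<open>-1\<close>.
  The injective parking functions form a single orbit, along which vanishing propagates.
\<close>
lemma pf_invariant_zero:
  assumes inv: "\<And>\<sigma>. pf_act \<sigma> \<phi> = \<phi>" and zero: "\<phi> base_pf = 0"
  shows "\<phi> (f :: 'n::finite pf) = 0"
proof -
  have closed: "\<phi> (perm_pf \<sigma> g) = 0" if "\<phi> g = 0" for \<sigma> and g :: "'n pf"
  proof (rule pf_perm_closed[where Q = "\<lambda>g. \<phi> g = 0", OF _ that])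
    fix g :: "'n pf" and k
    assume k: "Suc k < CARD('n)" and g: "\<phi> g = 0"
    show "\<phi> (perm_pf (adj k) g) = 0"
    proof (cases "pfun g k = pfun g (Suc k)")
      case True
      then show ?thesis using g by (simp add: perm_adj_same[OF k])
    next
      case False
      obtain a where "a \<noteq> 1" "pf_act (adj k) \<phi> g = - (a * \<phi> g + (1 - a) * \<phi> (perm_pf (adj k) g))"
        using pf_act_adj[OF k False] by blast
      then show ?thesis using inv[of "adj k"] g by simp
    qed
  qed
  show ?thesis
  proof (cases "inj_on (pfun f) {..<CARD('n)}")
    case True
    define \<pi> where "\<pi> i = (idx (nat (pfun f (pos i))) :: 'n)" for i :: 'n
    have bd: "nat (pfun f (pos i)) < CARD('n)" for i :: 'n
      using pfun_nonneg[OF pos_less, of f i] pfun_less[OF pos_less, of f i] by (simp add: nat_less_iff)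
    have "inj \<pi>"
    proof (rule injI)
      fix i j assume "\<pi> i = \<pi> j"
      then have "nat (pfun f (pos i)) = nat (pfun f (pos j))" by (simp add: \<pi>_def idx_inject bd)
      then have "pfun f (pos i) = pfun f (pos j)"
        using pfun_nonneg[OF pos_less, of f i] pfun_nonneg[OF pos_less, of f j] by simp
      with inj_onD[OF True, of "pos i" "pos j"] have "pos i = pos j" by simp
      then show "i = j" by simp
    qed
    then obtain \<sigma> where \<sigma>: "Perm.apply \<sigma> = \<pi>" using perm_of_inj by blast
    have "perm_pf (inverse \<sigma>) base_pf = f"
    proof (rule pf_eqI)
      fix k assume k: "k < CARD('n)"
      then show "pfun (perm_pf (inverse \<sigma>) base_pf) k = pfun f k"
        using bd[of "idx k"] pfun_nonneg[OF k, of f]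
        by (simp add: pfun_perm_pf \<sigma> \<pi>_def base_pf perm.inverse_inverse)
    qed
    then show ?thesis using closed[OF zero] by metis
  next
    case False
    then obtain k l where kl: "k < CARD('n)" "l < CARD('n)" "k \<noteq> l" "pfun f k = pfun f l"
      by (auto simp: inj_on_def)
    then have N: "Suc 0 < CARD('n)" by linarith
    have "(idx 0 :: 'n) \<noteq> idx (Suc 0)" "(idx k :: 'n) \<noteq> idx l" using kl N by (simp_all add: idx_inject)
    from perm_pair_exists[OF this] obtain \<rho> where \<rho>: "Perm.apply \<rho> (idx 0) = (idx k :: 'n)" "Perm.apply \<rho> (idx (Suc 0)) = idx l" .
    let ?g = "perm_pf (inverse \<rho>) f"
    have "pfun ?g 0 = pfun ?g (Suc 0)" using kl by (simp add: pfun_perm_pf perm.inverse_inverse \<rho>)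
    from pf_act_adj_same[OF N this, of \<phi>] have "\<phi> ?g = 0" by (simp add: inv)
    from closed[OF this, of \<rho>] show ?thesis by simp
  qed
qed

lemma pf_invariants:
  assumes inv: "\<And>\<sigma>. pf_act \<sigma> \<phi> = (\<phi> :: 'n::finite pf \<Rightarrow> complex)"
  shows "\<phi> \<in> module.span scaleF {pf_discriminant}"
proof -
  interpret sym_rep scaleF "pf_act :: 'n perm \<Rightarrow> _" by (rule sym_rep_pf_act)
  define c where "c = \<phi> base_pf / pf_discriminant (base_pf :: 'n pf)"
  define \<psi> where "\<psi> = \<phi> - scaleF c pf_discriminant"
  have "pf_act \<sigma> \<psi> = \<psi>" for \<sigma>
  proof -
    interpret L: Vector_Spaces.linear scaleF scaleF "pf_act \<sigma>" by (rule act_linear)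
    show ?thesis by (simp add: \<psi>_def L.diff L.scale inv pf_act_discriminant)
  qed
  moreover have "\<psi> base_pf = 0" using base_pf_discriminant[where 'n = 'n] by (simp add: \<psi>_def c_def)
  ultimately have "\<psi> f = 0" for f by (rule pf_invariant_zero)
  then have "\<phi> = scaleF c pf_discriminant" by (auto simp: \<psi>_def fun_eq_iff)
  then show ?thesis by (auto simp: span_singleton)
qed

text \<open>Lagrange interpolation with diagonal operators that separate points.\<close>
lemma delta_in_subspace:
  fixes S :: "('a::finite \<Rightarrow> complex) set"
  assumes S: "module.subspace scaleF S" and \<phi>: "\<phi> \<in> S" "\<phi> f \<noteq> 0"
    and D: "\<And>i \<psi>. \<psi> \<in> S \<Longrightarrow> (\<lambda>g. c i g * \<psi> g) \<in> S"
    and sep: "\<And>g. g \<noteq> f \<Longrightarrow> \<exists>i. c i g \<noteq> c i f"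
  shows "delta f \<in> S"
proof -
  interpret vector_space scaleF by (rule vector_space_scaleF)
  have "\<exists>\<psi>\<in>S. \<psi> f \<noteq> 0 \<and> (\<forall>g\<in>A. \<psi> g = 0)" if "finite A" "f \<notin> A" for A
    using that
  proof induction
    case empty
    show ?case using \<phi> by auto
  next
    case (insert g A)
    then obtain \<psi> where \<psi>: "\<psi> \<in> S" "\<psi> f \<noteq> 0" "\<And>h. h \<in> A \<Longrightarrow> \<psi> h = 0" by auto
    obtain i where i: "c i g \<noteq> c i f" using sep[of g] insert.prems by auto
    let ?\<chi> = "(\<lambda>h. c i h * \<psi> h) - scaleF (c i g) \<psi>"
    have "?\<chi> \<in> S" by (intro subspace_diff[OF S] subspace_scale[OF S] D \<psi>(1))
    moreover have "?\<chi> f \<noteq> 0" using \<psi>(2) i by (simp add: left_diff_distrib[symmetric])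
    moreover have "\<forall>h\<in>insert g A. ?\<chi> h = 0" using \<psi>(3) by simp
    ultimately show ?case by blast
  qed
  from this[of "UNIV - {f}"] obtain \<psi> where \<psi>: "\<psi> \<in> S" "\<psi> f \<noteq> 0" "\<And>g. g \<noteq> f \<Longrightarrow> \<psi> g = 0" by auto
  then have "delta f = scaleF (1 / \<psi> f) \<psi>" by (auto simp: fun_eq_iff delta_def)
  then show ?thesis using subspace_scale[OF S \<psi>(1)] by simp
qed

definition spec :: "'n::finite \<Rightarrow> 'n pf \<Rightarrow> complex" where
  "spec i f = of_int (val (aff_of f) (int (pos i))) - mean (aff_of f)"

lemma pf_diag_eq: "pf_diag i \<phi> = (\<lambda>f. spec i f * \<phi> f)"
  by (rule ext) (simp add: pf_diag_def descend_def diag_def spec_def extend_def aff_of)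

lemma spec_separates:
  assumes "f \<noteq> (g :: 'n::finite pf)"
  shows "\<exists>i. spec i f \<noteq> spec i g"
proof (rule ccontr)
  assume "\<not> (\<exists>i. spec i f \<noteq> spec i g)"
  then have eq: "spec i f = spec i g" for i by blast
  let ?u = "aff_of f" and ?v = "aff_of g"
  define c where "c = val ?v 0 - val ?u 0"
  have "?v = up c ?u"
  proof (rule aff_eqI[of 0])
    fix j :: int assume "0 \<le> j" "j < 0 + int CARD('n)"
    then obtain k where k: "j = int k" "k < CARD('n)" by (metis add_0 nonneg_int_cases of_nat_less_iff)
    have "of_int (val ?v (int k)) - of_int (val ?u (int k)) = mean ?v - mean ?u"
      using eq[of "idx k"] k by (simp add: spec_def algebra_simps)
    moreover have "of_int (val ?v 0) - of_int (val ?u 0) = mean ?v - mean ?u"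
      using eq[of "idx 0"] by (simp add: spec_def algebra_simps)
    ultimately have "(of_int (val ?v (int k) - val ?u (int k)) :: complex) = of_int c"
      by (simp add: c_def)
    then show "val ?v j = val (up c ?u) j" by (simp only: of_int_eq_iff) (simp add: k)
  qed
  then have "pf_of ?v = pf_of ?u" by simp
  then show False using assms by (simp add: aff_of)
qed

definition turn_pf :: "'n::finite pf \<Rightarrow> 'n pf" where
  "turn_pf f = pf_of (sh (aff_of f))"

lemma pf_trans_delta: "pf_trans (delta f) g = delta f (turn_pf g)"
  by (simp add: pf_trans_def descend_def turn_def extend_def dom_sh aff_of turn_pf_def)

lemma inj_turn_pf: "inj (turn_pf :: 'n::finite pf \<Rightarrow> _)"
proof (rule injI)
  fix f g :: "'n pf"
  assume "turn_pf f = turn_pf g"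
  then obtain c where c: "sh (aff_of g) = up c (sh (aff_of f))"
    using pf_of_eq_iff[of "sh (aff_of f)" "sh (aff_of g)"] by (auto simp: turn_pf_def dom_sh aff_of)
  have "val (aff_of g) j = val (up c (aff_of f)) j" for j
    using arg_cong[OF c, of "\<lambda>u. val u (j - 1)"] by simp
  then have "aff_of g = up c (aff_of f)" by (intro aff_eqI) blast
  then have "pf_of (aff_of g) = pf_of (aff_of f)" by simp
  then show "f = g" by (simp add: aff_of)
qed

lemma pf_size_turn:
  assumes f0: "pfun (f :: 'n::finite pf) 0 \<noteq> 0"
  shows "(\<Sum>k<CARD('n). pfun (turn_pf f) k) < (\<Sum>k<CARD('n). pfun f k)"
proof -
  let ?u = "aff_of f" and ?N = "int CARD('n)"
  let ?v = "sh ?u"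
  have N: "0 < CARD('n)" by simp
  have f: "park_coord ?u k = pfun f k" if "k < CARD('n)" for k
    using pfun_pf_of[OF aff_of(1) that, of f] by (simp add: aff_of(2))
  obtain l where l: "l < CARD('n)" "nval ?u l = 0" using nval_zero by blast
  have "l \<noteq> 0"
  proof
    assume "l = 0"
    then have "park_coord ?u 0 = 0" using l by (simp add: park_coord_def rk_def)
    then show False using f[OF N] f0 by simp
  qed
  then obtain l' where l': "l = Suc l'" by (cases l) auto
  have v: "val ?v (int k) = val ?u (int (Suc k))" for k by (simp add: add.commute)
  have last: "val ?u (int (Suc (CARD('n) - 1))) = val ?u (int 0) + ?N"
    using val_add[of ?u 0] N by simp
  have low: "low ?v = low ?u"
  proof (rule low_eqI[of _ _ l'])
    show "l' < CARD('n)" using l l' by simp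
    show "val ?v (int l') = low ?u" using l(2) unfolding v nval_def l' by simp
    fix k assume k: "k < CARD('n)"
    show "low ?u \<le> val ?v (int k)"
    proof (cases "Suc k < CARD('n)")
      case True
      then show ?thesis using nval_nonneg[OF True, of ?u] unfolding v nval_def by simp
    next
      case False
      then have "k = CARD('n) - 1" using k by simp
      then show ?thesis using nval_nonneg[OF N, of ?u] last unfolding v nval_def by simp
    qed
  qed
  have nv: "nval ?v k = nval ?u (Suc k)" for k
    unfolding nval_def v low ..
  have g: "pfun (turn_pf f) k = park_coord ?v k" if "k < CARD('n)" for k
    unfolding turn_pf_def by (rule pfun_pf_of[OF dom_sh[OF aff_of(1)] that])
  have gk: "park_coord ?v k = park_coord ?u (Suc k)" for k by (simp add: park_coord_def rk_def nv)
  have "nval ?u (Suc (CARD('n) - 1)) = nval ?u 0 + ?N" unfolding nval_def last by simp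
  then have gl: "park_coord ?u (Suc (CARD('n) - 1)) = park_coord ?u 0 - 1" by (simp add: park_coord_def rk_def)
  have "(\<Sum>k<CARD('n). pfun (turn_pf f) k) = (\<Sum>k<Suc (CARD('n) - 1). park_coord ?u (Suc k))"
    using N by (intro sum.cong) (auto simp: g gk)
  also have "\<dots> = (\<Sum>k<CARD('n) - 1. park_coord ?u (Suc k)) + (park_coord ?u 0 - 1)"
    unfolding sum.lessThan_Suc gl ..
  also have "\<dots> < (\<Sum>k<Suc (CARD('n) - 1). park_coord ?u k)"
    unfolding sum.lessThan_Suc_shift by simp
  also have "\<dots> = (\<Sum>k<CARD('n). pfun f k)"
    using N by (intro sum.cong) (auto simp: f)
  finally show ?thesis .
qed

lemma pf_size_perm: "(\<Sum>k<CARD('n). pfun (perm_pf \<sigma> f) k) = (\<Sum>k<CARD('n). pfun (f :: 'n::finite pf) k)"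
proof -
  have p: "(\<Sum>k<CARD('n). pfun g k) = (\<Sum>i\<in>(UNIV :: 'n set). pfun g (pos i))" for g :: "'n pf"
    using sum.reindex_bij_betw[OF bij_pos[where 'n = 'n], of "pfun g"] by simp
  have "(\<Sum>i\<in>UNIV. pfun f (pos (Perm.apply (inverse \<sigma>) i))) = (\<Sum>i\<in>(UNIV :: 'n set). pfun f (pos i))"
    by (rule sum.reindex_bij_betw) simp
  then show ?thesis unfolding p by (simp add: pfun_perm_pf)
qed

text \<open>
  Turning decreases the first value by one, if it is nonzero, and rotates the positions; so turns and
  transpositions lead from every parking function down to the zero function. The step backwards
  along turns is free because turning is a bijection of a finite set.
\<close>
lemma pf_reachable:
  assumes Q0: "\<exists>f. Q (f :: 'n::finite pf)"
    and adj: "\<And>f k. Suc k < CARD('n) \<Longrightarrow> Q f \<Longrightarrow> Q (perm_pf (adj k) f)"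
    and turn: "\<And>f. Q (turn_pf f) \<Longrightarrow> Q f"
  shows "Q f"
proof -
  have perm: "Q (perm_pf \<sigma> f)" if "Q f" for \<sigma> f by (rule pf_perm_closed[OF adj that])
  have "turn_pf -` Collect Q = Collect Q"
  proof (rule card_subset_eq)
    show "turn_pf -` Collect Q \<subseteq> Collect Q" using turn by auto
    have "surj (turn_pf :: 'n pf \<Rightarrow> _)" by (rule finite_UNIV_inj_surj[OF finite_pf inj_turn_pf])
    then show "card (turn_pf -` Collect Q) = card (Collect Q)"
      by (intro card_vimage_inj[OF inj_turn_pf]) simp
  qed simp
  then have turn_iff: "Q (turn_pf f) \<longleftrightarrow> Q f" for f by blast
  define z where "z f \<longleftrightarrow> (\<forall>k<CARD('n). pfun f k = 0)" for f :: "'n pf"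
  have reduce: "\<exists>g. z g \<and> (Q g \<longleftrightarrow> Q f)" for f
  proof (induction "nat (\<Sum>k<CARD('n). pfun f k)" arbitrary: f rule: less_induct)
    case less
    show ?case
    proof (cases "z f")
      case False
      then obtain k where k: "k < CARD('n)" "pfun f k \<noteq> 0" by (auto simp: z_def)
      define \<sigma> :: "'n perm" where "\<sigma> = Perm.swap (idx 0) (idx k)"
      define f' where "f' = perm_pf \<sigma> f"
      have "pfun f' 0 = pfun f k" using k by (simp add: f'_def \<sigma>_def pfun_perm_pf)
      then have lt: "(\<Sum>k<CARD('n). pfun (turn_pf f') k) < (\<Sum>k<CARD('n). pfun f k)"
        using pf_size_turn[of f'] k pf_size_perm[of \<sigma> f] by (simp add: f'_def)
      have "0 \<le> (\<Sum>k<CARD('n). pfun (turn_pf f') k)" by (intro sum_nonneg) (simp add: pfun_nonneg)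
      then have "nat (\<Sum>k<CARD('n). pfun (turn_pf f') k) < nat (\<Sum>k<CARD('n). pfun f k)"
        using lt by linarith
      from less.hyps[OF this] obtain g where g: "z g" "Q g \<longleftrightarrow> Q (turn_pf f')" by blast
      have "Q f' \<longleftrightarrow> Q f" using perm[of f \<sigma>] perm[of f' "inverse \<sigma>"] by (auto simp: f'_def)
      with g turn_iff show ?thesis by blast
    qed blast
  qed
  have z_unique: "g = h" if "z g" "z h" for g h :: "'n pf"
    using that by (intro pf_eqI) (simp add: z_def)
  from Q0 reduce z_unique show ?thesis by metis
qed

lemma pf_irreducible:
  fixes S :: "('n::finite pf \<Rightarrow> complex) set"
  assumes S: "module.subspace scaleF S" and w: "pf_discriminant \<in> S"
    and act: "\<And>\<sigma> v. v \<in> S \<Longrightarrow> pf_act \<sigma> v \<in> S"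
    and P: "\<And>v. v \<in> S \<Longrightarrow> pf_trans v \<in> S"
    and z: "\<And>i v. v \<in> S \<Longrightarrow> pf_diag i v \<in> S"
  shows "S = UNIV"
proof -
  interpret vector_space scaleF by (rule vector_space_scaleF)
  have delta: "delta f \<in> S" if "\<phi> \<in> S" "\<phi> f \<noteq> 0" for \<phi> f
    by (rule delta_in_subspace[OF S that, of spec]) (use z spec_separates in \<open>auto simp: pf_diag_eq\<close>)
  have "delta f \<in> S" for f
  proof (rule pf_reachable[where Q = "\<lambda>f. delta f \<in> S"])
    show "\<exists>f. delta f \<in> S" using delta[OF w base_pf_discriminant] by blast
    fix f :: "'n pf" and k
    assume k: "Suc k < CARD('n)" and f: "delta f \<in> S"
    show "delta (perm_pf (adj k) f) \<in> S"
    proof (cases "pfun f k = pfun f (Suc k)")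
      case True
      then show ?thesis using f by (simp add: perm_adj_same[OF k])
    next
      case False
      let ?g = "perm_pf (adj k) f"
      have g: "pfun ?g k = pfun f (Suc k)" "pfun ?g (Suc k) = pfun f k"
        using k by (simp_all add: pfun_perm_adj)
      then have "pfun ?g k \<noteq> pfun ?g (Suc k)" using False by simp
      from pf_act_adj[OF k this] obtain a where a: "a \<noteq> 1"
        "pf_act (adj k) (delta f) ?g = - (a * delta f ?g + (1 - a) * delta f (perm_pf (adj k) ?g))" by blast
      have "?g \<noteq> f" using g False by auto
      moreover have "perm_pf (adj k) ?g = f" by (simp add: perm_pf_one flip: perm_pf_mult)
      ultimately have "pf_act (adj k) (delta f) ?g \<noteq> 0" using a by (simp add: delta_def)
      then show ?thesis by (rule delta[OF act[OF f]])
    qed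
  next
    fix f :: "'n pf" assume "delta (turn_pf f) \<in> S"
    from delta[OF P[OF this], of f] show "delta f \<in> S" by (simp add: pf_trans_delta delta_def)
  qed
  then have "span (range delta) \<subseteq> S" by (intro span_minimal S) auto
  then show ?thesis unfolding span_delta by auto
qed

theorem pf_module_contained_in_DH:
  "contains_subrep (scale_DH :: complex \<Rightarrow> 'n::finite DH \<Rightarrow> 'n DH) perm_DH scaleF (pf_act :: 'n perm \<Rightarrow> _)"
proof -
  interpret trig_module scaleF "pf_act :: 'n perm \<Rightarrow> _" pf_trans pf_diag "of_nat CARD('n) + 1"
    by (rule trig_module_pf)
  interpret spherical_trig_module scaleF "pf_act :: 'n perm \<Rightarrow> _" pf_trans pf_diag "of_nat CARD('n) + 1"
    pf_discriminant "range delta"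
  proof (rule spherical_trig_module.intro[OF trig_module_pf spherical_trig_module_axioms.intro])
    show "pf_discriminant \<noteq> (0 :: 'n pf \<Rightarrow> complex)" using base_pf_discriminant[where 'n = 'n] by (auto simp: fun_eq_iff)
    show "pf_act \<sigma> pf_discriminant = pf_discriminant" for \<sigma> :: "'n perm" by (rule pf_act_discriminant)
    show "v \<in> span {pf_discriminant}" if "\<And>\<sigma>. pf_act \<sigma> v = v" for v :: "'n pf \<Rightarrow> complex"
      using that by (rule pf_invariants)
    show "finite (range (delta :: 'n pf \<Rightarrow> _))" by simp
    show "span (range (delta :: 'n pf \<Rightarrow> _)) = UNIV" by (rule span_delta)
    show "S = UNIV" if "subspace S" "pf_discriminant \<in> S" "\<And>\<sigma> v. v \<in> S \<Longrightarrow> pf_act \<sigma> v \<in> S"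
      "\<And>v. v \<in> S \<Longrightarrow> pf_trans v \<in> S" "\<And>i v. v \<in> S \<Longrightarrow> pf_diag i v \<in> S" for S :: "('n pf \<Rightarrow> complex) set"
      using that by (rule pf_irreducible)
  qed
  show ?thesis by (rule spherical_module_contained_in_DH)
qed

section \<open>Comparison with the permutation representation\<close>

definition sg :: "'n::finite perm \<Rightarrow> complex" where
  "sg \<sigma> = of_int (sign (Perm.apply \<sigma>))"

lemma sg_mult: "sg (\<sigma> * \<tau>) = sg \<sigma> * sg \<tau>"
  by (simp add: sg_def apply_times sign_compose apply_permutation)

lemma sg_one: "sg 1 = 1"
  by (simp add: sg_def)

lemma sg_square: "sg \<sigma> * sg \<sigma> = 1"
  by (simp add: sg_def sign_def)

lemma sg_adj: "Suc k < CARD('n) \<Longrightarrow> sg (adj k :: 'n::finite perm) = - 1"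
  by (simp add: sg_def adj_def swap.rep_eq sign_swap_id idx_inject)

definition sorted_pf :: "'n::finite pf \<Rightarrow> bool" where
  "sorted_pf f \<longleftrightarrow> (\<forall>k l. k \<le> l \<longrightarrow> l < CARD('n) \<longrightarrow> pfun f k \<le> pfun f l)"

lemma sorted_rearrangement: "\<exists>\<sigma>. sorted_pf (perm_pf \<sigma> (f :: 'n::finite pf))"
proof -
  let ?xs = "map (pfun f) [0..<CARD('n)]"
  have "mset (sort ?xs) = mset ?xs" by simp
  then obtain p where p: "p permutes {..<length ?xs}" "permute_list p ?xs = sort ?xs"
    by (rule mset_eq_permutation)
  have pl: "p k < CARD('n)" if "k < CARD('n)" for k
    using permutes_in_image[OF p(1), of k] that by simp
  have nth: "sort ?xs ! k = pfun f (p k)" if "k < CARD('n)" for k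
    using that pl[OF that] by (simp add: p(2)[symmetric] permute_list_def)
  define \<pi> where "\<pi> i = (idx (p (pos i)) :: 'n)" for i :: 'n
  have "inj \<pi>"
  proof (rule injI)
    fix i j assume "\<pi> i = \<pi> j"
    then have "p (pos i) = p (pos j)" by (simp add: \<pi>_def idx_inject pl)
    then have "pos i = pos j" using permutes_inj[OF p(1)] by (simp only: inj_eq)
    then show "i = j" by simp
  qed
  then obtain \<sigma> where \<sigma>: "Perm.apply \<sigma> = \<pi>" using perm_of_inj by blast
  have "pfun (perm_pf (inverse \<sigma>) f) k = sort ?xs ! k" if "k < CARD('n)" for k
    using that by (simp add: pfun_perm_pf perm.inverse_inverse \<sigma> \<pi>_def pl nth)
  then have "sorted_pf (perm_pf (inverse \<sigma>) f)"
    unfolding sorted_pf_def by (auto intro!: sorted_nth_mono)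
  then show ?thesis by blast
qed

definition sort_pf :: "'n::finite pf \<Rightarrow> 'n pf" where
  "sort_pf f = (SOME g. sorted_pf g \<and> (\<exists>\<sigma>. g = perm_pf \<sigma> f))"

lemma sort_pf: "sorted_pf (sort_pf f)" "\<exists>\<sigma>. sort_pf f = perm_pf \<sigma> f"
proof -
  have "\<exists>g. sorted_pf g \<and> (\<exists>\<sigma>. g = perm_pf \<sigma> f)" using sorted_rearrangement[of f] by blast
  from someI_ex[OF this] show "sorted_pf (sort_pf f)" "\<exists>\<sigma>. sort_pf f = perm_pf \<sigma> f"
    unfolding sort_pf_def by blast+
qed

lemma sort_pf_perm: "sort_pf (perm_pf \<tau> f) = sort_pf f"
proof -
  have "(\<exists>\<sigma>. g = perm_pf \<sigma> (perm_pf \<tau> f)) \<longleftrightarrow> (\<exists>\<sigma>. g = perm_pf \<sigma> f)" for g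
  proof
    assume "\<exists>\<sigma>. g = perm_pf \<sigma> f"
    then obtain \<sigma> where "g = perm_pf \<sigma> f" ..
    then have "g = perm_pf (\<sigma> * inverse \<tau>) (perm_pf \<tau> f)" by (simp add: perm_pf_mult)
    then show "\<exists>\<sigma>. g = perm_pf \<sigma> (perm_pf \<tau> f)" ..
  qed (auto simp flip: perm_pf_mult)
  then show ?thesis by (simp add: sort_pf_def)
qed

interpretation pf_rep: sym_rep scaleF "pf_act :: 'n::finite perm \<Rightarrow> _"
  by (rule sym_rep_pf_act)

text \<open>
  The stabilizer of a weakly increasing function is generated by adjacent transpositions: a descent
  of one of its elements is forced to lie inside a block of equal values.
\<close>
lemma pf_act_stabilizer:
  assumes f: "sorted_pf (f :: 'n::finite pf)"
  shows "perm_pf \<rho> f = f \<Longrightarrow> pf_act \<rho> \<phi> f = sg \<rho> * \<phi> f"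
proof (induction \<rho> arbitrary: \<phi> rule: perm_descent_induct)
  case one
  show ?case by (simp add: pf_rep.act_one sg_one)
next
  case (descent \<rho> k)
  have k: "Suc k < CARD('n)" using descent(1) by (simp add: descent_def)
  let ?a = "pos (Perm.apply \<rho> (idx k))" and ?b = "pos (Perm.apply \<rho> (idx (Suc k)))"
  have stab: "pfun f (pos (Perm.apply \<rho> (idx l))) = pfun f l" if "l < CARD('n)" for l
  proof -
    have "perm_pf (inverse \<rho>) f = f" by (metis descent.prems perm_pf_inverse(1))
    then have "pfun (perm_pf (inverse \<rho>) f) l = pfun f l" by simp
    then show ?thesis by (simp add: pfun_perm_pf perm.inverse_inverse)
  qed
  have "?b \<le> ?a" using descent(1) by (simp add: descent_def)
  then have "pfun f ?b \<le> pfun f ?a" using f by (simp add: sorted_pf_def)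
  then have "pfun f (Suc k) \<le> pfun f k" using k by (simp add: stab)
  moreover have "pfun f k \<le> pfun f (Suc k)" using f k by (simp add: sorted_pf_def)
  ultimately have eq: "pfun f k = pfun f (Suc k)" by simp
  then have "perm_pf (\<rho> * adj k) f = f" using descent.prems by (simp add: perm_pf_mult perm_adj_same[OF k])
  from descent.IH[OF this, of "pf_act (adj k) \<phi>"]
  have "pf_act \<rho> \<phi> f = sg (\<rho> * adj k) * pf_act (adj k) \<phi> f" by (simp flip: pf_rep.act_mult)
  then show ?case using eq by (simp add: pf_act_adj_same[OF k] sg_mult sg_adj[OF k])
qed

text \<open>
  The restriction of the module to the orbit of a sorted \<open>g\<close> is induced from the sign character
  of the stabilizer of \<open>g\<close>. The map is the corresponding Frobenius reciprocity; summing over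
  all ways to sort \<open>f\<close> makes it independent of choices and visibly equivariant.
\<close>
definition straighten :: "('n::finite pf \<Rightarrow> complex) \<Rightarrow> 'n pf \<Rightarrow> complex" where
  "straighten \<phi> f = (\<Sum>\<sigma> | perm_pf \<sigma> f = sort_pf f. sg \<sigma> * pf_act \<sigma> \<phi> (sort_pf f))"

lemma straighten_linear: "Vector_Spaces.linear scaleF scaleF (straighten :: ('n::finite pf \<Rightarrow> complex) \<Rightarrow> _)"
  by (rule linear_scaleI)
    (simp_all add: vector_space_scaleF fun_eq_iff straighten_def pf_rep.act_add pf_rep.act_scale
      distrib_left sum.distrib sum_distrib_left mult_ac)

lemma straighten_act:
  "straighten (pf_act \<tau> \<phi>) f = sg \<tau> * straighten \<phi> (perm_pf (inverse \<tau>) (f :: 'n::finite pf))"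
proof -
  let ?f = "perm_pf (inverse \<tau>) f"
  have "straighten (pf_act \<tau> \<phi>) f = (\<Sum>\<sigma> | perm_pf \<sigma> ?f = sort_pf f. sg \<tau> * (sg \<sigma> * pf_act \<sigma> \<phi> (sort_pf f)))"
    unfolding straighten_def
  proof (rule sum.reindex_bij_witness[of _ "\<lambda>\<sigma>. \<sigma> * inverse \<tau>" "\<lambda>\<sigma>. \<sigma> * \<tau>"])
    fix \<sigma> assume s: "\<sigma> \<in> {\<sigma>. perm_pf \<sigma> f = sort_pf f}"
    show "\<sigma> * \<tau> * inverse \<tau> = \<sigma>" by (simp add: mult.assoc perm.right_inverse)
    have "perm_pf (\<sigma> * \<tau>) ?f = perm_pf \<sigma> (perm_pf \<tau> ?f)" by (rule perm_pf_mult)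
    also have "\<dots> = sort_pf f" using s by simp
    finally show "\<sigma> * \<tau> \<in> {\<sigma>. perm_pf \<sigma> ?f = sort_pf f}" by simp
    have "sg \<tau> * (sg (\<sigma> * \<tau>) * c) = sg \<sigma> * c" for c
      using sg_square[of \<tau>] by (simp add: sg_mult)
    then show "sg \<tau> * (sg (\<sigma> * \<tau>) * pf_act (\<sigma> * \<tau>) \<phi> (sort_pf f)) = sg \<sigma> * pf_act \<sigma> (pf_act \<tau> \<phi>) (sort_pf f)"
      by (simp add: pf_rep.act_mult)
  next
    fix \<sigma> assume s: "\<sigma> \<in> {\<sigma>. perm_pf \<sigma> ?f = sort_pf f}"
    show "\<sigma> * inverse \<tau> * \<tau> = \<sigma>" by (simp add: mult.assoc perm.left_inverse)
    show "\<sigma> * inverse \<tau> \<in> {\<sigma>. perm_pf \<sigma> f = sort_pf f}" using s by (simp add: perm_pf_mult)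
  qed
  then show ?thesis by (simp add: straighten_def sort_pf_perm sum_distrib_left)
qed

text \<open>
  If the value at \<open>sort_pf f\<close> of all translates of \<open>\<phi>\<close> is zero, then so is the value at every
  rearrangement, since adjacent transpositions have nonzero transition amplitudes.
\<close>
lemma straighten_inj:
  assumes zero: "straighten \<phi> = 0"
  shows "\<phi> = (0 :: 'n::finite pf \<Rightarrow> complex)"
proof
  fix f :: "'n pf"
  let ?g = "sort_pf f"
  have vanish: "pf_act \<tau> \<phi> ?g = 0" for \<tau>
  proof -
    have sg: "sort_pf ?g = ?g" using sort_pf(2)[of f] sort_pf_perm by metis
    have "0 = straighten (pf_act \<tau> \<phi>) ?g" by (simp add: straighten_act zero)
    also have "\<dots> = (\<Sum>\<sigma> | perm_pf \<sigma> ?g = ?g. sg \<sigma> * pf_act \<sigma> (pf_act \<tau> \<phi>) ?g)"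
      by (simp add: straighten_def sg)
    also have "\<dots> = (\<Sum>\<sigma> | perm_pf \<sigma> ?g = ?g. pf_act \<tau> \<phi> ?g)"
    proof (rule sum.cong[OF refl])
      fix \<sigma> assume "\<sigma> \<in> {\<sigma>. perm_pf \<sigma> ?g = ?g}"
      then have "pf_act \<sigma> (pf_act \<tau> \<phi>) ?g = sg \<sigma> * pf_act \<tau> \<phi> ?g"
        by (intro pf_act_stabilizer sort_pf) simp
      then show "sg \<sigma> * pf_act \<sigma> (pf_act \<tau> \<phi>) ?g = pf_act \<tau> \<phi> ?g"
        by (simp add: sg_square flip: mult.assoc)
    qed
    also have "\<dots> = of_nat (card {\<sigma>. perm_pf \<sigma> ?g = ?g}) * pf_act \<tau> \<phi> ?g" by simp
    finally have "of_nat (card {\<sigma>. perm_pf \<sigma> ?g = ?g}) * pf_act \<tau> \<phi> ?g = 0" by simp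
    moreover have "card {\<sigma>. perm_pf \<sigma> ?g = ?g} \<noteq> 0"
      using finite_subset[OF subset_UNIV finite_perm_UNIV, of "{\<sigma>. perm_pf \<sigma> ?g = ?g}"] perm_pf_one[of ?g]
      by (auto simp: card_eq_0_iff)
    ultimately show ?thesis by simp
  qed
  obtain \<sigma> where \<sigma>: "?g = perm_pf \<sigma> f" using sort_pf(2) by blast
  have "\<forall>\<tau>. pf_act \<tau> \<phi> (perm_pf (inverse \<sigma>) ?g) = 0"
  proof (rule pf_perm_closed[where Q = "\<lambda>g. \<forall>\<tau>. pf_act \<tau> \<phi> g = 0"])
    show "\<forall>\<tau>. pf_act \<tau> \<phi> ?g = 0" using vanish by blast
    fix h :: "'n pf" and k
    assume k: "Suc k < CARD('n)" and h: "\<forall>\<tau>. pf_act \<tau> \<phi> h = 0"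
    show "\<forall>\<tau>. pf_act \<tau> \<phi> (perm_pf (adj k) h) = 0"
    proof (cases "pfun h k = pfun h (Suc k)")
      case True
      then show ?thesis using h by (simp add: perm_adj_same[OF k])
    next
      case False
      then obtain a where a: "a \<noteq> 1" "\<And>\<psi>. pf_act (adj k) \<psi> h = - (a * \<psi> h + (1 - a) * \<psi> (perm_pf (adj k) h))"
        using pf_act_adj[OF k] by blast
      show ?thesis
      proof
        fix \<tau>
        have "pf_act (adj k * \<tau>) \<phi> h = 0" using h by blast
        then show "pf_act \<tau> \<phi> (perm_pf (adj k) h) = 0"
          using a h by (simp add: pf_rep.act_mult)
      qed
    qed
  qed
  then have "pf_act 1 \<phi> f = 0" by (simp add: \<sigma>)
  then show "\<phi> f = 0 f" by (simp add: pf_rep.act_one)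
qed

lemma surj_of_inj_scaleF:
  fixes h :: "('a::finite \<Rightarrow> complex) \<Rightarrow> 'a \<Rightarrow> complex"
  assumes h: "Vector_Spaces.linear scaleF scaleF h" and inj: "inj h"
  shows "surj h"
proof -
  interpret V: vector_space "scaleF :: complex \<Rightarrow> ('a \<Rightarrow> complex) \<Rightarrow> _" by (rule vector_space_scaleF)
  obtain B :: "('a \<Rightarrow> complex) set" where "V.independent B" "UNIV \<subseteq> V.span B"
    using V.maximal_independent_subset[of UNIV] by blast
  then have B: "V.independent B" "V.span B = UNIV" by blast+
  have "finite B" using V.independent_span_bound[of "range delta" B] B(1) span_delta by auto
  then interpret V: finite_dimensional_vector_space "scaleF :: complex \<Rightarrow> ('a \<Rightarrow> complex) \<Rightarrow> _" B
    using B by unfold_locales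
  show ?thesis by (rule V.linear_inj_imp_surj[OF h inj])
qed

theorem pf_module_contains_CPF:
  "contains_subrep scaleF (pf_act :: 'n::finite perm \<Rightarrow> _)
     (scale_CPF :: complex \<Rightarrow> 'n CPF \<Rightarrow> 'n CPF) (tensor_sign scale_CPF perm_CPF)"
proof -
  interpret S: Vector_Spaces.linear scaleF scaleF "straighten :: ('n pf \<Rightarrow> complex) \<Rightarrow> _"
    by (rule straighten_linear)
  have "inj (straighten :: ('n pf \<Rightarrow> complex) \<Rightarrow> _)"
    using straighten_inj by (auto simp: S.inj_iff_eq_0)
  then have surj: "surj (straighten :: ('n pf \<Rightarrow> complex) \<Rightarrow> _)"
    by (rule surj_of_inj_scaleF[OF straighten_linear])
  define L where "L \<phi> = (Abs_poly_mapping (straighten \<phi>) :: 'n CPF)" for \<phi>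
  have L: "Poly_Mapping.lookup (L \<phi>) = straighten \<phi>" for \<phi>
    unfolding L_def by (rule Abs_poly_mapping_inverse) simp
  show ?thesis
  proof (rule contains_subrep_of_surjection)
    show "sym_rep scaleF (pf_act :: 'n perm \<Rightarrow> _)" by (rule sym_rep_pf_act)
    show "sym_rep (scale_CPF :: complex \<Rightarrow> 'n CPF \<Rightarrow> 'n CPF) (tensor_sign scale_CPF perm_CPF)"
      by (rule sym_rep_tensor_sign[OF CPF.sym_rep_axioms])
    show "Vector_Spaces.linear scaleF scale_CPF L"
      by (rule linear_scaleI)
        (auto intro!: vector_space_scaleF CPF.vector_space_axioms poly_mapping_eqI
          simp: L lookup_add lookup_scale_CPF S.add S.scale)
    show "surj L"
    proof (rule surjI)
      fix v :: "'n CPF"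
      show "L (inv straighten (Poly_Mapping.lookup v)) = v"
        by (rule poly_mapping_eqI) (simp add: L surj_f_inv_f[OF surj])
    qed
    show "L (pf_act \<tau> \<phi>) = tensor_sign scale_CPF perm_CPF \<tau> (L \<phi>)" for \<tau> \<phi>
      by (rule poly_mapping_eqI)
        (simp add: L straighten_act tensor_sign_def lookup_scale_CPF lookup_perm_CPF sg_def)
  qed
qed


section \<open>Counting parking functions\<close>

text \<open>
  Pollak's argument: among the \<open>n + 1\<close> rotations modulo \<open>n + 1\<close> of a function with values in
  \<open>{0..n}\<close> exactly one is a parking function (up to the shift of values by one).
\<close>

definition rotate_value :: "nat \<Rightarrow> nat \<Rightarrow> nat \<Rightarrow> nat" where
  "rotate_value N r a = (if r \<le> a then a - r else a + (N + 1) - r)"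

lemma bij_rotate_value:
  assumes "r \<le> N"
  shows "bij_betw (rotate_value N r) {0..N} {0..N}"
  by (rule bij_betw_byWitness[where f' = "\<lambda>b. if b + r \<le> N then b + r else b + r - (N + 1)"])
    (use assms in \<open>auto simp: rotate_value_def\<close>)

definition excess :: "('n::finite \<Rightarrow> nat) \<Rightarrow> nat \<Rightarrow> int" where
  "excess g c = int (card {i. g i < c}) - int c"

definition ballot :: "('n::finite \<Rightarrow> nat) \<Rightarrow> bool" where
  "ballot h \<longleftrightarrow> (\<forall>s\<in>{1..CARD('n)}. s \<le> card {i. h i < s})"

lemma card_rotate_value:
  fixes g :: "'n::finite \<Rightarrow> nat"
  assumes g: "\<And>i. g i \<le> CARD('n)" and r: "r \<le> CARD('n)" and s: "1 \<le> s" "s \<le> CARD('n)"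
  shows "int (card {i. rotate_value CARD('n) r (g i) < s}) - int s =
    (if r + s \<le> CARD('n) + 1 then excess g (r + s) - excess g r
     else excess g (r + s - (CARD('n) + 1)) - excess g r - 1)"
proof (cases "r + s \<le> CARD('n) + 1")
  case True
  have "{i. rotate_value CARD('n) r (g i) < s} = {i. g i < r + s} - {i. g i < r}"
    using True by (auto simp: rotate_value_def not_less)
  moreover have "card ({i. g i < r + s} - {i. g i < r}) = card {i. g i < r + s} - card {i. g i < r}"
    by (rule card_Diff_subset) auto
  moreover have "card {i. g i < r} \<le> card {i. g i < r + s}" by (rule card_mono) auto
  ultimately show ?thesis using True by (simp add: excess_def of_nat_diff)
next
  case False
  let ?c = "r + s - (CARD('n) + 1)"
  have "{i. rotate_value CARD('n) r (g i) < s} = (UNIV - {i. g i < r}) \<union> {i. g i < ?c}"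
  proof (rule set_eqI)
    fix i
    show "i \<in> {i. rotate_value CARD('n) r (g i) < s} \<longleftrightarrow> i \<in> (UNIV - {i. g i < r}) \<union> {i. g i < ?c}"
      using False g[of i] r s by (auto simp: rotate_value_def)
  qed
  moreover have "card ((UNIV - {i. g i < r}) \<union> {i. g i < ?c}) = card (UNIV - {i. g i < r}) + card {i. g i < ?c}"
    using s r by (intro card_Un_disjoint) auto
  moreover have "card (UNIV - {i. g i < r}) = CARD('n) - card {i. g i < r}"
    by (rule card_Diff_subset) auto
  moreover have "card {i. g i < r} \<le> CARD('n)" by (rule card_mono) auto
  ultimately show ?thesis using False by (simp add: excess_def of_nat_diff)
qed

text \<open>
  The cycle lemma: a rotation is a parking function iff it starts at the first minimum of the
  excess, which drops by one over a full turn.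
\<close>
lemma ballot_rotate_iff:
  fixes g :: "'n::finite \<Rightarrow> nat"
  assumes g: "\<And>i. g i \<le> CARD('n)" and r: "r \<le> CARD('n)"
  shows "ballot (\<lambda>i. rotate_value CARD('n) r (g i)) \<longleftrightarrow>
    (\<forall>c\<le>CARD('n). excess g r \<le> excess g c \<and> (c < r \<longrightarrow> excess g r < excess g c))"
proof -
  let ?N = "CARD('n)"
  have e0: "excess g 0 = 0" by (simp add: excess_def)
  have eN: "excess g (?N + 1) = - 1"
  proof -
    have "{i. g i < ?N + 1} = UNIV" using g by (auto simp: less_Suc_eq_le)
    then show ?thesis by (simp add: excess_def)
  qed
  have "ballot (\<lambda>i. rotate_value ?N r (g i)) \<longleftrightarrow> (\<forall>s\<in>{1..?N}. if r + s \<le> ?N + 1 then excess g r \<le> excess g (r + s)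
     else excess g r < excess g (r + s - (?N + 1)))"
    unfolding ballot_def
  proof (rule ball_cong[OF refl])
    fix s assume "s \<in> {1..?N}"
    then have s: "1 \<le> s" "s \<le> ?N" by auto
    show "s \<le> card {i. rotate_value ?N r (g i) < s} \<longleftrightarrow> (if r + s \<le> ?N + 1 then excess g r \<le> excess g (r + s)
     else excess g r < excess g (r + s - (?N + 1)))"
      using card_rotate_value[where g = g, OF g r s] by (auto split: if_splits)
  qed
  also have "\<dots> \<longleftrightarrow> (\<forall>c\<le>?N. excess g r \<le> excess g c \<and> (c < r \<longrightarrow> excess g r < excess g c))"
  proof (intro iffI allI impI ballI)
    fix c assume H: "\<forall>s\<in>{1..?N}. if r + s \<le> ?N + 1 then excess g r \<le> excess g (r + s)
     else excess g r < excess g (r + s - (?N + 1))" and c: "c \<le> ?N"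
    consider "c = r" | "r < c" | "c < r" "c = 0" | "c < r" "0 < c" by linarith
    then show "excess g r \<le> excess g c \<and> (c < r \<longrightarrow> excess g r < excess g c)"
    proof cases
      case 2
      then have "c - r \<in> {1..?N}" using c by auto
      from bspec[OF H this] 2 c show ?thesis by simp
    next
      case 3
      then have "?N + 1 - r \<in> {1..?N}" using r by auto
      from bspec[OF H this] have "excess g r \<le> excess g (?N + 1)" using r by simp
      then show ?thesis using 3 e0 eN by simp
    next
      case 4
      then have "c + (?N + 1) - r \<in> {1..?N}" using r by auto
      from bspec[OF H this] 4 r show ?thesis by simp
    qed simp
  next
    fix s assume H: "\<forall>c\<le>?N. excess g r \<le> excess g c \<and> (c < r \<longrightarrow> excess g r < excess g c)" and s: "s \<in> {1..?N}"
    consider "r + s \<le> ?N" | "r + s = ?N + 1" | "r + s > ?N + 1" by linarith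
    then show "if r + s \<le> ?N + 1 then excess g r \<le> excess g (r + s) else excess g r < excess g (r + s - (?N + 1))"
    proof cases
      case 2
      then have "0 < r" using s by simp
      then have "excess g r < 0" using H e0 by force
      then show ?thesis using 2 eN by simp
    next
      case 3
      then have "r + s - (?N + 1) < r" "r + s - (?N + 1) \<le> ?N" using s r by auto
      then show ?thesis using H 3 by auto
    qed (use H in auto)
  qed
  finally show ?thesis .
qed

lemma unique_ballot_rotation:
  fixes g :: "'n::finite \<Rightarrow> nat"
  assumes g: "\<And>i. g i \<le> CARD('n)"
  shows "\<exists>!r. r \<le> CARD('n) \<and> ballot (\<lambda>i. rotate_value CARD('n) r (g i))"
proof -
  let ?N = "CARD('n)"
  let ?first = "\<lambda>r. r \<le> ?N \<and> (\<forall>c\<le>?N. excess g r \<le> excess g c \<and> (c < r \<longrightarrow> excess g r < excess g c))"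
  have "Min (excess g ` {..?N}) \<in> excess g ` {..?N}" by (rule Min_in) auto
  then obtain r0 where r0: "Min (excess g ` {..?N}) = excess g r0" "r0 \<in> {..?N}" by (rule imageE)
  have "excess g r0 \<le> excess g c" if "c \<le> ?N" for c
    unfolding r0(1)[symmetric] using that by (intro Min_le) auto
  then have ex: "\<exists>r. r \<le> ?N \<and> (\<forall>c\<le>?N. excess g r \<le> excess g c)"
    using r0(2) by auto
  define r where "r = (LEAST r. r \<le> ?N \<and> (\<forall>c\<le>?N. excess g r \<le> excess g c))"
  have r: "r \<le> ?N" "\<And>c. c \<le> ?N \<Longrightarrow> excess g r \<le> excess g c"
    using LeastI_ex[OF ex] unfolding r_def by blast+
  have "excess g r < excess g c" if "c < r" for c
  proof (rule ccontr)
    assume "\<not> excess g r < excess g c"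
    moreover have "excess g r \<le> excess g d" if "d \<le> ?N" for d using that by (rule r(2))
    ultimately have "c \<le> ?N \<and> (\<forall>d\<le>?N. excess g c \<le> excess g d)"
      using r(1) that by fastforce
    then have "r \<le> c" unfolding r_def by (rule Least_le)
    with that show False by simp
  qed
  with r have "?first r" by blast
  moreover have "a = b" if "?first a" "?first b" for a b
  proof (cases a b rule: linorder_cases)
    case less
    then have "excess g b < excess g a" "excess g a \<le> excess g b" using that by auto
    then show ?thesis by simp
  next
    case greater
    then have "excess g a < excess g b" "excess g b \<le> excess g a" using that by auto
    then show ?thesis by simp
  qed
  ultimately have "\<exists>!r. ?first r" by blast
  moreover have "r \<le> ?N \<and> ballot (\<lambda>i. rotate_value ?N r (g i)) \<longleftrightarrow> ?first r" for r
    using ballot_rotate_iff[where g = g, OF g, of r] by blast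
  ultimately show ?thesis by simp
qed

lemma card_ballot: "(CARD('n) + 1) * card {h :: 'n::finite \<Rightarrow> nat. range h \<subseteq> {0..CARD('n)} \<and> ballot h} = (CARD('n) + 1) ^ CARD('n)"
proof -
  let ?N = "CARD('n)"
  let ?F = "{g :: 'n \<Rightarrow> nat. range g \<subseteq> {0..?N}}"
  let ?B = "{h :: 'n \<Rightarrow> nat. range h \<subseteq> {0..?N} \<and> ballot h}"
  let ?R = "\<lambda>r (g :: 'n \<Rightarrow> nat) i. rotate_value ?N r (g i)"
  have F: "?F = (UNIV :: 'n set) \<rightarrow>\<^sub>E {0..?N}" by (auto simp: PiE_def)
  have card_F: "card ?F = (?N + 1) ^ ?N" unfolding F by (simp add: card_PiE)
  have finF: "finite ?F" unfolding F by (simp add: finite_PiE)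
  have eq: "?F = (\<Union>r\<in>{0..?N}. {g \<in> ?F. ballot (?R r g)})"
  proof
    show "?F \<subseteq> (\<Union>r\<in>{0..?N}. {g \<in> ?F. ballot (?R r g)})"
    proof
      fix g assume g: "g \<in> ?F"
      then have "\<And>i. g i \<le> ?N" by (auto simp: image_subset_iff)
      from ex1_implies_ex[OF unique_ballot_rotation[where g = g, OF this]]
      obtain r where "r \<le> ?N" "ballot (?R r g)" by blast
      with g show "g \<in> (\<Union>r\<in>{0..?N}. {g \<in> ?F. ballot (?R r g)})" by auto
    qed
  qed blast
  have "card ?F = (\<Sum>r\<in>{0..?N}. card {g \<in> ?F. ballot (?R r g)})"
  proof (subst eq, rule card_UN_disjoint)
    show "\<forall>r\<in>{0..?N}. \<forall>s\<in>{0..?N}. r \<noteq> s \<longrightarrow> {g \<in> ?F. ballot (?R r g)} \<inter> {g \<in> ?F. ballot (?R s g)} = {}"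
    proof (intro ballI impI equals0I)
      fix r s g assume rs: "r \<in> {0..?N}" "s \<in> {0..?N}" "r \<noteq> s"
        and g: "g \<in> {g \<in> ?F. ballot (?R r g)} \<inter> {g \<in> ?F. ballot (?R s g)}"
      then have "\<And>i. g i \<le> ?N" by (auto simp: image_subset_iff)
      then have "\<exists>!r. r \<le> ?N \<and> ballot (?R r g)" by (rule unique_ballot_rotation)
      moreover have "r \<le> ?N \<and> ballot (?R r g)" "s \<le> ?N \<and> ballot (?R s g)" using rs g by auto
      ultimately have "r = s" by blast
      with rs show False by simp
    qed
  qed (use finF in auto)
  also have "\<dots> = (\<Sum>r\<in>{0..?N}. card ?B)"
  proof (rule sum.cong[OF refl])
    fix r assume "r \<in> {0..?N}"
    then have bij: "bij_betw (rotate_value ?N r) {0..?N} {0..?N}" by (intro bij_rotate_value) simp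
    have "?R r ` {g \<in> ?F. ballot (?R r g)} = ?B"
    proof
      show "?R r ` {g \<in> ?F. ballot (?R r g)} \<subseteq> ?B"
        using bij by (auto simp: bij_betw_def)
      show "?B \<subseteq> ?R r ` {g \<in> ?F. ballot (?R r g)}"
      proof
        fix h assume h: "h \<in> ?B"
        let ?g = "\<lambda>i. inv_into {0..?N} (rotate_value ?N r) (h i)"
        have hi: "h i \<in> rotate_value ?N r ` {0..?N}" for i
        proof -
          have "h i \<in> {0..?N}" using h by blast
          then show ?thesis using bij by (simp add: bij_betw_def)
        qed
        have Rg: "?R r ?g = h" by (intro ext f_inv_into_f hi)
        have "?g i \<in> {0..?N}" for i using hi by (rule inv_into_into)
        then have "?g \<in> {g \<in> ?F. ballot (?R r g)}" using h Rg by auto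
        then show "h \<in> ?R r ` {g \<in> ?F. ballot (?R r g)}" by (rule image_eqI[where x = ?g and f = "?R r", rotated]) (simp only: Rg)
      qed
    qed
    moreover have "card (?R r ` {g \<in> ?F. ballot (?R r g)}) = card {g \<in> ?F. ballot (?R r g)}"
    proof (rule card_image, rule inj_onI, rule ext)
      fix g g' i assume "g \<in> {g \<in> ?F. ballot (?R r g)}" "g' \<in> {g \<in> ?F. ballot (?R r g)}" "?R r g = ?R r g'"
      then have "g i \<in> {0..?N}" "g' i \<in> {0..?N}" "rotate_value ?N r (g i) = rotate_value ?N r (g' i)"
        by (blast, blast, meson)
      then show "g i = g' i" using bij by (meson bij_betw_def inj_onD)
    qed
    ultimately show "card {g \<in> ?F. ballot (?R r g)} = card ?B" by (simp only:)
  qed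
  finally show ?thesis using card_F by simp
qed

lemma card_parking_functions:
  "card (parking_functions :: ('n::finite \<Rightarrow> nat) set) = (CARD('n) + 1) ^ (CARD('n) - 1)"
proof -
  let ?N = "CARD('n)"
  let ?B = "{h :: 'n \<Rightarrow> nat. range h \<subseteq> {0..?N} \<and> ballot h}"
  let ?s = "\<lambda>(h :: 'n \<Rightarrow> nat) i. Suc (h i)"
  have vim: "?s h -` {1..s} = {i. h i < s}" for h s by auto
  have "parking_functions = ?s ` ?B"
  proof
    show "?s ` ?B \<subseteq> parking_functions"
    proof
      fix f assume "f \<in> ?s ` ?B"
      then obtain h where h: "f = ?s h" "range h \<subseteq> {0..?N}" "ballot h" by auto
      have "?N \<le> card {i. h i < ?N}" using h(3) by (simp add: ballot_def)
      then have "{i. h i < ?N} = UNIV" by (intro card_seteq) auto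
      then have "range (?s h) \<subseteq> {1..?N}" by (auto simp: Suc_le_eq)
      then show "f \<in> parking_functions" using h(3) by (simp only: h(1) parking_functions_def ballot_def vim mem_Collect_eq)
    qed
    show "parking_functions \<subseteq> ?s ` ?B"
    proof
      fix f :: "'n \<Rightarrow> nat" assume f: "f \<in> parking_functions"
      let ?h = "\<lambda>i. f i - 1"
      have "range f \<subseteq> {1..?N}" using f by (simp add: parking_functions_def)
      then have r: "f i \<in> {1..?N}" for i by blast
      have fs: "f = ?s ?h" using r by (intro ext) (simp add: Suc_le_eq)
      have "f -` {1..s} = {i. f i - 1 < s}" for s
      proof (rule set_eqI)
        show "i \<in> f -` {1..s} \<longleftrightarrow> i \<in> {i. f i - 1 < s}" for i using r[of i] by auto
      qed
      then have "ballot ?h" using f by (simp add: parking_functions_def ballot_def)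
      moreover have "f i - 1 \<le> ?N" for i using r[of i] unfolding atLeastAtMost_iff by linarith
      ultimately have "?h \<in> ?B" by auto
      then show "f \<in> ?s ` ?B" by (rule image_eqI[where x = ?h and f = ?s, rotated]) (rule fs)
    qed
  qed
  moreover have "card (?s ` ?B) = card ?B"
    by (rule card_image) (auto simp: inj_on_def fun_eq_iff)
  ultimately have "card (parking_functions :: ('n \<Rightarrow> nat) set) = card ?B" by (simp only:)
  moreover have "(?N + 1) * card ?B = (?N + 1) * (?N + 1) ^ (?N - 1)"
    using card_ballot[where 'n = 'n] by (simp flip: power_Suc)
  then have "card ?B = (?N + 1) ^ (?N - 1)"
    by (rule nat_mult_eq_cancel1[THEN iffD1, rotated]) simp
  ultimately show ?thesis by (simp only:)
qed

section \<open>Finite dimension of the coinvariants\<close>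

lemma perm_poly_sum: "perm_poly \<sigma> (sum f A) = (\<Sum>a\<in>A. perm_poly \<sigma> (f a))"
  by (induction A rule: infinite_finite_induct) (simp_all add: perm_poly_add)

lemma perm_poly_prod: "perm_poly \<sigma> (prod f A) = (\<Prod>a\<in>A. perm_poly \<sigma> (f a))"
proof -
  have "perm_poly \<sigma> 1 = 1" using perm_poly_dconst[of \<sigma> 1] by (simp add: dconst_def)
  then show ?thesis by (induction A rule: infinite_finite_induct) (simp_all add: perm_poly_times)
qed

lemma lookup_dvar_times_0: "Poly_Mapping.lookup (dvar v * p) 0 = 0"
proof (induction p rule: dpoly_induct)
  case (single m c)
  have "Poly_Mapping.lookup (Poly_Mapping.single v (1::nat) + m) v \<noteq> 0" by (simp add: lookup_add)
  then have "Poly_Mapping.single v (1::nat) + m \<noteq> 0" by (metis lookup_zero)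
  then show ?case by (simp add: dvar_def mult_single lookup_single)
qed (simp_all add: ring_distribs lookup_add)

text \<open>
  Each variable is a root of the monic polynomial of degree \<open>n\<close> whose roots are all variables of
  its kind, and whose lower coefficients are invariants without constant term.
\<close>
lemma dvar_power_in_coinv_ideal:
  fixes K :: "'n::finite \<Rightarrow> 'n + 'n"
  assumes K: "\<And>\<sigma> i. perm_poly \<sigma> (dvar (K i)) = dvar (K (Perm.apply \<sigma> i))"
  shows "dvar (K i) ^ CARD('n) \<in> coinv_ideal"
proof -
  let ?t = "dvar (K i) :: 'n dpoly"
  define E where "E k = (\<Sum>X | card X = k. \<Prod>j\<in>UNIV - X. - dvar (K j))" for k
  have "0 = (\<Prod>j\<in>UNIV. ?t + - dvar (K j))"
    by (rule prod_zero[symmetric]) (auto intro: bexI[of _ i])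
  also have "\<dots> = (\<Sum>X\<in>UNIV. ?t ^ card X * (\<Prod>j\<in>UNIV - X. - dvar (K j)))"
    by (subst prod_add) simp_all
  also have "\<dots> = (\<Sum>k\<in>{..CARD('n)}. \<Sum>X | X \<in> UNIV \<and> card X = k. ?t ^ card X * (\<Prod>j\<in>UNIV - X. - dvar (K j)))"
    by (rule sum.group[symmetric]) (auto intro: card_mono)
  also have "\<dots> = (\<Sum>k\<le>CARD('n). ?t ^ k * E k)"
    by (simp add: E_def sum_distrib_left)
  also have "\<dots> = (\<Sum>k<CARD('n). ?t ^ k * E k) + ?t ^ CARD('n) * E (CARD('n))"
    by (simp flip: lessThan_Suc_atMost)
  also have "E (CARD('n)) = 1"
  proof -
    have "{X :: 'n set. card X = CARD('n)} = {UNIV}"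
      by (auto dest: card_subset_eq[OF finite subset_UNIV])
    then show ?thesis by (simp add: E_def)
  qed
  finally have eq: "?t ^ CARD('n) = - (\<Sum>k<CARD('n). ?t ^ k * E k)"
    by (simp add: eq_neg_iff_add_eq_0 add.commute)
  have "E k \<in> invariants_pos" if k: "k < CARD('n)" for k
  proof -
    have "perm_poly \<sigma> (E k) = E k" for \<sigma>
    proof -
      have bij: "bij (Perm.apply \<sigma>)" by simp
      have "perm_poly \<sigma> (\<Prod>j\<in>UNIV - X. - dvar (K j)) = (\<Prod>j\<in>UNIV - Perm.apply \<sigma> ` X. - dvar (K j))" for X
      proof -
        have minus: "perm_poly \<sigma> (- p) = - perm_poly \<sigma> p" for p using perm_poly_diff[of \<sigma> 0 p] by simp
        have "(\<Prod>j\<in>UNIV - Perm.apply \<sigma> ` X. - dvar (K j)) = (\<Prod>j\<in>Perm.apply \<sigma> ` (UNIV - X). - dvar (K j))"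
          using bij by (simp add: image_set_diff bij_is_inj bij_is_surj)
        also have "\<dots> = (\<Prod>j\<in>UNIV - X. - dvar (K (Perm.apply \<sigma> j)))"
          using bij by (subst prod.reindex) (auto intro: inj_on_subset[OF bij_is_inj[OF bij]])
        finally show ?thesis by (simp add: perm_poly_prod minus K)
      qed
      then have "perm_poly \<sigma> (E k) = (\<Sum>X | card X = k. \<Prod>j\<in>UNIV - Perm.apply \<sigma> ` X. - dvar (K j))"
        by (simp add: E_def perm_poly_sum)
      also have "\<dots> = E k"
        unfolding E_def
      proof (rule sum.reindex_bij_witness[of _ "\<lambda>X. Perm.apply (inverse \<sigma>) ` X" "\<lambda>X. Perm.apply \<sigma> ` X"])
        fix X :: "'n set" assume "X \<in> {X. card X = k}"
        then show "Perm.apply \<sigma> ` X \<in> {X. card X = k}" "Perm.apply (inverse \<sigma>) ` X \<in> {X. card X = k}"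
          by (simp_all add: card_image inj_on_subset[OF bij_is_inj[OF bij_apply]])
        show "Perm.apply (inverse \<sigma>) ` Perm.apply \<sigma> ` X = X" "Perm.apply \<sigma> ` Perm.apply (inverse \<sigma>) ` X = X"
          by (simp_all add: image_image)
      qed simp
      finally show ?thesis .
    qed
    moreover have "Poly_Mapping.lookup (E k) 0 = 0"
    proof -
      have "Poly_Mapping.lookup (\<Prod>j\<in>UNIV - X. - dvar (K j)) 0 = 0" if "card X = k" for X
      proof -
        have "X \<noteq> UNIV" using that k by auto
        then obtain j where j: "j \<in> UNIV - X" by auto
        have "(\<Prod>j\<in>UNIV - X. - dvar (K j)) = dvar (K j) * - (\<Prod>j\<in>UNIV - X - {j}. - dvar (K j))"
          by (subst prod.remove[OF _ j]) simp_all
        then show ?thesis by (simp only: lookup_dvar_times_0)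
      qed
      then show ?thesis by (simp add: E_def lookup_sum)
    qed
    ultimately show ?thesis by (simp add: invariants_pos_def)
  qed
  then have "E k \<in> coinv_ideal" if "k < CARD('n)" for k
    using that unfolding coinv_ideal_def by (intro dpoly_module.span_base)
  then have "(\<Sum>k<CARD('n). ?t ^ k * E k) \<in> coinv_ideal"
    unfolding coinv_ideal_def
    by (intro dpoly_module.span_sum dpoly_module.span_scale) simp
  then show ?thesis unfolding eq by (rule coinv_ideal_minus)
qed

lemma single_power: "Poly_Mapping.single (Poly_Mapping.single v 1) (1 :: complex) ^ k
   = Poly_Mapping.single (Poly_Mapping.single v k) 1"
proof (induction k)
  case (Suc k)
  have "Poly_Mapping.single v (1 :: nat) + Poly_Mapping.single v k = Poly_Mapping.single v (Suc k)"
    by (simp flip: single_add)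
  then show ?case unfolding power_Suc Suc.IH mult_single by simp
qed (simp add: single_one)

lemma monomial_in_coinv_ideal:
  assumes "CARD('n) \<le> Poly_Mapping.lookup m v"
  shows "Poly_Mapping.single m c \<in> (coinv_ideal :: 'n::finite dpoly set)"
proof -
  let ?N = "CARD('n)"
  have "dvar v ^ ?N \<in> (coinv_ideal :: 'n dpoly set)"
    using dvar_power_in_coinv_ideal[of Inl] dvar_power_in_coinv_ideal[of Inr]
    by (cases v) (simp_all add: perm_poly_dvar)
  then have mem: "Poly_Mapping.single (m - Poly_Mapping.single v ?N) c * dvar v ^ ?N \<in> coinv_ideal"
    by (rule coinv_ideal_mult)
  have "m - Poly_Mapping.single v ?N + Poly_Mapping.single v ?N = m"
    using assms by (intro poly_mapping_eqI) (auto simp: lookup_add lookup_minus lookup_single when_def)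
  then have "Poly_Mapping.single (m - Poly_Mapping.single v ?N) c * dvar v ^ ?N = Poly_Mapping.single m c"
    unfolding dvar_def single_power by (simp add: mult_single)
  with mem show ?thesis by simp
qed

lemma DH_finite_span: "\<exists>B :: 'n::finite DH set. finite B \<and> DH.span B = UNIV"
proof -
  let ?N = "CARD('n)"
  define M where "M = {m :: 'n dmonom. \<forall>v. Poly_Mapping.lookup m v < ?N}"
  define B where "B = (\<lambda>m. abs_DH (Poly_Mapping.single m 1) :: 'n DH) ` M"
  have "finite M"
  proof (rule finite_imageD)
    have "Poly_Mapping.lookup ` M \<subseteq> (UNIV :: ('n + 'n) set) \<rightarrow>\<^sub>E {..<?N}"
      by (auto simp: M_def)
    then show "finite (Poly_Mapping.lookup ` M)" by (rule finite_subset) (simp add: finite_PiE)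
    show "inj_on Poly_Mapping.lookup M" by (auto intro: inj_onI poly_mapping_eqI)
  qed
  have "abs_DH p \<in> DH.span B" for p :: "'n dpoly"
  proof (induction p rule: dpoly_induct)
    case zero
    show ?case using DH.span_zero by (simp add: zero_DH_def)
  next
    case (single m c)
    show ?case
    proof (cases "m \<in> M")
      case True
      have "abs_DH (Poly_Mapping.single m c) = scale_DH c (abs_DH (Poly_Mapping.single m 1))"
        by (simp add: scale_DH.abs_eq dconst_def mult_single)
      also have "\<dots> \<in> DH.span B"
        using True by (intro DH.span_scale DH.span_base) (simp add: B_def)
      finally show ?thesis .
    next
      case False
      then obtain v where "?N \<le> Poly_Mapping.lookup m v" by (auto simp: M_def not_less)
      then have "coinv_rel (Poly_Mapping.single m c) 0"
        by (simp add: coinv_rel_def monomial_in_coinv_ideal)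
      then have "abs_DH (Poly_Mapping.single m c) = 0" by (simp add: DH.abs_eq_iff zero_DH_def)
      then show ?thesis by (simp add: DH.span_zero)
    qed
  next
    case (add p q)
    then show ?case by (simp add: DH.span_add flip: plus_DH.abs_eq)
  qed
  moreover have "\<exists>p. x = abs_DH p" for x :: "'n DH" by (metis Quotient3_DH Quotient3_abs_rep)
  ultimately have "DH.span B = UNIV" by (metis UNIV_eq_I)
  with \<open>finite M\<close> show ?thesis by (auto simp: B_def)
qed

section \<open>The theorem\<close>

lemma contains_subrep_trans:
  assumes "contains_subrep s1 a1 s2 a2" "contains_subrep s2 a2 s3 a3"
  shows "contains_subrep s1 a1 s3 a3"
proof -
  obtain S where S: "Vector_Spaces.linear s2 s1 S" "inj S" "\<And>\<sigma> w. S (a2 \<sigma> w) = a1 \<sigma> (S w)"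
    using assms(1) by (auto simp: contains_subrep_def)
  obtain T where T: "Vector_Spaces.linear s3 s2 T" "inj T" "\<And>\<sigma> w. T (a3 \<sigma> w) = a2 \<sigma> (T w)"
    using assms(2) by (auto simp: contains_subrep_def)
  have "Vector_Spaces.linear s3 s1 (S \<circ> T)" by (rule Vector_Spaces.linear_compose[OF T(1) S(1)])
  moreover have "inj (S \<circ> T)" by (rule inj_compose[OF S(2) T(2)])
  moreover have "\<forall>\<sigma> w. (S \<circ> T) (a3 \<sigma> w) = a1 \<sigma> ((S \<circ> T) w)" by (simp add: S(3) T(3))
  ultimately show ?thesis using assms unfolding contains_subrep_def by blast
qed

lemma independent_singles:
  "\<not> module.dependent scale_CPF (range (\<lambda>f. Poly_Mapping.single f 1 :: 'n::finite CPF))"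
proof -
  let ?e = "\<lambda>f. Poly_Mapping.single f 1 :: 'n CPF"
  have inj: "inj ?e" by (rule injI) (metis lookup_single_eq lookup_single_not_eq zero_neq_one)
  have "u (?e f) = 0" if "(\<Sum>v\<in>range ?e. scale_CPF (u v) v) = 0" for u f
  proof -
    have "0 = Poly_Mapping.lookup (\<Sum>g\<in>UNIV. scale_CPF (u (?e g)) (?e g)) f"
      using that by (simp add: sum.reindex[OF inj])
    also have "\<dots> = (\<Sum>g\<in>UNIV. u (?e g) * Poly_Mapping.lookup (?e g) f)"
      by (simp add: lookup_sum lookup_scale_CPF)
    also have "\<dots> = u (?e f)" by (simp add: lookup_single when_def if_distrib[of "\<lambda>c. _ * c"] cong: if_cong)
    finally show ?thesis by simp
  qed
  moreover have "finite (range ?e)" by simp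
  ultimately show ?thesis by (subst CPF.dependent_finite) auto
qed

text \<open>
  The dimension of an infinite-dimensional space is 0 by convention, so finiteness is needed for a
  lower bound.
\<close>
lemma dim_DH_ge:
  fixes T :: "'n::finite CPF \<Rightarrow> 'n DH"
  assumes "Vector_Spaces.linear scale_CPF scale_DH T" "inj T"
  shows "CARD('n pf) \<le> DH.dim (UNIV :: 'n DH set)"
proof -
  interpret T: Vector_Spaces.linear scale_CPF scale_DH T by (rule assms(1))
  let ?e = "\<lambda>f. Poly_Mapping.single f 1 :: 'n CPF"
  have inj: "inj ?e" by (rule injI) (metis lookup_single_eq lookup_single_not_eq zero_neq_one)
  have ind: "DH.independent (T ` range ?e)"
  proof (rule T.independent_injective_image)
    show "\<not> CPF.dependent (range ?e)" by (rule independent_singles)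
    show "inj_on T (CPF.span (range ?e))" using assms(2) by (rule inj_on_subset) simp
  qed
  obtain B :: "'n DH set" where B: "DH.independent B" "UNIV \<subseteq> DH.span B" "card B = DH.dim (UNIV :: 'n DH set)"
    using DH.basis_exists[of UNIV] by blast
  obtain B0 :: "'n DH set" where "finite B0" "DH.span B0 = UNIV" using DH_finite_span by blast
  then have "finite B" using DH.independent_span_bound[of B0 B] B(1) by auto
  then have "card (T ` range ?e) \<le> card B"
    using DH.independent_span_bound[OF _ ind, of B] B(2) by auto
  moreover have "card (T ` range ?e) = CARD('n pf)"
    unfolding image_comp by (rule card_image[OF inj_compose[OF assms(2) inj]])
  ultimately show ?thesis using B(3) by simp
qed

theorem mainTheorem8:
  shows "card (parking_functions :: ('n::finite \<Rightarrow> nat) set) = (CARD('n) + 1) ^ (CARD('n) - 1) \<and>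
    DH.dim (UNIV :: 'n DH set) \<ge> (CARD('n) + 1) ^ (CARD('n) - 1) \<and>
    contains_subrep (scale_DH :: complex \<Rightarrow> 'n DH \<Rightarrow> 'n DH) perm_DH
      (scale_CPF :: complex \<Rightarrow> 'n CPF \<Rightarrow> 'n CPF) (tensor_sign scale_CPF perm_CPF)"
proof (intro conjI)
  show card: "card (parking_functions :: ('n \<Rightarrow> nat) set) = (CARD('n) + 1) ^ (CARD('n) - 1)"
    by (rule card_parking_functions)
  show sub: "contains_subrep (scale_DH :: complex \<Rightarrow> 'n DH \<Rightarrow> 'n DH) perm_DH
      (scale_CPF :: complex \<Rightarrow> 'n CPF \<Rightarrow> 'n CPF) (tensor_sign scale_CPF perm_CPF)"
    by (rule contains_subrep_trans[OF pf_module_contained_in_DH pf_module_contains_CPF])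
  then obtain T :: "'n CPF \<Rightarrow> 'n DH" where "Vector_Spaces.linear scale_CPF scale_DH T" "inj T"
    by (auto simp: contains_subrep_def)
  then have "CARD('n pf) \<le> DH.dim (UNIV :: 'n DH set)" by (rule dim_DH_ge)
  then show "DH.dim (UNIV :: 'n DH set) \<ge> (CARD('n) + 1) ^ (CARD('n) - 1)"
    by (simp add: type_definition.card[OF type_definition_pf] card)
qed

end
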